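(* Let $(X,\mathcal{O}_X)$ be a ringed space satisfying (FT), and let $\mathcal{M}$ be a coherent $\mathcal{O}_X$-module such that for every open subset $U\subset X$, every coherent subquotient of $\mathcal{M}|_U$ satisfies (SH). Then every ascending chain $$\mathcal{K}_1\subset\mathcal{K}_2\subset\mathcal{K}_3\subset\dots\subset\mathcal{M}$$ of sub-$\mathcal{O}_X$-modules (not necessarily coherent) of $\mathcal{M}$ is stationary.
   Context: Rings are associative with unit, not necessarily commutative; modules are left modules. A ringed space $(X,\mathcal{O}_X)$ satisfies (FT) if (1) $X$ is sober (every irreducible closed subset has a unique generic point) and a noetherian topological space; (2) $\mathcal{O}_X$ is a coherent sheaf of rings and $\mathcal{O}_{X,x}$ is noetherian for every $x\in X$. A coherent $\mathcal{O}_X$-module $\mathcal{M}$ satisfies (SH) if there exists a finite family $\{Z_i\}_{i\in I}$ of irreducible closed subsets of $X$ such that for every open $U\subset X$ and every $s\in\Gamma(U,\mathcal{M})$ there is a subset $I'\subset I$ with $\mathrm{Supp}(s)=\bigcup_{i\in I'}Z_i\cap U$. For $\mathcal{M}|_U$ the condition is understood on the ringed space $(U,\mathcal{O}_X|_U)$. *)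

theory Defs
  imports "HOL-Analysis.Abstract_Topology" "HOL-Algebra.QuotRing" "HOL-Algebra.Module"
begin

section \<open>Topology\<close>

definition irreducible_closedin :: "'a topology \<Rightarrow> 'a set \<Rightarrow> bool" where
  "irreducible_closedin X Z \<longleftrightarrow> closedin X Z \<and> Z \<noteq> {} \<and>
     (\<forall>A B. closedin X A \<longrightarrow> closedin X B \<longrightarrow> Z = A \<union> B \<longrightarrow> Z = A \<or> Z = B)"

definition sober_space :: "'a topology \<Rightarrow> bool" where
  "sober_space X \<longleftrightarrow>
     (\<forall>Z. irreducible_closedin X Z \<longrightarrow> (\<exists>!x. x \<in> Z \<and> X closure_of {x} = Z))"

definition noetherian_space :: "'a topology \<Rightarrow> bool" where
  "noetherian_space X \<longleftrightarrow>
     (\<forall>C :: nat \<Rightarrow> 'a set. (\<forall>n. closedin X (C n)) \<longrightarrow> (\<forall>n. C (Suc n) \<subseteq> C n) \<longrightarrow>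
        (\<exists>N. \<forall>n\<ge>N. C n = C N))"


section \<open>Left modules over rings\<close>

text \<open>
  The locale \<^locale>\<open>module\<close> requires a commutative base ring. The record type
  \<^type>\<open>module_ext\<close> is reused; its fields \<^const>\<open>mult\<close> and \<^const>\<open>one\<close> play no role for a module.
\<close>

locale left_module = R?: ring R + M?: abelian_group M for R and M (structure) +
  assumes left_smult_closed:
      "\<lbrakk>a \<in> carrier R; x \<in> carrier M\<rbrakk> \<Longrightarrow> a \<odot>\<^bsub>M\<^esub> x \<in> carrier M"
    and left_smult_l_distr:
      "\<lbrakk>a \<in> carrier R; b \<in> carrier R; x \<in> carrier M\<rbrakk> \<Longrightarrow>
        (a \<oplus>\<^bsub>R\<^esub> b) \<odot>\<^bsub>M\<^esub> x = a \<odot>\<^bsub>M\<^esub> x \<oplus>\<^bsub>M\<^esub> b \<odot>\<^bsub>M\<^esub> x"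
    and left_smult_r_distr:
      "\<lbrakk>a \<in> carrier R; x \<in> carrier M; y \<in> carrier M\<rbrakk> \<Longrightarrow>
        a \<odot>\<^bsub>M\<^esub> (x \<oplus>\<^bsub>M\<^esub> y) = a \<odot>\<^bsub>M\<^esub> x \<oplus>\<^bsub>M\<^esub> a \<odot>\<^bsub>M\<^esub> y"
    and left_smult_assoc:
      "\<lbrakk>a \<in> carrier R; b \<in> carrier R; x \<in> carrier M\<rbrakk> \<Longrightarrow>
        (a \<otimes>\<^bsub>R\<^esub> b) \<odot>\<^bsub>M\<^esub> x = a \<odot>\<^bsub>M\<^esub> (b \<odot>\<^bsub>M\<^esub> x)"
    and left_smult_one:
      "x \<in> carrier M \<Longrightarrow> \<one>\<^bsub>R\<^esub> \<odot>\<^bsub>M\<^esub> x = x"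

definition regular_module :: "'r ring \<Rightarrow> ('r, 'r) module" where
  "regular_module R = \<lparr>carrier = carrier R, mult = undefined, one = undefined,
     zero = zero R, add = add R, smult = mult R\<rparr>"

text \<open>All modules being left modules, noetherian means left noetherian; this is
  implied by the two-sided notion. (The library's \<open>noetherian_ring\<close> only concerns
  two-sided ideals.)\<close>

definition left_noetherian :: "'r ring \<Rightarrow> bool" where
  "left_noetherian R \<longleftrightarrow>
     (\<forall>I :: nat \<Rightarrow> 'r set. (\<forall>n. submodule (I n) R (regular_module R)) \<longrightarrow>
        (\<forall>n. I n \<subseteq> I (Suc n)) \<longrightarrow> (\<exists>N. \<forall>n\<ge>N. I n = I N))"

definition quotient_module :: "('r, 'm) module \<Rightarrow> 'm set \<Rightarrow> ('r, 'm set) module" where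
  "quotient_module M L = \<lparr>carrier = a_rcosets\<^bsub>M\<^esub> L, mult = undefined, one = undefined,
     zero = L, add = set_add M, smult = (\<lambda>r A. \<Union>a\<in>A. L +>\<^bsub>M\<^esub> (r \<odot>\<^bsub>M\<^esub> a))\<rparr>"


section \<open>Sheaves of rings and modules\<close>

text \<open>
  Only the values of a presheaf on open sets matter. Hence the restriction of a sheaf on \<open>X\<close> to
  an open set \<open>U\<close> is given by the same record, considered on the space \<open>subtopology X U\<close>,
  whose open sets are the open subsets of \<open>X\<close> contained in \<open>U\<close>.
\<close>

record ('a, 'e, 's) presheaf =
  sections :: "'a set \<Rightarrow> 's"
  restr :: "'a set \<Rightarrow> 'a set \<Rightarrow> 'e \<Rightarrow> 'e"  \<comment> \<open>\<open>restr F U V\<close> restricts sections from \<open>U\<close> to \<open>V\<close>\<close>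

type_synonym ('a, 'r) ring_presheaf = "('a, 'r, 'r ring) presheaf"
type_synonym ('a, 'r, 'm) module_presheaf = "('a, 'm, ('r, 'm) module) presheaf"

definition is_presheaf ::
    "'a topology \<Rightarrow> ('a, 'e, ('e, 'z) partial_object_scheme) presheaf \<Rightarrow> bool" where
  "is_presheaf X F \<longleftrightarrow>
     (\<forall>U V. openin X U \<longrightarrow> openin X V \<longrightarrow> V \<subseteq> U \<longrightarrow>
        restr F U V \<in> carrier (sections F U) \<rightarrow> carrier (sections F V)) \<and>
     (\<forall>U. openin X U \<longrightarrow> (\<forall>s\<in>carrier (sections F U). restr F U U s = s)) \<and>
     (\<forall>U V W. openin X U \<longrightarrow> openin X V \<longrightarrow> openin X W \<longrightarrow> W \<subseteq> V \<longrightarrow> V \<subseteq> U \<longrightarrow>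
        (\<forall>s\<in>carrier (sections F U). restr F V W (restr F U V s) = restr F U W s))"

definition is_sheaf ::
    "'a topology \<Rightarrow> ('a, 'e, ('e, 'z) partial_object_scheme) presheaf \<Rightarrow> bool" where
  "is_sheaf X F \<longleftrightarrow> is_presheaf X F \<and>
     (\<forall>\<V> s. (\<forall>V\<in>\<V>. openin X V \<and> s V \<in> carrier (sections F V)) \<longrightarrow>
        (\<forall>V\<in>\<V>. \<forall>W\<in>\<V>. restr F V (V \<inter> W) (s V) = restr F W (V \<inter> W) (s W)) \<longrightarrow>
        (\<exists>!t. t \<in> carrier (sections F (\<Union>\<V>)) \<and> (\<forall>V\<in>\<V>. restr F (\<Union>\<V>) V t = s V)))"

definition ringed_space :: "'a topology \<Rightarrow> ('a, 'r) ring_presheaf \<Rightarrow> bool" where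
  "ringed_space X \<O> \<longleftrightarrow> is_sheaf X \<O> \<and>
     (\<forall>U. openin X U \<longrightarrow> ring (sections \<O> U)) \<and>
     (\<forall>U V. openin X U \<longrightarrow> openin X V \<longrightarrow> V \<subseteq> U \<longrightarrow>
        restr \<O> U V \<in> ring_hom (sections \<O> U) (sections \<O> V))"

definition module_sheaf ::
    "'a topology \<Rightarrow> ('a, 'r) ring_presheaf \<Rightarrow> ('a, 'r, 'm) module_presheaf \<Rightarrow> bool" where
  "module_sheaf X \<O> \<M> \<longleftrightarrow> is_sheaf X \<M> \<and>
     (\<forall>U. openin X U \<longrightarrow> left_module (sections \<O> U) (sections \<M> U)) \<and>
     (\<forall>U V. openin X U \<longrightarrow> openin X V \<longrightarrow> V \<subseteq> U \<longrightarrow>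
        (\<forall>s\<in>carrier (sections \<M> U). \<forall>t\<in>carrier (sections \<M> U).
           restr \<M> U V (s \<oplus>\<^bsub>sections \<M> U\<^esub> t) =
             restr \<M> U V s \<oplus>\<^bsub>sections \<M> V\<^esub> restr \<M> U V t) \<and>
        (\<forall>r\<in>carrier (sections \<O> U). \<forall>s\<in>carrier (sections \<M> U).
           restr \<M> U V (r \<odot>\<^bsub>sections \<M> U\<^esub> s) =
             restr \<O> U V r \<odot>\<^bsub>sections \<M> V\<^esub> restr \<M> U V s))"

text \<open>A subsheaf is given by its sets of sections, with the structure induced from the
  ambient sheaf.\<close>

definition subsheaf ::
    "('a, 'r, 'm) module_presheaf \<Rightarrow> ('a set \<Rightarrow> 'm set) \<Rightarrow> ('a, 'r, 'm) module_presheaf" where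
  "subsheaf \<M> \<K> =
     \<lparr>sections = (\<lambda>U. (sections \<M> U)\<lparr>carrier := \<K> U\<rparr>), restr = restr \<M>\<rparr>"

definition submodule_sheaf ::
    "'a topology \<Rightarrow> ('a, 'r) ring_presheaf \<Rightarrow> ('a, 'r, 'm) module_presheaf \<Rightarrow>
       ('a set \<Rightarrow> 'm set) \<Rightarrow> bool" where
  "submodule_sheaf X \<O> \<M> \<K> \<longleftrightarrow>
     (\<forall>U. openin X U \<longrightarrow> submodule (\<K> U) (sections \<O> U) (sections \<M> U)) \<and>
     is_sheaf X (subsheaf \<M> \<K>)"


section \<open>Stalks and supports\<close>

definition germ ::
    "'a topology \<Rightarrow> ('a, 'e, ('e, 'z) partial_object_scheme) presheaf \<Rightarrow>
       'a \<Rightarrow> 'a set \<Rightarrow> 'e \<Rightarrow> ('a set \<times> 'e) set" where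
  "germ X F x U s = {(V, t). openin X V \<and> x \<in> V \<and> t \<in> carrier (sections F V) \<and>
     (\<exists>W. openin X W \<and> x \<in> W \<and> W \<subseteq> U \<inter> V \<and> restr F U W s = restr F V W t)}"

definition stalk ::
    "'a topology \<Rightarrow> ('a, 'e, ('e, 'z) partial_object_scheme) presheaf \<Rightarrow>
       'a \<Rightarrow> ('a set \<times> 'e) set set" where
  "stalk X F x =
     {germ X F x U s | U s. openin X U \<and> x \<in> U \<and> s \<in> carrier (sections F U)}"

text \<open>The operation on germs induced by operations \<open>op W\<close> on sections over \<open>W\<close>; the germs in
  the union all coincide.\<close>

definition germ_map2 ::
    "'a topology \<Rightarrow> ('a, 'e, ('e, 'y) partial_object_scheme) presheaf \<Rightarrow>
       ('a, 'f, ('f, 'z) partial_object_scheme) presheaf \<Rightarrow> ('a set \<Rightarrow> 'e \<Rightarrow> 'f \<Rightarrow> 'f) \<Rightarrow> 'a \<Rightarrow>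
       ('a set \<times> 'e) set \<Rightarrow> ('a set \<times> 'f) set \<Rightarrow> ('a set \<times> 'f) set" where
  "germ_map2 X F G op x A B = (\<Union>(U, s)\<in>A. \<Union>(V, t)\<in>B.
     germ X G x (U \<inter> V) (op (U \<inter> V) (restr F U (U \<inter> V) s) (restr G V (U \<inter> V) t)))"

definition stalk_ring ::
    "'a topology \<Rightarrow> ('a, 'r) ring_presheaf \<Rightarrow> 'a \<Rightarrow> ('a set \<times> 'r) set ring" where
  "stalk_ring X \<O> x = \<lparr>carrier = stalk X \<O> x,
     mult = germ_map2 X \<O> \<O> (\<lambda>W. mult (sections \<O> W)) x,
     one = germ X \<O> x (topspace X) (one (sections \<O> (topspace X))),
     zero = germ X \<O> x (topspace X) (zero (sections \<O> (topspace X))),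
     add = germ_map2 X \<O> \<O> (\<lambda>W. add (sections \<O> W)) x\<rparr>"

definition stalk_module ::
    "'a topology \<Rightarrow> ('a, 'r) ring_presheaf \<Rightarrow> ('a, 'r, 'm) module_presheaf \<Rightarrow> 'a \<Rightarrow>
       (('a set \<times> 'r) set, ('a set \<times> 'm) set) module" where
  "stalk_module X \<O> \<M> x = \<lparr>carrier = stalk X \<M> x, mult = undefined, one = undefined,
     zero = germ X \<M> x (topspace X) (zero (sections \<M> (topspace X))),
     add = germ_map2 X \<M> \<M> (\<lambda>W. add (sections \<M> W)) x,
     smult = germ_map2 X \<O> \<M> (\<lambda>W. smult (sections \<M> W)) x\<rparr>"

definition supp ::
    "'a topology \<Rightarrow> ('a, 'r) ring_presheaf \<Rightarrow> ('a, 'r, 'm) module_presheaf \<Rightarrow>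
       'a set \<Rightarrow> 'm \<Rightarrow> 'a set" where
  "supp X \<O> \<M> U s = {x \<in> U. germ X \<M> x U s \<noteq> \<zero>\<^bsub>stalk_module X \<O> \<M> x\<^esub>}"


section \<open>Quotients and subquotients\<close>

definition sheafification ::
    "'a topology \<Rightarrow> ('a, 'r) ring_presheaf \<Rightarrow> ('a, 'r, 'm) module_presheaf \<Rightarrow>
       ('a, 'r, 'a \<Rightarrow> ('a set \<times> 'm) set) module_presheaf" where
  "sheafification X \<O> \<M> = \<lparr>
     sections = (\<lambda>U. \<lparr>
       carrier = {\<sigma> \<in> (\<Pi>\<^sub>E x\<in>U. stalk X \<M> x).
         \<forall>x\<in>U. \<exists>V t. openin X V \<and> x \<in> V \<and> V \<subseteq> U \<and> t \<in> carrier (sections \<M> V) \<and>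
           (\<forall>y\<in>V. \<sigma> y = germ X \<M> y V t)},
       mult = undefined, one = undefined,
       zero = (\<lambda>x\<in>U. \<zero>\<^bsub>stalk_module X \<O> \<M> x\<^esub>),
       add = (\<lambda>\<sigma> \<tau>. \<lambda>x\<in>U. \<sigma> x \<oplus>\<^bsub>stalk_module X \<O> \<M> x\<^esub> \<tau> x),
       smult = (\<lambda>r \<sigma>. \<lambda>x\<in>U. germ X \<O> x U r \<odot>\<^bsub>stalk_module X \<O> \<M> x\<^esub> \<sigma> x)\<rparr>),
     restr = (\<lambda>U V \<sigma>. restrict \<sigma> V)\<rparr>"

definition quotient_presheaf ::
    "('a, 'r, 'm) module_presheaf \<Rightarrow> ('a set \<Rightarrow> 'm set) \<Rightarrow> ('a, 'r, 'm set) module_presheaf" where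
  "quotient_presheaf \<M> \<L> = \<lparr>
     sections = (\<lambda>U. quotient_module (sections \<M> U) (\<L> U)),
     restr = (\<lambda>U V A. \<Union>a\<in>A. \<L> V +>\<^bsub>sections \<M> V\<^esub> restr \<M> U V a)\<rparr>"

definition quotient_sheaf ::
    "'a topology \<Rightarrow> ('a, 'r) ring_presheaf \<Rightarrow> ('a, 'r, 'm) module_presheaf \<Rightarrow>
       ('a set \<Rightarrow> 'm set) \<Rightarrow> ('a, 'r, 'a \<Rightarrow> ('a set \<times> 'm set) set) module_presheaf" where
  "quotient_sheaf X \<O> \<M> \<L> = sheafification X \<O> (quotient_presheaf \<M> \<L>)"

text \<open>\<open>\<N>\<close> is \<open>\<K>/\<L>\<close> for \<open>\<O>\<close>-submodules \<open>\<L> \<subseteq> \<K> \<subseteq> \<M>\<close>, neither of which need be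
  coherent.\<close>

definition subquotient_sheaf ::
    "'a topology \<Rightarrow> ('a, 'r) ring_presheaf \<Rightarrow> ('a, 'r, 'm) module_presheaf \<Rightarrow>
       ('a, 'r, 'a \<Rightarrow> ('a set \<times> 'm set) set) module_presheaf \<Rightarrow> bool" where
  "subquotient_sheaf X \<O> \<M> \<N> \<longleftrightarrow>
     (\<exists>\<K> \<L>. submodule_sheaf X \<O> \<M> \<K> \<and> submodule_sheaf X \<O> \<M> \<L> \<and>
        (\<forall>U. openin X U \<longrightarrow> \<L> U \<subseteq> \<K> U) \<and>
        \<N> = quotient_sheaf X \<O> (subsheaf \<M> \<K>) \<L>)"


section \<open>Coherence\<close>

definition regular_sheaf :: "('a, 'r) ring_presheaf \<Rightarrow> ('a, 'r, 'r) module_presheaf" where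
  "regular_sheaf \<O> = \<lparr>sections = (\<lambda>U. regular_module (sections \<O> U)), restr = restr \<O>\<rparr>"

text \<open>The free module \<open>\<O>\<^sup>n\<close>.\<close>

definition free_sheaf ::
    "('a, 'r) ring_presheaf \<Rightarrow> nat \<Rightarrow> ('a, 'r, nat \<Rightarrow> 'r) module_presheaf" where
  "free_sheaf \<O> n = \<lparr>
     sections = (\<lambda>U. \<lparr>carrier = (\<Pi>\<^sub>E i\<in>{..<n}. carrier (sections \<O> U)),
       mult = undefined, one = undefined,
       zero = (\<lambda>i\<in>{..<n}. \<zero>\<^bsub>sections \<O> U\<^esub>),
       add = (\<lambda>f g. \<lambda>i\<in>{..<n}. f i \<oplus>\<^bsub>sections \<O> U\<^esub> g i),
       smult = (\<lambda>r f. \<lambda>i\<in>{..<n}. r \<otimes>\<^bsub>sections \<O> U\<^esub> f i)\<rparr>),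
     restr = (\<lambda>U V f. \<lambda>i\<in>{..<n}. restr \<O> U V (f i))\<rparr>"

text \<open>The morphism \<open>\<O>\<^sup>n|\<^sub>U \<rightarrow> \<M>|\<^sub>U\<close> given by sections \<open>s 0, \<dots>, s (n - 1)\<close> of \<open>\<M>\<close> over \<open>U\<close>,
  evaluated on sections over an open subset \<open>V\<close> of \<open>U\<close>. Every such morphism is of this form.\<close>

definition free_hom ::
    "('a, 'r, 'm) module_presheaf \<Rightarrow> nat \<Rightarrow> 'a set \<Rightarrow> (nat \<Rightarrow> 'm) \<Rightarrow> 'a set \<Rightarrow>
       (nat \<Rightarrow> 'r) \<Rightarrow> 'm" where
  "free_hom \<M> n U s V f =
     (\<Oplus>\<^bsub>sections \<M> V\<^esub>i\<in>{..<n}. f i \<odot>\<^bsub>sections \<M> V\<^esub> restr \<M> U V (s i))"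

definition free_hom_ker ::
    "('a, 'r) ring_presheaf \<Rightarrow> ('a, 'r, 'm) module_presheaf \<Rightarrow> nat \<Rightarrow> 'a set \<Rightarrow> (nat \<Rightarrow> 'm) \<Rightarrow>
       'a set \<Rightarrow> (nat \<Rightarrow> 'r) set" where
  "free_hom_ker \<O> \<M> n U s V =
     {f \<in> carrier (sections (free_sheaf \<O> n) V). free_hom \<M> n U s V f = \<zero>\<^bsub>sections \<M> V\<^esub>}"

text \<open>Locally \<open>\<M>\<close> is a quotient of some \<open>\<O>\<^sup>n\<close>; an epimorphism of sheaves is surjective only
  up to refinement of open sets.\<close>

definition finite_type ::
    "'a topology \<Rightarrow> ('a, 'r) ring_presheaf \<Rightarrow> ('a, 'r, 'm) module_presheaf \<Rightarrow> bool" where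
  "finite_type X \<O> \<M> \<longleftrightarrow>
     (\<forall>x\<in>topspace X. \<exists>U n s. openin X U \<and> x \<in> U \<and> (\<forall>i<n. s i \<in> carrier (sections \<M> U)) \<and>
        (\<forall>V t. openin X V \<longrightarrow> V \<subseteq> U \<longrightarrow> t \<in> carrier (sections \<M> V) \<longrightarrow>
           (\<forall>y\<in>V. \<exists>W f. openin X W \<and> y \<in> W \<and> W \<subseteq> V \<and>
              f \<in> carrier (sections (free_sheaf \<O> n) W) \<and>
              restr \<M> V W t = free_hom \<M> n U s W f)))"

definition coherent_sheaf ::
    "'a topology \<Rightarrow> ('a, 'r) ring_presheaf \<Rightarrow> ('a, 'r, 'm) module_presheaf \<Rightarrow> bool" where
  "coherent_sheaf X \<O> \<M> \<longleftrightarrow> module_sheaf X \<O> \<M> \<and> finite_type X \<O> \<M> \<and>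
     (\<forall>U n s. openin X U \<longrightarrow> (\<forall>i<n. s i \<in> carrier (sections \<M> U)) \<longrightarrow>
        finite_type (subtopology X U) \<O> (subsheaf (free_sheaf \<O> n) (free_hom_ker \<O> \<M> n U s)))"


section \<open>The conditions (FT) and (SH)\<close>

definition FT :: "'a topology \<Rightarrow> ('a, 'r) ring_presheaf \<Rightarrow> bool" where
  "FT X \<O> \<longleftrightarrow> ringed_space X \<O> \<and>
     sober_space X \<and> noetherian_space X \<and>
     coherent_sheaf X \<O> (regular_sheaf \<O>) \<and>
     (\<forall>x\<in>topspace X. left_noetherian (stalk_ring X \<O> x))"

definition SH ::
    "'a topology \<Rightarrow> ('a, 'r) ring_presheaf \<Rightarrow> ('a, 'r, 'm) module_presheaf \<Rightarrow> bool" where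
  "SH X \<O> \<M> \<longleftrightarrow>
     (\<exists>\<Z>. finite \<Z> \<and> (\<forall>Z\<in>\<Z>. irreducible_closedin X Z) \<and>
        (\<forall>U s. openin X U \<longrightarrow> s \<in> carrier (sections \<M> U) \<longrightarrow>
           (\<exists>\<Z>'\<subseteq>\<Z>. supp X \<O> \<M> U s = (\<Union>Z\<in>\<Z>'. Z \<inter> U))))"

end

theory Submission
  imports Defs
begin

text \<open>
  The proof is a noetherian induction on the closed sets along which the chain is to become
  stationary. Finite unions being harmless, let \<open>C\<close> be irreducible with generic point \<open>x\<close>. As the
  stalk of \<open>\<M>\<close> at \<open>x\<close> is a noetherian module, finitely many sections of some \<open>\<K> N\<close>, over a
  neighbourhood \<open>V\<close> of \<open>x\<close>, generate the stalks at \<open>x\<close> of all \<open>\<K> n\<close>. Let \<open>\<L>\<close> be the submodule of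
  \<open>\<M>\<close> over \<open>V\<close> generated by them. Then \<open>\<M>/\<L>\<close> is coherent, so (SH) provides a finite family of
  irreducible closed sets whose unions include all supports of its sections. Remove from \<open>V\<close> the
  members of the family that do not contain \<open>x\<close>. An open set \<open>W\<close> that meets \<open>C\<close> contains \<open>x\<close>, hence
  the class in \<open>\<M>/\<L>\<close> of a section of \<open>\<K> n\<close> over such a \<open>W \<subseteq> V\<close> has a support avoiding \<open>x\<close>, which
  is therefore empty: the section lies in \<open>\<L> \<subseteq> \<K> N\<close>. What remains of \<open>C\<close> is a smaller closed set.
\<close>

section \<open>Finitely generated submodules over left noetherian rings\<close>

text \<open>The \<open>\<K> n\<close> need not be coherent, so generators of the stalk at the
  generic point \<open>x\<close> have no reason to generate on a neighbourhood: every section of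
  \<open>\<K> n\<close> around \<open>x\<close> falls into \<open>\<L>\<close> near
  \<open>x\<close>, but the neighbourhood depends on the section and may shrink without bound as the
  section and \<open>n\<close> vary. (SH) makes it uniform: one finite family controls the supports
  of all sections of \<open>\<M>/\<L>\<close> over all open subsets at once. Since (SH) is available
  for coherent subquotients only, the quotient is taken of \<open>\<M>\<close> and not of the
  \<open>\<K> n\<close>; it receives the classes of all of them, and it is coherent because
  \<open>\<L>\<close> is generated by finitely many sections. As \<open>\<M>/\<L>\<close> is a
  sheafification, its zero sections have to be identified: they come from \<open>\<L>\<close>
  because membership in a subsheaf is local. Stationarity along a subset is a pointwise condition
  with one common index, hence compatible with finite unions and meaningful on locally closed
  sets.\<close>

context left_module
begin

lemma smult_l_null: "x \<in> carrier M \<Longrightarrow> \<zero>\<^bsub>R\<^esub> \<odot> x = \<zero>"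
proof -
  assume x: "x \<in> carrier M"
  have c: "\<zero>\<^bsub>R\<^esub> \<odot> x \<in> carrier M"
    using x by (simp add: left_smult_closed)
  have "\<zero>\<^bsub>R\<^esub> \<odot> x \<oplus> \<zero>\<^bsub>R\<^esub> \<odot> x = \<zero>\<^bsub>R\<^esub> \<odot> x"
    using left_smult_l_distr[of "\<zero>\<^bsub>R\<^esub>" "\<zero>\<^bsub>R\<^esub>" x] x by simp
  then show ?thesis
    using c M.add.r_cancel_one by blast
qed

lemma smult_r_null: "a \<in> carrier R \<Longrightarrow> a \<odot> \<zero> = \<zero>"
proof -
  assume a: "a \<in> carrier R"
  have c: "a \<odot> \<zero> \<in> carrier M"
    using a by (simp add: left_smult_closed)
  have "a \<odot> \<zero> \<oplus> a \<odot> \<zero> = a \<odot> \<zero>"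
    using left_smult_r_distr[of a "\<zero>" "\<zero>"] a by simp
  then show ?thesis
    using c M.add.r_cancel_one by blast
qed

lemma smult_minus_one:
  assumes x: "x \<in> carrier M"
  shows "(\<ominus>\<^bsub>R\<^esub> \<one>\<^bsub>R\<^esub>) \<odot> x = \<ominus> x"
proof -
  have "(\<ominus>\<^bsub>R\<^esub> \<one>\<^bsub>R\<^esub>) \<odot> x \<oplus> x = (\<ominus>\<^bsub>R\<^esub> \<one>\<^bsub>R\<^esub> \<oplus>\<^bsub>R\<^esub> \<one>\<^bsub>R\<^esub>) \<odot> x"
    using x by (simp add: left_smult_l_distr left_smult_one)
  also have "\<dots> = \<zero>"
    using x by (simp add: R.l_neg smult_l_null)
  finally show ?thesis
    using x by (simp add: M.minus_equality left_smult_closed)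
qed

text \<open>Closure under negation is automatic, \<open>\<ominus> x\<close> being the multiple of
  \<open>x\<close> by minus one.\<close>

lemma left_submoduleI:
  assumes "H \<subseteq> carrier M" "\<zero> \<in> H"
    and add: "\<And>x y. x \<in> H \<Longrightarrow> y \<in> H \<Longrightarrow> x \<oplus> y \<in> H"
    and smult: "\<And>a x. a \<in> carrier R \<Longrightarrow> x \<in> H \<Longrightarrow> a \<odot> x \<in> H"
  shows "submodule H R M"
proof (intro submodule.intro subgroup.intro)
  fix x assume "x \<in> H"
  then have "\<ominus> x \<in> H"
    using smult[of "\<ominus>\<^bsub>R\<^esub> \<one>\<^bsub>R\<^esub>" x] assms(1) by (auto simp: smult_minus_one)
  then show "inv\<^bsub>add_monoid M\<^esub> x \<in> H"
    by (simp add: a_inv_def)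
qed (use assms in \<open>auto simp: submodule_axioms_def\<close>)

lemma left_submoduleD:
  assumes "submodule H R M"
  shows "H \<subseteq> carrier M" "\<zero> \<in> H"
    and "\<And>x y. x \<in> H \<Longrightarrow> y \<in> H \<Longrightarrow> x \<oplus> y \<in> H"
    and "\<And>a x. a \<in> carrier R \<Longrightarrow> x \<in> H \<Longrightarrow> a \<odot> x \<in> H"
    and "\<And>x. x \<in> H \<Longrightarrow> \<ominus> x \<in> H"
    and "\<And>x y. x \<in> H \<Longrightarrow> y \<in> H \<Longrightarrow> x \<ominus> y \<in> H"
proof -
  interpret submodule H R M by fact
  show "H \<subseteq> carrier M" "\<zero> \<in> H"
    and 1: "\<And>x y. x \<in> H \<Longrightarrow> y \<in> H \<Longrightarrow> x \<oplus> y \<in> H"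
    and "\<And>a x. a \<in> carrier R \<Longrightarrow> x \<in> H \<Longrightarrow> a \<odot> x \<in> H"
    and 2: "\<And>x. x \<in> H \<Longrightarrow> \<ominus> x \<in> H"
    using subset one_closed m_closed m_inv_closed by (auto simp: a_inv_def)
  show "x \<in> H \<Longrightarrow> y \<in> H \<Longrightarrow> x \<ominus> y \<in> H" for x y
    unfolding a_minus_def using 1 2 by blast
qed

lemma left_submodule_abelian_subgroup:
  assumes "submodule H R M"
  shows "abelian_subgroup H M"
proof (rule abelian_subgroupI3[OF additive_subgroup.intro])
  show "subgroup H (add_monoid M)"
    using assms by (simp add: submodule_def)
qed (rule M.abelian_group_axioms)

lemma carrier_submodule: "submodule (carrier M) R M"
  by (rule left_submoduleI) (auto simp: left_smult_closed)

lemma Int_submodule: "submodule H R M \<Longrightarrow> submodule K R M \<Longrightarrow> submodule (H \<inter> K) R M"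
  by (rule left_submoduleI) (auto dest: left_submoduleD)

lemma left_module_submodule:
  assumes "submodule H R M"
  shows "left_module R (M\<lparr>carrier := H\<rparr>)"
proof -
  note H = left_submoduleD[OF assms]
  have sub: "x \<in> H \<Longrightarrow> x \<in> carrier M" for x
    using H(1) by blast
  have "abelian_group (M\<lparr>carrier := H\<rparr>)"
  proof (rule abelian_groupI)
    show "\<exists>y\<in>carrier (M\<lparr>carrier := H\<rparr>). y \<oplus>\<^bsub>M\<lparr>carrier := H\<rparr>\<^esub> x = \<zero>\<^bsub>M\<lparr>carrier := H\<rparr>\<^esub>"
      if "x \<in> carrier (M\<lparr>carrier := H\<rparr>)" for x
      using that H(5)[of x] by (auto simp: sub M.l_neg intro!: bexI[of _ "\<ominus> x"])
  qed (auto simp: sub H(2) H(3) M.a_assoc intro: M.a_comm)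
  then show ?thesis
    unfolding left_module_def left_module_axioms_def using R.ring_axioms
    by (auto simp: sub H(4) left_smult_closed left_smult_l_distr left_smult_r_distr left_smult_assoc
        left_smult_one)
qed

end

section \<open>Spans and finite generation\<close>

definition left_span :: "('r, 'y) ring_scheme \<Rightarrow> ('r, 'm, 'z) module_scheme \<Rightarrow> 'm set \<Rightarrow> 'm set" where
  "left_span R M S = \<Inter>{H. submodule H R M \<and> S \<subseteq> H}"

text \<open>For a submodule \<open>H\<close> the two inclusions say that \<open>F\<close> spans
  \<open>H\<close>, since the span of \<open>F\<close> is contained in \<open>H\<close> by
  \<open>left_span_least\<close>.\<close>

definition fg_submodule :: "('r, 'y) ring_scheme \<Rightarrow> ('r, 'm, 'z) module_scheme \<Rightarrow> 'm set \<Rightarrow> bool" where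
  "fg_submodule R M H \<longleftrightarrow> (\<exists>F. finite F \<and> F \<subseteq> H \<and> H \<subseteq> left_span R M F)"

lemma left_span_superset: "S \<subseteq> left_span R M S"
  by (auto simp: left_span_def)

lemma left_span_least: "submodule H R M \<Longrightarrow> S \<subseteq> H \<Longrightarrow> left_span R M S \<subseteq> H"
  by (auto simp: left_span_def)

lemma left_span_mono: "S \<subseteq> T \<Longrightarrow> left_span R M S \<subseteq> left_span R M T"
  by (auto simp: left_span_def)

lemma (in left_module) submodule_left_span:
  assumes "S \<subseteq> carrier M"
  shows "submodule (left_span R M S) R M"
proof (rule left_submoduleI)
  show "left_span R M S \<subseteq> carrier M"
    using carrier_submodule assms by (rule left_span_least)
qed (auto simp: left_span_def left_submoduleD)

lemma left_module_regular: "ring R \<Longrightarrow> left_module R (regular_module R)"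
proof -
  assume "ring R"
  then interpret ring R .
  have "abelian_group (regular_module R)"
    by (rule abelian_groupI)
      (auto simp: regular_module_def a_assoc l_neg intro: a_comm bexI[of _ "a_inv R _"])
  then show ?thesis
    unfolding left_module_def left_module_axioms_def using \<open>ring R\<close>
    by (auto simp: regular_module_def l_distr r_distr m_assoc)
qed

text \<open>Otherwise an element outside the span of those chosen so far could always be added, and
  the successive spans would form a strictly ascending chain of left ideals. Finite generation is
  the form in which the noetherian property is passed on to modules.\<close>

lemma left_noetherian_fg:
  assumes R: "ring R" and noeth: "left_noetherian R" and J: "submodule J R (regular_module R)"
  shows "fg_submodule R (regular_module R) J"
proof (rule ccontr)
  interpret left_module R "regular_module R"
    by (rule left_module_regular[OF R])
  let ?span = "left_span R (regular_module R)"
  assume not_fg: "\<not> fg_submodule R (regular_module R) J"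
  have new: "\<exists>a. a \<in> J \<and> a \<notin> ?span F" if "finite F" "F \<subseteq> J" for F
    using not_fg that unfolding fg_submodule_def by blast
  define F where "F = rec_nat {} (\<lambda>_ F. insert (SOME a. a \<in> J \<and> a \<notin> ?span F) F)"
  have F_Suc: "F (Suc n) = insert (SOME a. a \<in> J \<and> a \<notin> ?span (F n)) (F n)" for n
    by (simp add: F_def)
  have F: "finite (F n) \<and> F n \<subseteq> J" for n
  proof (induction n)
    case (Suc n)
    then show ?case
      using someI_ex[OF new[of "F n"]] by (simp add: F_Suc)
  qed (simp add: F_def)
  have proper: "?span (F (Suc n)) \<noteq> ?span (F n)" for n
  proof -
    have "(SOME a. a \<in> J \<and> a \<notin> ?span (F n)) \<notin> ?span (F n)"
      using someI_ex[OF new[of "F n"]] F by blast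
    moreover have "(SOME a. a \<in> J \<and> a \<notin> ?span (F n)) \<in> ?span (F (Suc n))"
      using left_span_superset[of "F (Suc n)" R "regular_module R"] by (auto simp: F_Suc)
    ultimately show ?thesis by metis
  qed
  have "submodule (?span (F n)) R (regular_module R)" for n
    using F left_submoduleD(1)[OF J] by (intro submodule_left_span) blast
  moreover have "?span (F n) \<subseteq> ?span (F (Suc n))" for n
    by (rule left_span_mono) (auto simp: F_Suc)
  ultimately obtain N where "\<forall>n\<ge>N. ?span (F n) = ?span (F N)"
    using noeth unfolding left_noetherian_def by meson
  then show False
    using proper[of N] by (meson le_Suc_eq order_refl)
qed

section \<open>Submodules of finitely generated modules\<close>

context
  fixes R :: "'r ring" and M :: "('r, 'm, 'z) module_scheme" (structure)
  assumes left_module: "left_module R M"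
begin

interpretation left_module R M by (rule left_module)

text \<open>The counterpart of the ideal of leading coefficients in Hilbert's basis theorem: with
  \<open>K\<close> spanned by the remaining generators, it collects the coefficients at
  \<open>s\<close> of elements of \<open>H\<close>. The submodule \<open>H\<close> is kept variable
  because the ideals of two submodules are compared in the induction below.\<close>

lemma submodule_left_coefficients:
  assumes s: "s \<in> carrier M" and H: "submodule H R M" and K: "submodule K R M"
  shows "submodule {r \<in> carrier R. \<exists>m\<in>K. r \<odot> s \<oplus> m \<in> H} R (regular_module R)"
    (is "submodule ?J _ _")
proof (rule left_module.left_submoduleI[OF left_module_regular[OF R.ring_axioms]])
  show "?J \<subseteq> carrier (regular_module R)"
    by (auto simp: regular_module_def)
  show "\<zero>\<^bsub>regular_module R\<^esub> \<in> ?J"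
    using left_submoduleD(2)[OF H] left_submoduleD(2)[OF K] s
    by (auto simp: regular_module_def smult_l_null intro!: bexI[of _ "\<zero>"])
next
  fix a b assume "a \<in> ?J" "b \<in> ?J"
  then obtain m n where ab: "a \<in> carrier R" "b \<in> carrier R" and mn: "m \<in> K" "n \<in> K"
    and H': "a \<odot> s \<oplus> m \<in> H" "b \<odot> s \<oplus> n \<in> H" by blast
  have "m \<in> carrier M" "n \<in> carrier M"
    using left_submoduleD(1)[OF K] mn by auto
  then have "(a \<odot> s \<oplus> m) \<oplus> (b \<odot> s \<oplus> n) = (a \<oplus>\<^bsub>R\<^esub> b) \<odot> s \<oplus> (m \<oplus> n)"
    using ab s by (simp add: left_smult_l_distr left_smult_closed M.a_ac)
  then show "a \<oplus>\<^bsub>regular_module R\<^esub> b \<in> ?J"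
    using ab left_submoduleD(3)[OF K mn] left_submoduleD(3)[OF H H']
    by (auto simp: regular_module_def)
next
  fix a b assume "a \<in> carrier R" "b \<in> ?J"
  then obtain n where ab: "a \<in> carrier R" "b \<in> carrier R" and n: "n \<in> K"
    and bn: "b \<odot> s \<oplus> n \<in> H" by blast
  have "n \<in> carrier M"
    using left_submoduleD(1)[OF K] n by auto
  then have "a \<odot> (b \<odot> s \<oplus> n) = (a \<otimes>\<^bsub>R\<^esub> b) \<odot> s \<oplus> a \<odot> n"
    using ab s by (simp add: left_smult_r_distr left_smult_closed left_smult_assoc)
  then show "a \<odot>\<^bsub>regular_module R\<^esub> b \<in> ?J"
    using ab left_submoduleD(4)[OF K ab(1) n] left_submoduleD(4)[OF H ab(1) bn]
    by (auto simp: regular_module_def)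
qed

text \<open>The sums of this form already make up a submodule containing \<open>s\<close> and
  \<open>S\<close>.\<close>

lemma left_span_insert:
  assumes s: "s \<in> carrier M" and S: "S \<subseteq> carrier M" and h: "h \<in> left_span R M (insert s S)"
  shows "\<exists>r\<in>carrier R. \<exists>m\<in>left_span R M S. h = r \<odot> s \<oplus> m"
proof -
  note K = left_submoduleD[OF submodule_left_span[OF S]]
  let ?H = "{r \<odot> s \<oplus> m | r m. r \<in> carrier R \<and> m \<in> left_span R M S}"
  have "submodule ?H R M"
  proof (rule left_submoduleI)
    show "?H \<subseteq> carrier M"
      using K(1) s by (auto simp: left_smult_closed)
    have "\<zero> = \<zero>\<^bsub>R\<^esub> \<odot> s \<oplus> \<zero>"
      using s by (simp add: smult_l_null)
    then show "\<zero> \<in> ?H"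
      using K(2) by blast
  next
    fix x y assume "x \<in> ?H" "y \<in> ?H"
    then obtain a m b n where x: "x = a \<odot> s \<oplus> m" and y: "y = b \<odot> s \<oplus> n"
      and *: "a \<in> carrier R" "b \<in> carrier R" "m \<in> left_span R M S" "n \<in> left_span R M S" by blast
    then have "m \<in> carrier M" "n \<in> carrier M"
      using K(1) by auto
    then have "x \<oplus> y = (a \<oplus>\<^bsub>R\<^esub> b) \<odot> s \<oplus> (m \<oplus> n)"
      using * s by (simp add: x y left_smult_l_distr left_smult_closed M.a_ac)
    then show "x \<oplus> y \<in> ?H"
      using * K(3) by blast
  next
    fix a x assume a: "a \<in> carrier R" and "x \<in> ?H"
    then obtain b n where x: "x = b \<odot> s \<oplus> n"
      and *: "b \<in> carrier R" "n \<in> left_span R M S" by blast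
    then have "n \<in> carrier M"
      using K(1) by auto
    then have "a \<odot> x = (a \<otimes>\<^bsub>R\<^esub> b) \<odot> s \<oplus> a \<odot> n"
      using * a s by (simp add: x left_smult_r_distr left_smult_closed left_smult_assoc)
    then show "a \<odot> x \<in> ?H"
      using * a K(4) by blast
  qed
  moreover have "insert s S \<subseteq> ?H"
  proof -
    have "s = \<one>\<^bsub>R\<^esub> \<odot> s \<oplus> \<zero>"
      using s by (simp add: left_smult_one)
    moreover have "x = \<zero>\<^bsub>R\<^esub> \<odot> s \<oplus> x" if "x \<in> S" for x
      using s S that by (auto simp: smult_l_null)
    ultimately show ?thesis
      using K(2) left_span_superset[of S R M] R.zero_closed R.one_closed by blast
  qed
  ultimately have "left_span R M (insert s S) \<subseteq> ?H"
    by (rule left_span_least)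
  with h show ?thesis by blast
qed

text \<open>Induction on the number of generators. With \<open>K\<close> the span of
  \<open>S\<close>, an element of \<open>H\<close> is determined modulo \<open>H \<inter> K\<close>
  by a coefficient at \<open>s\<close>, and the possible coefficients form a left ideal. The ideal
  is finitely generated by \<open>left_noetherian_fg\<close>, the intersection by the induction
  hypothesis; generators of the intersection together with lifts of generators of the ideal generate
  \<open>H\<close>.\<close>

theorem fg_submodule_noetherian:
  assumes noeth: "left_noetherian R" and "finite S" "S \<subseteq> carrier M"
    and "submodule H R M" "H \<subseteq> left_span R M S"
  shows "fg_submodule R M H"
  using assms(2-)
proof (induction S arbitrary: H rule: finite_induct)
  case empty
  then show ?case
    unfolding fg_submodule_def by blast
next
  case (insert s S)
  have s: "s \<in> carrier M" and S: "S \<subseteq> carrier M"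
    using insert.prems by auto
  let ?K = "left_span R M S"
  let ?J = "{r \<in> carrier R. \<exists>m\<in>?K. r \<odot> s \<oplus> m \<in> H}"
  note K = submodule_left_span[OF S]
  note HD = left_submoduleD[OF \<open>submodule H R M\<close>]
  have "fg_submodule R (regular_module R) ?J"
    using R.ring_axioms noeth submodule_left_coefficients[OF s \<open>submodule H R M\<close> K]
    by (rule left_noetherian_fg)
  then obtain A where A: "finite A" "A \<subseteq> ?J" "?J \<subseteq> left_span R (regular_module R) A"
    unfolding fg_submodule_def by blast
  then have "\<forall>a\<in>A. \<exists>m. m \<in> ?K \<and> a \<odot> s \<oplus> m \<in> H"
    by blast
  \<comment> \<open>\<open>m\<close> lifts each generator \<open>a\<close> of the ideal to an
    element of \<open>H\<close> with coefficient \<open>a\<close> at \<open>s\<close>.\<close>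
  then obtain m where m: "\<And>a. a \<in> A \<Longrightarrow> m a \<in> ?K \<and> a \<odot> s \<oplus> m a \<in> H"
    by metis
  obtain F where F: "finite F" "F \<subseteq> H \<inter> ?K" "H \<inter> ?K \<subseteq> left_span R M F"
    using insert.IH[OF S Int_submodule[OF \<open>submodule H R M\<close> K]] unfolding fg_submodule_def by blast
  let ?G = "F \<union> (\<lambda>a. a \<odot> s \<oplus> m a) ` A"
  have G: "?G \<subseteq> H" "finite ?G"
    using F A m by auto
  have GM: "?G \<subseteq> carrier M"
    using G HD(1) by blast
  note GD = left_submoduleD[OF submodule_left_span[OF GM]]
  have GH: "left_span R M ?G \<subseteq> H"
    using \<open>submodule H R M\<close> G(1) by (rule left_span_least)
  \<comment> \<open>The coefficients realised inside the span of \<open>?G\<close> form a left ideal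
    as well. It contains \<open>A\<close> and hence \<open>?J\<close>: each coefficient occurring in
    \<open>H\<close> is realised in that span.\<close>
  have "submodule {r \<in> carrier R. \<exists>n\<in>?K. r \<odot> s \<oplus> n \<in> left_span R M ?G} R (regular_module R)"
    using s submodule_left_span[OF GM] K by (rule submodule_left_coefficients)
  moreover have "A \<subseteq> {r \<in> carrier R. \<exists>n\<in>?K. r \<odot> s \<oplus> n \<in> left_span R M ?G}"
    using A(2) m left_span_superset[of ?G R M] by blast
  ultimately have J: "?J \<subseteq> {r \<in> carrier R. \<exists>n\<in>?K. r \<odot> s \<oplus> n \<in> left_span R M ?G}"
    using A(3) left_span_least by (meson subset_trans)
  have "H \<subseteq> left_span R M ?G"
  proof
    fix h assume h: "h \<in> H"
    then obtain r k where r: "r \<in> carrier R" "k \<in> ?K" "h = r \<odot> s \<oplus> k"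
      using left_span_insert[OF s S] insert.prems(3) by blast
    with h J obtain n where n: "n \<in> ?K" "r \<odot> s \<oplus> n \<in> left_span R M ?G"
      by blast
    have c: "n \<in> carrier M" "k \<in> carrier M" "r \<odot> s \<in> carrier M" "h \<in> carrier M"
      using n r left_submoduleD(1)[OF K] s h HD(1) by (auto simp: left_smult_closed)
    \<comment> \<open>Subtracting an element of the span of \<open>?G\<close> with the same
      coefficient \<open>r\<close> leaves a remainder in \<open>H \<inter> ?K\<close>, which is
      contained in the span of \<open>F\<close>.\<close>
    have eq: "h \<ominus> (r \<odot> s \<oplus> n) = k \<ominus> n"
      using c unfolding r(3) a_minus_def
      by (simp add: M.minus_add M.a_ac M.r_neg M.r_neg1 M.r_neg2)
    have "h \<ominus> (r \<odot> s \<oplus> n) \<in> H"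
      using HD(6)[OF h] n(2) GH by blast
    moreover have "k \<ominus> n \<in> ?K"
      using left_submoduleD(6)[OF K] r n by blast
    ultimately have "h \<ominus> (r \<odot> s \<oplus> n) \<in> left_span R M F"
      using F(3) eq by auto
    also have "\<dots> \<subseteq> left_span R M ?G"
      by (rule left_span_mono) simp
    finally have "(h \<ominus> (r \<odot> s \<oplus> n)) \<oplus> (r \<odot> s \<oplus> n) \<in> left_span R M ?G"
      using GD(3) n(2) by blast
    moreover have "(h \<ominus> (r \<odot> s \<oplus> n)) \<oplus> (r \<odot> s \<oplus> n) = h"
      using c by (simp add: a_minus_def M.a_assoc M.l_neg)
    ultimately show "h \<in> left_span R M ?G"
      by simp
  qed
  with G show ?case
    unfolding fg_submodule_def by blast
qed

end

section \<open>Quotients of left modules\<close>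

context
  fixes R :: "('r, 'y) ring_scheme" and M :: "('r, 'm) module" and L
  assumes M: "left_module R M" and L: "submodule L R M"
begin

interpretation left_module R M by (rule M)
interpretation abelian_subgroup L M by (rule left_submodule_abelian_subgroup[OF L])

lemma quotient_module_carrier: "carrier (quotient_module M L) = {L +>\<^bsub>M\<^esub> a | a. a \<in> carrier M}"
  by (auto simp: quotient_module_def A_RCOSETS_def')

lemma coset_eq_iff:
  assumes "a \<in> carrier M" "b \<in> carrier M"
  shows "L +>\<^bsub>M\<^esub> a = L +>\<^bsub>M\<^esub> b \<longleftrightarrow> a \<ominus>\<^bsub>M\<^esub> b \<in> L"
proof
  assume "L +>\<^bsub>M\<^esub> a = L +>\<^bsub>M\<^esub> b"
  then have "a \<in> L +>\<^bsub>M\<^esub> b"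
    using a_rcos_self[OF assms(1)] by simp
  then show "a \<ominus>\<^bsub>M\<^esub> b \<in> L"
    using a_rcos_module[OF assms(2,1)] by (simp add: a_minus_def)
next
  assume "a \<ominus>\<^bsub>M\<^esub> b \<in> L"
  then have "a \<in> L +>\<^bsub>M\<^esub> b"
    using a_rcos_module[OF assms(2,1)] by (simp add: a_minus_def)
  then show "L +>\<^bsub>M\<^esub> a = L +>\<^bsub>M\<^esub> b"
    using M.a_repr_independence[OF _ assms(2) a_subgroup] by simp
qed

lemma coset_eq_self_iff: "a \<in> carrier M \<Longrightarrow> L +>\<^bsub>M\<^esub> a = L \<longleftrightarrow> a \<in> L"
  using a_rcos_self a_rcos_const by blast

text \<open>Operations on quotients are defined as unions over all representatives of a coset; such
  a union collapses once its terms do not depend on the representative. This serves scalar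
  multiplication here and the restriction maps of quotient presheaves later.\<close>

lemma UN_coset_eq:
  assumes "a \<in> carrier M" and "\<And>b. b \<in> carrier M \<Longrightarrow> L +>\<^bsub>M\<^esub> b = L +>\<^bsub>M\<^esub> a \<Longrightarrow> f b = f a"
  shows "(\<Union>b\<in>L +>\<^bsub>M\<^esub> a. f b) = f a"
proof -
  have "f b = f a" if "b \<in> L +>\<^bsub>M\<^esub> a" for b
  proof (rule assms(2))
    show b: "b \<in> carrier M"
      using that assms(1) a_subset M.a_r_coset_subset_G by blast
    show "L +>\<^bsub>M\<^esub> b = L +>\<^bsub>M\<^esub> a"
      using M.a_repr_independence[OF that assms(1) a_subgroup] by simp
  qed
  then show ?thesis
    using a_rcos_self[OF assms(1)] by blast
qed

lemma quotient_module_add: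
  assumes "a \<in> carrier M" "b \<in> carrier M"
  shows "(L +>\<^bsub>M\<^esub> a) \<oplus>\<^bsub>quotient_module M L\<^esub> (L +>\<^bsub>M\<^esub> b) = L +>\<^bsub>M\<^esub> (a \<oplus>\<^bsub>M\<^esub> b)"
  using assms by (simp add: quotient_module_def a_rcos_sum)

lemma quotient_module_zero: "\<zero>\<^bsub>quotient_module M L\<^esub> = L +>\<^bsub>M\<^esub> \<zero>\<^bsub>M\<^esub>"
  using coset_eq_self_iff[of "\<zero>\<^bsub>M\<^esub>"] by (simp add: quotient_module_def)

lemma quotient_module_smult:
  assumes r: "r \<in> carrier R" and a: "a \<in> carrier M"
  shows "r \<odot>\<^bsub>quotient_module M L\<^esub> (L +>\<^bsub>M\<^esub> a) = L +>\<^bsub>M\<^esub> (r \<odot>\<^bsub>M\<^esub> a)"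
  unfolding quotient_module_def module.simps
proof (rule UN_coset_eq[OF a])
  fix b assume b: "b \<in> carrier M" and "L +>\<^bsub>M\<^esub> b = L +>\<^bsub>M\<^esub> a"
  then have "b \<ominus>\<^bsub>M\<^esub> a \<in> L"
    using a by (simp add: coset_eq_iff)
  then have "r \<odot>\<^bsub>M\<^esub> (b \<ominus>\<^bsub>M\<^esub> a) \<in> L"
    using r left_submoduleD(4)[OF L] by blast
  moreover have "r \<odot>\<^bsub>M\<^esub> (b \<ominus>\<^bsub>M\<^esub> a) = r \<odot>\<^bsub>M\<^esub> b \<ominus>\<^bsub>M\<^esub> r \<odot>\<^bsub>M\<^esub> a"
  proof -
    have "r \<odot>\<^bsub>M\<^esub> (b \<ominus>\<^bsub>M\<^esub> a) \<oplus>\<^bsub>M\<^esub> r \<odot>\<^bsub>M\<^esub> a = r \<odot>\<^bsub>M\<^esub> ((b \<ominus>\<^bsub>M\<^esub> a) \<oplus>\<^bsub>M\<^esub> a)"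
      using a b r by (simp add: left_smult_r_distr)
    also have "(b \<ominus>\<^bsub>M\<^esub> a) \<oplus>\<^bsub>M\<^esub> a = b"
      using a b by (simp add: a_minus_def M.a_assoc M.l_neg)
    finally have "r \<odot>\<^bsub>M\<^esub> b = r \<odot>\<^bsub>M\<^esub> (b \<ominus>\<^bsub>M\<^esub> a) \<oplus>\<^bsub>M\<^esub> r \<odot>\<^bsub>M\<^esub> a" by simp
    then show ?thesis
      using a b r by (simp add: a_minus_def M.a_assoc M.r_neg left_smult_closed)
  qed
  ultimately show "L +>\<^bsub>M\<^esub> (r \<odot>\<^bsub>M\<^esub> b) = L +>\<^bsub>M\<^esub> (r \<odot>\<^bsub>M\<^esub> a)"
    using a b r by (simp add: coset_eq_iff left_smult_closed)
qed

lemma left_module_quotient: "left_module R (quotient_module M L)"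
proof -
  have "abelian_group (quotient_module M L)"
  proof (rule abelian_groupI)
    fix x assume "x \<in> carrier (quotient_module M L)"
    then obtain a where "a \<in> carrier M" "x = L +>\<^bsub>M\<^esub> a"
      by (auto simp: quotient_module_carrier)
    then show "\<exists>y\<in>carrier (quotient_module M L). y \<oplus>\<^bsub>quotient_module M L\<^esub> x = \<zero>\<^bsub>quotient_module M L\<^esub>"
      by (intro bexI[of _ "L +>\<^bsub>M\<^esub> (\<ominus>\<^bsub>M\<^esub> a)"])
        (auto simp: quotient_module_carrier quotient_module_add quotient_module_zero M.l_neg)
  next
    show "\<zero>\<^bsub>quotient_module M L\<^esub> \<in> carrier (quotient_module M L)"
      by (auto simp: quotient_module_zero quotient_module_carrier)
  next
    show "x \<oplus>\<^bsub>quotient_module M L\<^esub> y \<in> carrier (quotient_module M L)"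
      if "x \<in> carrier (quotient_module M L)" "y \<in> carrier (quotient_module M L)" for x y
      using that M.add.m_closed unfolding quotient_module_carrier
      by (auto simp: quotient_module_add)
  qed (auto simp: quotient_module_carrier quotient_module_add quotient_module_zero M.a_ac)
  moreover have "left_module_axioms R (quotient_module M L)"
  proof
    show "r \<odot>\<^bsub>quotient_module M L\<^esub> x \<in> carrier (quotient_module M L)"
      if "r \<in> carrier R" "x \<in> carrier (quotient_module M L)" for r x
      using that left_smult_closed unfolding quotient_module_carrier
      by (auto simp: quotient_module_smult)
  qed (auto simp: quotient_module_carrier quotient_module_add quotient_module_smult left_smult_closed
      left_smult_l_distr left_smult_r_distr left_smult_assoc left_smult_one)
  ultimately show ?thesis
    unfolding left_module_def using R.ring_axioms by blast
qed

end

section \<open>Stalks of presheaves of rings and modules\<close>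

abbreviation \<Gamma> :: "('a, 'e, ('e, 'z) partial_object_scheme) presheaf \<Rightarrow> 'a set \<Rightarrow> 'e set" where
  "\<Gamma> F U \<equiv> carrier (sections F U)"

locale presheaf_on =
  fixes X :: "'a topology" and F :: "('a, 'e, ('e, 'z) partial_object_scheme) presheaf"
  assumes is_presheaf: "is_presheaf X F"
begin

lemma restr_closed:
  "openin X U \<Longrightarrow> openin X V \<Longrightarrow> V \<subseteq> U \<Longrightarrow> s \<in> \<Gamma> F U \<Longrightarrow>
    restr F U V s \<in> \<Gamma> F V"
  using is_presheaf by (simp add: is_presheaf_def Pi_iff)

lemma restr_id: "openin X U \<Longrightarrow> s \<in> \<Gamma> F U \<Longrightarrow> restr F U U s = s"
  using is_presheaf by (simp add: is_presheaf_def Pi_iff)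

lemma restr_restr:
  "openin X U \<Longrightarrow> openin X V \<Longrightarrow> openin X W \<Longrightarrow> W \<subseteq> V \<Longrightarrow> V \<subseteq> U \<Longrightarrow>
    s \<in> \<Gamma> F U \<Longrightarrow> restr F V W (restr F U V s) = restr F U W s"
  using is_presheaf by (simp add: is_presheaf_def Pi_iff)

lemma mem_germ_self:
  "openin X U \<Longrightarrow> x \<in> U \<Longrightarrow> s \<in> \<Gamma> F U \<Longrightarrow> (U, s) \<in> germ X F x U s"
  by (auto simp: germ_def)

text \<open>Agreement near \<open>x\<close> is transitive because two witnessing neighbourhoods can
  be intersected; hence the sets \<open>germ X F x U s\<close> are the classes of an equivalence
  relation on pairs of a neighbourhood and a section.\<close>

lemma germ_eq_iff:
  assumes U: "openin X U" "x \<in> U" "s \<in> \<Gamma> F U"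
    and V: "openin X V" "x \<in> V" "t \<in> \<Gamma> F V"
  shows "germ X F x U s = germ X F x V t \<longleftrightarrow>
    (\<exists>W. openin X W \<and> x \<in> W \<and> W \<subseteq> U \<inter> V \<and> restr F U W s = restr F V W t)"
    (is "?l \<longleftrightarrow> ?r")
proof
  assume ?l
  then have "(V, t) \<in> germ X F x U s"
    using V mem_germ_self by simp
  then show ?r
    by (auto simp: germ_def)
next
  \<comment> \<open>One inclusion is proved for arbitrary data; exchanging the two pairs gives the
    other.\<close>
  have *: "germ X F x V' t' \<subseteq> germ X F x U' s'"
    if U': "openin X U'" "s' \<in> \<Gamma> F U'"
      and V': "openin X V'" "t' \<in> \<Gamma> F V'"
      and W: "openin X W" "x \<in> W" "W \<subseteq> U' \<inter> V'" "restr F U' W s' = restr F V' W t'"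
    for U' V' W s' t'
  proof clarify
    fix V1 t1 assume "(V1, t1) \<in> germ X F x V' t'"
    then obtain W1 where 1: "openin X V1" "x \<in> V1" "t1 \<in> \<Gamma> F V1"
      and W1: "openin X W1" "x \<in> W1" "W1 \<subseteq> V' \<inter> V1" "restr F V' W1 t' = restr F V1 W1 t1"
      by (auto simp: germ_def)
    have "restr F U' (W \<inter> W1) s' = restr F W (W \<inter> W1) (restr F U' W s')"
      using U' W W1 by (subst restr_restr) auto
    also have "\<dots> = restr F V' (W \<inter> W1) t'"
      using V' W W1 by (subst W(4), subst restr_restr) auto
    also have "\<dots> = restr F W1 (W \<inter> W1) (restr F V' W1 t')"
      using V' W W1 by (subst restr_restr) auto
    also have "\<dots> = restr F V1 (W \<inter> W1) t1"
      using 1 W W1 by (subst W1(4), subst restr_restr) auto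
    finally show "(V1, t1) \<in> germ X F x U' s'"
      using 1 W W1 unfolding germ_def by (auto intro!: exI[of _ "W \<inter> W1"])
  qed
  assume ?r
  then obtain W where W: "openin X W" "x \<in> W" "W \<subseteq> U \<inter> V" "restr F U W s = restr F V W t"
    by blast
  show ?l
    using *[OF U(1,3) V(1,3) W] *[OF V(1,3) U(1,3) W(1,2) _ W(4)[symmetric]] W(3) by blast
qed

lemma germ_restr:
  assumes "openin X U" "s \<in> \<Gamma> F U" "openin X V" "x \<in> V" "V \<subseteq> U"
  shows "germ X F x V (restr F U V s) = germ X F x U s"
proof (subst germ_eq_iff)
  show "\<exists>W. openin X W \<and> x \<in> W \<and> W \<subseteq> V \<inter> U \<and> restr F V W (restr F U V s) = restr F U W s"
    using assms by (intro exI[of _ V]) (auto simp: restr_id restr_closed)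
qed (use assms in \<open>auto simp: restr_closed\<close>)

lemma germ_in_stalk:
  "openin X U \<Longrightarrow> x \<in> U \<Longrightarrow> s \<in> \<Gamma> F U \<Longrightarrow> germ X F x U s \<in> stalk X F x"
  by (auto simp: stalk_def)

text \<open>A representative exists over every sufficiently small neighbourhood, not just over one,
  so that several germs can be moved to a common domain by intersecting.\<close>

lemma stalk_repr:
  assumes "A \<in> stalk X F x"
  shows "\<exists>U. openin X U \<and> x \<in> U \<and>
    (\<forall>V. openin X V \<longrightarrow> x \<in> V \<longrightarrow> V \<subseteq> U \<longrightarrow> A \<in> germ X F x V ` \<Gamma> F V)"
proof -
  obtain U s where U: "openin X U" "x \<in> U" "s \<in> \<Gamma> F U" "A = germ X F x U s"
    using assms by (auto simp: stalk_def)
  have "A \<in> germ X F x V ` \<Gamma> F V" if "openin X V" "x \<in> V" "V \<subseteq> U" for V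
    using U that by (intro image_eqI[of _ _ "restr F U V s"]) (auto simp: germ_restr restr_closed)
  with U(1,2) show ?thesis by blast
qed

lemma stalk_cases3:
  assumes "A \<in> stalk X F x" "B \<in> stalk X F x" "C \<in> stalk X F x"
  obtains U a b c where "openin X U" "x \<in> U" "a \<in> \<Gamma> F U"
    "b \<in> \<Gamma> F U" "c \<in> \<Gamma> F U"
    "A = germ X F x U a" "B = germ X F x U b" "C = germ X F x U c"
proof -
  obtain U1 where 1: "openin X U1" "x \<in> U1" "\<forall>V. openin X V \<longrightarrow> x \<in> V \<longrightarrow> V \<subseteq> U1 \<longrightarrow>
      A \<in> germ X F x V ` \<Gamma> F V"
    using stalk_repr[OF assms(1)] by blast
  obtain U2 where 2: "openin X U2" "x \<in> U2" "\<forall>V. openin X V \<longrightarrow> x \<in> V \<longrightarrow> V \<subseteq> U2 \<longrightarrow>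
      B \<in> germ X F x V ` \<Gamma> F V"
    using stalk_repr[OF assms(2)] by blast
  obtain U3 where 3: "openin X U3" "x \<in> U3" "\<forall>V. openin X V \<longrightarrow> x \<in> V \<longrightarrow> V \<subseteq> U3 \<longrightarrow>
      C \<in> germ X F x V ` \<Gamma> F V"
    using stalk_repr[OF assms(3)] by blast
  let ?U = "U1 \<inter> U2 \<inter> U3"
  have U: "openin X ?U" "x \<in> ?U" and sub: "?U \<subseteq> U1" "?U \<subseteq> U2" "?U \<subseteq> U3"
    using 1 2 3 by auto
  have m1: "A \<in> germ X F x ?U ` \<Gamma> F ?U"
    using 1(3) U sub(1) by blast
  have m2: "B \<in> germ X F x ?U ` \<Gamma> F ?U"
    using 2(3) U sub(2) by blast
  have m3: "C \<in> germ X F x ?U ` \<Gamma> F ?U"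
    using 3(3) U sub(3) by blast
  show ?thesis
    using m1 m2 m3 by (elim imageE) (rule that[OF U])
qed

end

text \<open>\<open>G\<close> is any record with the carrier, addition and zero of a stalk, which
  covers the stalk ring and the stalk module at once.\<close>

lemma abelian_group_stalk:
  fixes G :: "(('a set \<times> 'e) set, 'y) ring_scheme" (structure)
  assumes F: "presheaf_on X F" and x: "x \<in> topspace X"
    and groups: "\<And>U. openin X U \<Longrightarrow> abelian_group (sections F U)"
    and carrier: "carrier G = stalk X F x"
    and add: "\<And>U s t. openin X U \<Longrightarrow> x \<in> U \<Longrightarrow> s \<in> \<Gamma> F U \<Longrightarrow> t \<in> \<Gamma> F U \<Longrightarrow>
      germ X F x U s \<oplus> germ X F x U t = germ X F x U (s \<oplus>\<^bsub>sections F U\<^esub> t)"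
    and zero: "\<And>U. openin X U \<Longrightarrow> x \<in> U \<Longrightarrow> \<zero> = germ X F x U \<zero>\<^bsub>sections F U\<^esub>"
  shows "abelian_group G"
proof (rule abelian_groupI, unfold carrier)
  interpret presheaf_on X F by (rule F)
  fix A B C assume "A \<in> stalk X F x" "B \<in> stalk X F x" "C \<in> stalk X F x"
  then obtain U a b c where U: "openin X U" "x \<in> U"
    and abc: "a \<in> \<Gamma> F U" "b \<in> \<Gamma> F U" "c \<in> \<Gamma> F U"
    and eq: "A = germ X F x U a" "B = germ X F x U b" "C = germ X F x U c"
    by (rule stalk_cases3)
  interpret abelian_group "sections F U" by (rule groups[OF U(1)])
  show "A \<oplus> B \<oplus> C = A \<oplus> (B \<oplus> C)"
    using U abc by (simp add: eq add a_assoc)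
next
  interpret presheaf_on X F by (rule F)
  fix A B assume AB: "A \<in> stalk X F x" "B \<in> stalk X F x"
  then obtain U a b where U: "openin X U" "x \<in> U" and ab: "a \<in> \<Gamma> F U" "b \<in> \<Gamma> F U"
    and eq: "A = germ X F x U a" "B = germ X F x U b"
    using stalk_cases3[OF AB(1,2,2)] by metis
  interpret abelian_group "sections F U" by (rule groups[OF U(1)])
  show "A \<oplus> B \<in> stalk X F x"
    using U ab by (simp add: eq add germ_in_stalk)
  show "A \<oplus> B = B \<oplus> A"
    using U ab by (simp add: eq add a_comm)
  show "\<zero> \<oplus> A = A"
    using U ab by (simp add: eq add zero[OF U])
  show "\<exists>B\<in>stalk X F x. B \<oplus> A = \<zero>"
    using U ab by (intro bexI[of _ "germ X F x U (\<ominus>\<^bsub>sections F U\<^esub> a)"])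
      (simp_all add: eq add zero[OF U] l_neg germ_in_stalk)
next
  interpret presheaf_on X F by (rule F)
  interpret abelian_group "sections F (topspace X)" by (rule groups[OF openin_topspace])
  show "\<zero> \<in> stalk X F x"
    using x by (simp add: zero[OF openin_topspace x] germ_in_stalk)
qed

text \<open>\<open>germ_map2\<close> is a union over all pairs of representatives. Since
  \<open>op\<close> commutes with restriction, each pair yields the same germ, by comparison on a
  common small neighbourhood. The two presheaves may differ so that the action of germs of scalars
  on germs of sections is included.\<close>

lemma germ_map2_germ:
  assumes F: "is_presheaf X F" and G: "is_presheaf X G"
    and op_closed: "\<And>W s t. openin X W \<Longrightarrow> s \<in> \<Gamma> F W \<Longrightarrow>
      t \<in> \<Gamma> G W \<Longrightarrow> op W s t \<in> \<Gamma> G W"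
    and op_restr: "\<And>V W s t. openin X W \<Longrightarrow> openin X V \<Longrightarrow> V \<subseteq> W \<Longrightarrow>
      s \<in> \<Gamma> F W \<Longrightarrow> t \<in> \<Gamma> G W \<Longrightarrow>
      restr G W V (op W s t) = op V (restr F W V s) (restr G W V t)"
    and U: "openin X U" "x \<in> U" and s: "s \<in> \<Gamma> F U" and t: "t \<in> \<Gamma> G U"
  shows "germ_map2 X F G op x (germ X F x U s) (germ X G x U t) = germ X G x U (op U s t)"
proof -
  interpret F: presheaf_on X F by standard (rule F)
  interpret G: presheaf_on X G by standard (rule G)
  have *: "germ X G x (V \<inter> V') (op (V \<inter> V') (restr F V (V \<inter> V') s') (restr G V' (V \<inter> V') t')) =
      germ X G x U (op U s t)"
    if st: "(V, s') \<in> germ X F x U s" "(V', t') \<in> germ X G x U t" for V s' V' t'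
  proof -
    obtain W where V: "openin X V" "x \<in> V" "s' \<in> \<Gamma> F V"
      and W: "openin X W" "x \<in> W" "W \<subseteq> U \<inter> V" "restr F U W s = restr F V W s'"
      using st(1) by (auto simp: germ_def)
    obtain W' where V': "openin X V'" "x \<in> V'" "t' \<in> \<Gamma> G V'"
      and W': "openin X W'" "x \<in> W'" "W' \<subseteq> U \<inter> V'" "restr G U W' t = restr G V' W' t'"
      using st(2) by (auto simp: germ_def)
    let ?O = "W \<inter> W'"
    have O: "openin X ?O" "x \<in> ?O" "?O \<subseteq> U" "?O \<subseteq> V \<inter> V'"
      using W W' by auto
    have VV: "openin X (V \<inter> V')" "x \<in> V \<inter> V'"
      using V V' by auto
    have "restr F U ?O s = restr F W ?O (restr F U W s)"
      using U s W W' by (subst F.restr_restr) auto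
    also have "\<dots> = restr F V ?O s'"
      using V W W' by (subst W(4), subst F.restr_restr) auto
    also have "\<dots> = restr F (V \<inter> V') ?O (restr F V (V \<inter> V') s')"
      using V VV O by (subst F.restr_restr) auto
    finally have 1: "restr F U ?O s = \<dots>" .
    have "restr G U ?O t = restr G W' ?O (restr G U W' t)"
      using U t W W' by (subst G.restr_restr) auto
    also have "\<dots> = restr G V' ?O t'"
      using V' W W' by (subst W'(4), subst G.restr_restr) auto
    also have "\<dots> = restr G (V \<inter> V') ?O (restr G V' (V \<inter> V') t')"
      using V' VV O by (subst G.restr_restr) auto
    finally have 2: "restr G U ?O t = \<dots>" .
    have c: "restr F V (V \<inter> V') s' \<in> \<Gamma> F (V \<inter> V')"
      "restr G V' (V \<inter> V') t' \<in> \<Gamma> G (V \<inter> V')"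
      using V V' VV by (auto intro: F.restr_closed G.restr_closed)
    show ?thesis
    proof (subst G.germ_eq_iff)
      show "\<exists>W. openin X W \<and> x \<in> W \<and> W \<subseteq> V \<inter> V' \<inter> U \<and>
          restr G (V \<inter> V') W (op (V \<inter> V') (restr F V (V \<inter> V') s') (restr G V' (V \<inter> V') t')) =
          restr G U W (op U s t)"
        using O VV U s t c 1 2 by (intro exI[of _ ?O]) (auto simp: op_restr)
    qed (use VV U s t c in \<open>auto intro: op_closed\<close>)
  qed
  have "germ_map2 X F G op x (germ X F x U s) (germ X G x U t) =
      (\<Union>(V, s')\<in>germ X F x U s. \<Union>(V', t')\<in>germ X G x U t. germ X G x U (op U s t))"
    unfolding germ_map2_def using * by (intro SUP_cong refl) auto
  also have "\<dots> = germ X G x U (op U s t)"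
    using F.mem_germ_self[OF U s] G.mem_germ_self[OF U t] by auto
  finally show ?thesis .
qed

section \<open>Stalks of presheaves of rings\<close>

locale ring_presheaf_on = presheaf_on X \<O> for X and \<O> :: "('a, 'r) ring_presheaf" +
  assumes rings: "openin X U \<Longrightarrow> ring (sections \<O> U)"
    and restr_ring_hom: "openin X U \<Longrightarrow> openin X V \<Longrightarrow> V \<subseteq> U \<Longrightarrow>
      restr \<O> U V \<in> ring_hom (sections \<O> U) (sections \<O> V)"
begin

lemma ring_ops_closed:
  assumes "openin X U"
  shows "s \<in> \<Gamma> \<O> U \<Longrightarrow> t \<in> \<Gamma> \<O> U \<Longrightarrow>
      s \<oplus>\<^bsub>sections \<O> U\<^esub> t \<in> \<Gamma> \<O> U"
    and "s \<in> \<Gamma> \<O> U \<Longrightarrow> t \<in> \<Gamma> \<O> U \<Longrightarrow>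
      s \<otimes>\<^bsub>sections \<O> U\<^esub> t \<in> \<Gamma> \<O> U"
    and "\<zero>\<^bsub>sections \<O> U\<^esub> \<in> \<Gamma> \<O> U"
    and "\<one>\<^bsub>sections \<O> U\<^esub> \<in> \<Gamma> \<O> U"
    and "s \<in> \<Gamma> \<O> U \<Longrightarrow> \<ominus>\<^bsub>sections \<O> U\<^esub> s \<in> \<Gamma> \<O> U"
  using rings[OF assms] by (simp_all add: ring.ring_simprules)

lemma ring_restr:
  assumes "openin X U" "openin X V" "V \<subseteq> U"
  shows "s \<in> \<Gamma> \<O> U \<Longrightarrow> t \<in> \<Gamma> \<O> U \<Longrightarrow>
      restr \<O> U V (s \<oplus>\<^bsub>sections \<O> U\<^esub> t) = restr \<O> U V s \<oplus>\<^bsub>sections \<O> V\<^esub> restr \<O> U V t"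
    and "s \<in> \<Gamma> \<O> U \<Longrightarrow> t \<in> \<Gamma> \<O> U \<Longrightarrow>
      restr \<O> U V (s \<otimes>\<^bsub>sections \<O> U\<^esub> t) = restr \<O> U V s \<otimes>\<^bsub>sections \<O> V\<^esub> restr \<O> U V t"
    and "restr \<O> U V \<one>\<^bsub>sections \<O> U\<^esub> = \<one>\<^bsub>sections \<O> V\<^esub>"
    and "restr \<O> U V \<zero>\<^bsub>sections \<O> U\<^esub> = \<zero>\<^bsub>sections \<O> V\<^esub>"
  using restr_ring_hom[OF assms] rings assms
  by (auto simp: ring_hom_add ring_hom_mult ring_hom_one ring_hom_zero)

lemma stalk_ring_ops:
  assumes U: "openin X U" "x \<in> U"
  shows "s \<in> \<Gamma> \<O> U \<Longrightarrow> t \<in> \<Gamma> \<O> U \<Longrightarrow>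
      germ X \<O> x U s \<oplus>\<^bsub>stalk_ring X \<O> x\<^esub> germ X \<O> x U t = germ X \<O> x U (s \<oplus>\<^bsub>sections \<O> U\<^esub> t)"
      (is "PROP ?add")
    and "s \<in> \<Gamma> \<O> U \<Longrightarrow> t \<in> \<Gamma> \<O> U \<Longrightarrow>
      germ X \<O> x U s \<otimes>\<^bsub>stalk_ring X \<O> x\<^esub> germ X \<O> x U t = germ X \<O> x U (s \<otimes>\<^bsub>sections \<O> U\<^esub> t)"
      (is "PROP ?mult")
    and "\<zero>\<^bsub>stalk_ring X \<O> x\<^esub> = germ X \<O> x U \<zero>\<^bsub>sections \<O> U\<^esub>" (is ?zero)
    and "\<one>\<^bsub>stalk_ring X \<O> x\<^esub> = germ X \<O> x U \<one>\<^bsub>sections \<O> U\<^esub>" (is ?one)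
proof -
  show "PROP ?add" "PROP ?mult"
    unfolding stalk_ring_def ring.simps monoid.simps
    by (rule germ_map2_germ[OF is_presheaf is_presheaf]; use U in \<open>simp add: ring_ops_closed ring_restr\<close>)+
  have "U \<subseteq> topspace X"
    using U by (simp add: openin_subset)
  then show ?zero ?one
    using U germ_restr[of "topspace X" "\<zero>\<^bsub>sections \<O> (topspace X)\<^esub>" U x]
      germ_restr[of "topspace X" "\<one>\<^bsub>sections \<O> (topspace X)\<^esub>" U x]
    by (simp_all add: stalk_ring_def ring_ops_closed ring_restr)
qed

lemma carrier_stalk_ring: "carrier (stalk_ring X \<O> x) = stalk X \<O> x"
  by (simp add: stalk_ring_def)

lemma ring_stalk:
  assumes x: "x \<in> topspace X"
  shows "ring (stalk_ring X \<O> x)"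
proof -
  let ?R = "stalk_ring X \<O> x"
  have one: "\<one>\<^bsub>?R\<^esub> \<in> stalk X \<O> x"
    using x by (auto simp: stalk_ring_ops[of "topspace X"] ring_ops_closed intro: germ_in_stalk)
  have "abelian_group ?R"
    by (rule abelian_group_stalk[OF presheaf_on_axioms x])
      (simp_all add: carrier_stalk_ring stalk_ring_ops ring.is_abelian_group[OF rings])
  moreover have "monoid ?R"
  proof (rule monoidI, unfold carrier_stalk_ring)
    fix A B C assume ABC: "A \<in> stalk X \<O> x" "B \<in> stalk X \<O> x" "C \<in> stalk X \<O> x"
    then obtain U a b c where U: "openin X U" "x \<in> U"
      and abc: "a \<in> \<Gamma> \<O> U" "b \<in> \<Gamma> \<O> U" "c \<in> \<Gamma> \<O> U"
      and eq: "A = germ X \<O> x U a" "B = germ X \<O> x U b" "C = germ X \<O> x U c"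
      by (rule stalk_cases3)
    interpret ring "sections \<O> U" by (rule rings[OF U(1)])
    show "A \<otimes>\<^bsub>?R\<^esub> B \<otimes>\<^bsub>?R\<^esub> C = A \<otimes>\<^bsub>?R\<^esub> (B \<otimes>\<^bsub>?R\<^esub> C)"
      using U abc by (simp add: eq stalk_ring_ops[OF U] m_assoc)
  next
    fix A B assume ABC: "A \<in> stalk X \<O> x" "B \<in> stalk X \<O> x"
    then obtain U a b where U: "openin X U" "x \<in> U"
      and abc: "a \<in> \<Gamma> \<O> U" "b \<in> \<Gamma> \<O> U"
      and eq: "A = germ X \<O> x U a" "B = germ X \<O> x U b"
      using stalk_cases3[of A x B B] by metis
    interpret ring "sections \<O> U" by (rule rings[OF U(1)])
    show "A \<otimes>\<^bsub>?R\<^esub> B \<in> stalk X \<O> x"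
      using U abc by (simp add: eq stalk_ring_ops[OF U] germ_in_stalk)
    show "\<one>\<^bsub>?R\<^esub> \<otimes>\<^bsub>?R\<^esub> A = A" "A \<otimes>\<^bsub>?R\<^esub> \<one>\<^bsub>?R\<^esub> = A"
      using U abc by (simp_all add: eq stalk_ring_ops[OF U])
  qed (rule one)
  ultimately show ?thesis
  proof (rule ringI, unfold carrier_stalk_ring)
    fix A B C assume ABC: "A \<in> stalk X \<O> x" "B \<in> stalk X \<O> x" "C \<in> stalk X \<O> x"
    then obtain U a b c where U: "openin X U" "x \<in> U"
      and abc: "a \<in> \<Gamma> \<O> U" "b \<in> \<Gamma> \<O> U" "c \<in> \<Gamma> \<O> U"
      and eq: "A = germ X \<O> x U a" "B = germ X \<O> x U b" "C = germ X \<O> x U c"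
      by (rule stalk_cases3)
    interpret ring "sections \<O> U" by (rule rings[OF U(1)])
    show "(A \<oplus>\<^bsub>?R\<^esub> B) \<otimes>\<^bsub>?R\<^esub> C = A \<otimes>\<^bsub>?R\<^esub> C \<oplus>\<^bsub>?R\<^esub> B \<otimes>\<^bsub>?R\<^esub> C"
      using U abc by (simp add: eq stalk_ring_ops[OF U] l_distr)
    show "C \<otimes>\<^bsub>?R\<^esub> (A \<oplus>\<^bsub>?R\<^esub> B) = C \<otimes>\<^bsub>?R\<^esub> A \<oplus>\<^bsub>?R\<^esub> C \<otimes>\<^bsub>?R\<^esub> B"
      using U abc by (simp add: eq stalk_ring_ops[OF U] r_distr)
  qed
qed

end

section \<open>Stalks of presheaves of modules\<close>

locale module_presheaf_on = O: ring_presheaf_on X \<O> + presheaf_on X \<M>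
  for X and \<O> :: "('a, 'r) ring_presheaf" and \<M> :: "('a, 'r, 'm) module_presheaf" +
  assumes modules: "openin X U \<Longrightarrow> left_module (sections \<O> U) (sections \<M> U)"
    and restr_add: "openin X U \<Longrightarrow> openin X V \<Longrightarrow> V \<subseteq> U \<Longrightarrow>
      s \<in> \<Gamma> \<M> U \<Longrightarrow> t \<in> \<Gamma> \<M> U \<Longrightarrow>
      restr \<M> U V (s \<oplus>\<^bsub>sections \<M> U\<^esub> t) = restr \<M> U V s \<oplus>\<^bsub>sections \<M> V\<^esub> restr \<M> U V t"
    and restr_smult: "openin X U \<Longrightarrow> openin X V \<Longrightarrow> V \<subseteq> U \<Longrightarrow>
      r \<in> \<Gamma> \<O> U \<Longrightarrow> s \<in> \<Gamma> \<M> U \<Longrightarrow>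
      restr \<M> U V (r \<odot>\<^bsub>sections \<M> U\<^esub> s) = restr \<O> U V r \<odot>\<^bsub>sections \<M> V\<^esub> restr \<M> U V s"
begin

lemma module_ops_closed:
  assumes "openin X U"
  shows "s \<in> \<Gamma> \<M> U \<Longrightarrow> t \<in> \<Gamma> \<M> U \<Longrightarrow>
      s \<oplus>\<^bsub>sections \<M> U\<^esub> t \<in> \<Gamma> \<M> U" (is "PROP ?add")
    and "r \<in> \<Gamma> \<O> U \<Longrightarrow> t \<in> \<Gamma> \<M> U \<Longrightarrow>
      r \<odot>\<^bsub>sections \<M> U\<^esub> t \<in> \<Gamma> \<M> U" (is "PROP ?smult")
    and "\<zero>\<^bsub>sections \<M> U\<^esub> \<in> \<Gamma> \<M> U" (is ?zero)
    and "s \<in> \<Gamma> \<M> U \<Longrightarrow> \<ominus>\<^bsub>sections \<M> U\<^esub> s \<in> \<Gamma> \<M> U" (is "PROP ?minus")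
proof -
  interpret left_module "sections \<O> U" "sections \<M> U" by (rule modules[OF assms])
  show "PROP ?add" "PROP ?smult" "?zero" "PROP ?minus"
    by (simp_all add: left_smult_closed)
qed

lemma restr_zero:
  assumes "openin X U" "openin X V" "V \<subseteq> U"
  shows "restr \<M> U V \<zero>\<^bsub>sections \<M> U\<^esub> = \<zero>\<^bsub>sections \<M> V\<^esub>"
proof -
  interpret U: left_module "sections \<O> U" "sections \<M> U" by (rule modules[OF assms(1)])
  interpret V: left_module "sections \<O> V" "sections \<M> V" by (rule modules[OF assms(2)])
  have c: "restr \<M> U V \<zero>\<^bsub>sections \<M> U\<^esub> \<in> \<Gamma> \<M> V"
    using assms by (simp add: restr_closed)
  have "restr \<M> U V \<zero>\<^bsub>sections \<M> U\<^esub> \<oplus>\<^bsub>sections \<M> V\<^esub> restr \<M> U V \<zero>\<^bsub>sections \<M> U\<^esub> =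
      restr \<M> U V \<zero>\<^bsub>sections \<M> U\<^esub>"
    using restr_add[OF assms, of "\<zero>\<^bsub>sections \<M> U\<^esub>" "\<zero>\<^bsub>sections \<M> U\<^esub>"] by simp
  then show ?thesis
    using c V.M.add.r_cancel_one by blast
qed

lemma restr_minus:
  assumes U: "openin X U" "openin X V" "V \<subseteq> U" and s: "s \<in> \<Gamma> \<M> U"
  shows "restr \<M> U V (\<ominus>\<^bsub>sections \<M> U\<^esub> s) = \<ominus>\<^bsub>sections \<M> V\<^esub> restr \<M> U V s"
proof -
  interpret U: left_module "sections \<O> U" "sections \<M> U" by (rule modules[OF U(1)])
  interpret V: left_module "sections \<O> V" "sections \<M> V" by (rule modules[OF U(2)])
  have "restr \<M> U V (\<ominus>\<^bsub>sections \<M> U\<^esub> s) \<oplus>\<^bsub>sections \<M> V\<^esub> restr \<M> U V s = \<zero>\<^bsub>sections \<M> V\<^esub>"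
    using s restr_add[OF U, of "\<ominus>\<^bsub>sections \<M> U\<^esub> s" s]
    by (simp add: U.M.l_neg restr_zero[OF U])
  then show ?thesis
    using s U by (intro V.M.minus_equality[symmetric]) (auto simp: restr_closed)
qed

lemma carrier_stalk_module: "carrier (stalk_module X \<O> \<M> x) = stalk X \<M> x"
  by (simp add: stalk_module_def)

lemma stalk_module_ops:
  assumes U: "openin X U" "x \<in> U"
  shows "s \<in> \<Gamma> \<M> U \<Longrightarrow> t \<in> \<Gamma> \<M> U \<Longrightarrow>
      germ X \<M> x U s \<oplus>\<^bsub>stalk_module X \<O> \<M> x\<^esub> germ X \<M> x U t = germ X \<M> x U (s \<oplus>\<^bsub>sections \<M> U\<^esub> t)"
      (is "PROP ?add")
    and "r \<in> \<Gamma> \<O> U \<Longrightarrow> t \<in> \<Gamma> \<M> U \<Longrightarrow>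
      germ X \<O> x U r \<odot>\<^bsub>stalk_module X \<O> \<M> x\<^esub> germ X \<M> x U t = germ X \<M> x U (r \<odot>\<^bsub>sections \<M> U\<^esub> t)"
      (is "PROP ?smult")
    and "\<zero>\<^bsub>stalk_module X \<O> \<M> x\<^esub> = germ X \<M> x U \<zero>\<^bsub>sections \<M> U\<^esub>" (is ?zero)
proof -
  show "PROP ?add"
    unfolding stalk_module_def ring.simps
    by (rule germ_map2_germ[OF is_presheaf is_presheaf])
      (use U in \<open>auto simp: module_ops_closed restr_add\<close>)
  show "PROP ?smult"
    unfolding stalk_module_def module.simps
    by (rule germ_map2_germ[OF O.is_presheaf is_presheaf])
      (use U in \<open>auto simp: module_ops_closed restr_smult\<close>)
  have "U \<subseteq> topspace X"
    using U by (simp add: openin_subset)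
  then show ?zero
    using U germ_restr[of "topspace X" "\<zero>\<^bsub>sections \<M> (topspace X)\<^esub>" U x]
    by (simp add: stalk_module_def module_ops_closed restr_zero)
qed

lemma stalk_module_cases:
  assumes "A \<in> stalk X \<O> x" "B \<in> stalk X \<O> x"
    "S \<in> stalk X \<M> x" "T \<in> stalk X \<M> x" "Y \<in> stalk X \<M> x"
  obtains U a b s t y where "openin X U" "x \<in> U" "a \<in> \<Gamma> \<O> U" "b \<in> \<Gamma> \<O> U"
    "s \<in> \<Gamma> \<M> U" "t \<in> \<Gamma> \<M> U" "y \<in> \<Gamma> \<M> U"
    "A = germ X \<O> x U a" "B = germ X \<O> x U b"
    "S = germ X \<M> x U s" "T = germ X \<M> x U t" "Y = germ X \<M> x U y"
proof -
  obtain U1 where 1: "openin X U1" "x \<in> U1" "\<forall>V. openin X V \<longrightarrow> x \<in> V \<longrightarrow> V \<subseteq> U1 \<longrightarrow>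
      A \<in> germ X \<O> x V ` \<Gamma> \<O> V"
    using O.stalk_repr[OF assms(1)] by blast
  obtain U2 where 2: "openin X U2" "x \<in> U2" "\<forall>V. openin X V \<longrightarrow> x \<in> V \<longrightarrow> V \<subseteq> U2 \<longrightarrow>
      B \<in> germ X \<O> x V ` \<Gamma> \<O> V"
    using O.stalk_repr[OF assms(2)] by blast
  obtain U3 where 3: "openin X U3" "x \<in> U3" "\<forall>V. openin X V \<longrightarrow> x \<in> V \<longrightarrow> V \<subseteq> U3 \<longrightarrow>
      S \<in> germ X \<M> x V ` \<Gamma> \<M> V"
    using stalk_repr[OF assms(3)] by blast
  obtain U4 where 4: "openin X U4" "x \<in> U4" "\<forall>V. openin X V \<longrightarrow> x \<in> V \<longrightarrow> V \<subseteq> U4 \<longrightarrow>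
      T \<in> germ X \<M> x V ` \<Gamma> \<M> V"
    using stalk_repr[OF assms(4)] by blast
  obtain U5 where 5: "openin X U5" "x \<in> U5" "\<forall>V. openin X V \<longrightarrow> x \<in> V \<longrightarrow> V \<subseteq> U5 \<longrightarrow>
      Y \<in> germ X \<M> x V ` \<Gamma> \<M> V"
    using stalk_repr[OF assms(5)] by blast
  let ?U = "U1 \<inter> U2 \<inter> U3 \<inter> U4 \<inter> U5"
  have U: "openin X ?U" "x \<in> ?U" and sub: "?U \<subseteq> U1" "?U \<subseteq> U2" "?U \<subseteq> U3" "?U \<subseteq> U4" "?U \<subseteq> U5"
    using 1 2 3 4 5 by auto
  have m1: "A \<in> germ X \<O> x ?U ` \<Gamma> \<O> ?U"
    using 1(3) U sub(1) by blast
  have m2: "B \<in> germ X \<O> x ?U ` \<Gamma> \<O> ?U"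
    using 2(3) U sub(2) by blast
  have m3: "S \<in> germ X \<M> x ?U ` \<Gamma> \<M> ?U"
    using 3(3) U sub(3) by blast
  have m4: "T \<in> germ X \<M> x ?U ` \<Gamma> \<M> ?U"
    using 4(3) U sub(4) by blast
  have m5: "Y \<in> germ X \<M> x ?U ` \<Gamma> \<M> ?U"
    using 5(3) U sub(5) by blast
  show ?thesis
    using m1 m2 m3 m4 m5 by (elim imageE) (rule that[OF U])
qed

lemma left_module_stalk:
  assumes x: "x \<in> topspace X"
  shows "left_module (stalk_ring X \<O> x) (stalk_module X \<O> \<M> x)"
proof -
  let ?R = "stalk_ring X \<O> x" and ?M = "stalk_module X \<O> \<M> x"
  \<comment> \<open>A scalar germ to fill the ring arguments of \<open>stalk_module_cases\<close> in
    the unit law, which comes without a scalar.\<close>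
  have zeroR: "\<zero>\<^bsub>?R\<^esub> \<in> stalk X \<O> x"
    using x by (auto simp: O.stalk_ring_ops[of "topspace X"] O.ring_ops_closed intro: O.germ_in_stalk)
  have "abelian_group ?M"
    by (rule abelian_group_stalk[OF presheaf_on_axioms x])
      (use modules in \<open>simp_all add: carrier_stalk_module stalk_module_ops left_module_def\<close>)
  moreover have "left_module_axioms ?R ?M"
  proof (unfold left_module_axioms_def carrier_stalk_module O.carrier_stalk_ring, intro conjI allI impI)
    fix A B S assume *: "A \<in> stalk X \<O> x" "B \<in> stalk X \<O> x" "S \<in> stalk X \<M> x"
    then obtain U a b s where U: "openin X U" "x \<in> U"
      and c: "a \<in> \<Gamma> \<O> U" "b \<in> \<Gamma> \<O> U" "s \<in> \<Gamma> \<M> U"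
      and eq: "A = germ X \<O> x U a" "B = germ X \<O> x U b" "S = germ X \<M> x U s"
      using stalk_module_cases[OF *(1,2,3,3,3)] by metis
    interpret left_module "sections \<O> U" "sections \<M> U" by (rule modules[OF U(1)])
    note s = stalk_module_ops[OF U] O.stalk_ring_ops[OF U]
    show "(A \<oplus>\<^bsub>?R\<^esub> B) \<odot>\<^bsub>?M\<^esub> S = A \<odot>\<^bsub>?M\<^esub> S \<oplus>\<^bsub>?M\<^esub> B \<odot>\<^bsub>?M\<^esub> S"
      using c by (simp add: eq s left_smult_closed left_smult_l_distr)
    show "(A \<otimes>\<^bsub>?R\<^esub> B) \<odot>\<^bsub>?M\<^esub> S = A \<odot>\<^bsub>?M\<^esub> (B \<odot>\<^bsub>?M\<^esub> S)"
      using c by (simp add: eq s left_smult_closed left_smult_assoc)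
  next
    fix A S T assume *: "A \<in> stalk X \<O> x" "S \<in> stalk X \<M> x" "T \<in> stalk X \<M> x"
    then obtain U a s t where U: "openin X U" "x \<in> U"
      and c: "a \<in> \<Gamma> \<O> U" "s \<in> \<Gamma> \<M> U" "t \<in> \<Gamma> \<M> U"
      and eq: "A = germ X \<O> x U a" "S = germ X \<M> x U s" "T = germ X \<M> x U t"
      using stalk_module_cases[OF *(1,1,2,3,3)] by metis
    interpret left_module "sections \<O> U" "sections \<M> U" by (rule modules[OF U(1)])
    note s = stalk_module_ops[OF U] O.stalk_ring_ops[OF U]
    show "A \<odot>\<^bsub>?M\<^esub> (S \<oplus>\<^bsub>?M\<^esub> T) = A \<odot>\<^bsub>?M\<^esub> S \<oplus>\<^bsub>?M\<^esub> A \<odot>\<^bsub>?M\<^esub> T"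
      using c by (simp add: eq s left_smult_closed left_smult_r_distr)
  next
    fix A S assume *: "A \<in> stalk X \<O> x" "S \<in> stalk X \<M> x"
    then obtain U a s where U: "openin X U" "x \<in> U"
      and c: "a \<in> \<Gamma> \<O> U" "s \<in> \<Gamma> \<M> U"
      and eq: "A = germ X \<O> x U a" "S = germ X \<M> x U s"
      using stalk_module_cases[OF *(1,1,2,2,2)] by metis
    interpret left_module "sections \<O> U" "sections \<M> U" by (rule modules[OF U(1)])
    show "A \<odot>\<^bsub>?M\<^esub> S \<in> stalk X \<M> x"
      using c U by (simp add: eq stalk_module_ops[OF U] left_smult_closed germ_in_stalk)
  next
    fix S assume *: "S \<in> stalk X \<M> x"
    then obtain U s where U: "openin X U" "x \<in> U"
      and c: "s \<in> \<Gamma> \<M> U"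
      and eq: "S = germ X \<M> x U s"
      using stalk_module_cases[OF zeroR zeroR *(1,1,1)] by metis
    interpret left_module "sections \<O> U" "sections \<M> U" by (rule modules[OF U(1)])
    show "\<one>\<^bsub>?R\<^esub> \<odot>\<^bsub>?M\<^esub> S = S"
      using c by (simp add: eq stalk_module_ops[OF U] O.stalk_ring_ops[OF U] left_smult_one)
  qed
  ultimately show ?thesis
    unfolding left_module_def using O.ring_stalk[OF x] by blast
qed

lemma germ_eq_zero_iff:
  assumes U: "openin X U" "x \<in> U" "s \<in> \<Gamma> \<M> U"
  shows "germ X \<M> x U s = \<zero>\<^bsub>stalk_module X \<O> \<M> x\<^esub> \<longleftrightarrow>
    (\<exists>W. openin X W \<and> x \<in> W \<and> W \<subseteq> U \<and> restr \<M> U W s = \<zero>\<^bsub>sections \<M> W\<^esub>)"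
proof -
  have "germ X \<M> x U s = \<zero>\<^bsub>stalk_module X \<O> \<M> x\<^esub> \<longleftrightarrow>
      (\<exists>W. openin X W \<and> x \<in> W \<and> W \<subseteq> U \<inter> U \<and> restr \<M> U W s = restr \<M> U W \<zero>\<^bsub>sections \<M> U\<^esub>)"
    using U by (subst stalk_module_ops(3)[OF U(1,2)], subst germ_eq_iff) (auto simp: module_ops_closed)
  also have "\<dots> \<longleftrightarrow> (\<exists>W. openin X W \<and> x \<in> W \<and> W \<subseteq> U \<and> restr \<M> U W s = \<zero>\<^bsub>sections \<M> W\<^esub>)"
    using U by (auto simp: restr_zero)
  finally show ?thesis .
qed

end

section \<open>Sheafification\<close>

context module_presheaf_on
begin

abbreviation sh :: "('a, 'r, 'a \<Rightarrow> ('a set \<times> 'm) set) module_presheaf" where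
  "sh \<equiv> sheafification X \<O> \<M>"

text \<open>The canonical map from the presheaf to its sheafification. Its kernel consists of the
  locally vanishing sections (\<open>to_sh_eq_zero_iff\<close>), and every section of the
  sheafification is locally in its image (\<open>sh_local\<close>).\<close>

definition to_sh :: "'a set \<Rightarrow> 'm \<Rightarrow> 'a \<Rightarrow> ('a set \<times> 'm) set" where
  "to_sh U s = (\<lambda>x\<in>U. germ X \<M> x U s)"

lemma sh_memI:
  assumes "\<sigma> \<in> extensional U"
    and "\<And>x. x \<in> U \<Longrightarrow> \<exists>V t. openin X V \<and> x \<in> V \<and> V \<subseteq> U \<and> t \<in> \<Gamma> \<M> V \<and>
      (\<forall>y\<in>V. \<sigma> y = germ X \<M> y V t)"
  shows "\<sigma> \<in> \<Gamma> sh U"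
proof -
  have "\<sigma> x \<in> stalk X \<M> x" if "x \<in> U" for x
    using assms(2)[OF that] by (auto intro: germ_in_stalk)
  then show ?thesis
    using assms by (simp add: sheafification_def PiE_def)
qed

lemma sh_memD:
  assumes "\<sigma> \<in> \<Gamma> sh U"
  shows "\<sigma> \<in> extensional U" and "x \<in> U \<Longrightarrow> \<sigma> x \<in> stalk X \<M> x"
    and "x \<in> U \<Longrightarrow> \<exists>V t. openin X V \<and> x \<in> V \<and> V \<subseteq> U \<and> t \<in> \<Gamma> \<M> V \<and>
      (\<forall>y\<in>V. \<sigma> y = germ X \<M> y V t)"
  using assms by (auto simp: sheafification_def PiE_def)

lemma to_sh_closed: "openin X U \<Longrightarrow> s \<in> \<Gamma> \<M> U \<Longrightarrow> to_sh U s \<in> \<Gamma> sh U"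
  by (rule sh_memI) (auto simp: to_sh_def)

lemma restr_sh: "restr sh U V \<sigma> = restrict \<sigma> V"
  by (simp add: sheafification_def)

lemma restr_to_sh:
  "openin X U \<Longrightarrow> openin X V \<Longrightarrow> V \<subseteq> U \<Longrightarrow> s \<in> \<Gamma> \<M> U \<Longrightarrow>
    restr sh U V (to_sh U s) = to_sh V (restr \<M> U V s)"
  by (rule ext) (auto simp: to_sh_def restr_sh germ_restr)

lemma sh_local:
  assumes "\<sigma> \<in> \<Gamma> sh U" "x \<in> U"
  obtains V t where "openin X V" "x \<in> V" "V \<subseteq> U" "t \<in> \<Gamma> \<M> V"
    "restr sh U V \<sigma> = to_sh V t"
proof -
  obtain V t where V: "openin X V" "x \<in> V" "V \<subseteq> U" "t \<in> \<Gamma> \<M> V"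
    and eq: "\<And>y. y \<in> V \<Longrightarrow> \<sigma> y = germ X \<M> y V t"
    using sh_memD(3)[OF assms] by blast
  have "restr sh U V \<sigma> = to_sh V t"
    by (rule ext) (simp add: restr_sh to_sh_def eq)
  with V that show ?thesis by blast
qed

lemma sh_add: "\<sigma> \<oplus>\<^bsub>sections sh U\<^esub> \<tau> = (\<lambda>x\<in>U. \<sigma> x \<oplus>\<^bsub>stalk_module X \<O> \<M> x\<^esub> \<tau> x)"
  and sh_smult: "r \<odot>\<^bsub>sections sh U\<^esub> \<sigma> = (\<lambda>x\<in>U. germ X \<O> x U r \<odot>\<^bsub>stalk_module X \<O> \<M> x\<^esub> \<sigma> x)"
  and sh_zero: "\<zero>\<^bsub>sections sh U\<^esub> = (\<lambda>x\<in>U. \<zero>\<^bsub>stalk_module X \<O> \<M> x\<^esub>)"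
  by (simp_all add: sheafification_def)

lemma to_sh_add: "openin X U \<Longrightarrow> s \<in> \<Gamma> \<M> U \<Longrightarrow> t \<in> \<Gamma> \<M> U \<Longrightarrow>
    to_sh U (s \<oplus>\<^bsub>sections \<M> U\<^esub> t) = to_sh U s \<oplus>\<^bsub>sections sh U\<^esub> to_sh U t"
  by (rule ext) (simp add: sh_add to_sh_def stalk_module_ops)

lemma to_sh_smult: "openin X U \<Longrightarrow> r \<in> \<Gamma> \<O> U \<Longrightarrow> t \<in> \<Gamma> \<M> U \<Longrightarrow>
    to_sh U (r \<odot>\<^bsub>sections \<M> U\<^esub> t) = r \<odot>\<^bsub>sections sh U\<^esub> to_sh U t"
  by (rule ext) (simp add: sh_smult to_sh_def stalk_module_ops)

lemma to_sh_zero: "openin X U \<Longrightarrow> to_sh U \<zero>\<^bsub>sections \<M> U\<^esub> = \<zero>\<^bsub>sections sh U\<^esub>"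
  by (rule ext) (simp add: sh_zero to_sh_def stalk_module_ops(3)[of U])

lemma to_sh_eq_zero_iff:
  assumes "openin X U" "s \<in> \<Gamma> \<M> U"
  shows "to_sh U s = \<zero>\<^bsub>sections sh U\<^esub> \<longleftrightarrow>
    (\<forall>x\<in>U. \<exists>W. openin X W \<and> x \<in> W \<and> W \<subseteq> U \<and> restr \<M> U W s = \<zero>\<^bsub>sections \<M> W\<^esub>)"
proof -
  have "to_sh U s = \<zero>\<^bsub>sections sh U\<^esub> \<longleftrightarrow>
      (\<forall>x\<in>U. germ X \<M> x U s = \<zero>\<^bsub>stalk_module X \<O> \<M> x\<^esub>)"
    by (auto simp: to_sh_def sh_zero fun_eq_iff restrict_def)
  then show ?thesis
    using assms by (simp add: germ_eq_zero_iff)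
qed

lemma sh_add_closed:
  assumes "openin X U" "\<sigma> \<in> \<Gamma> sh U" "\<tau> \<in> \<Gamma> sh U"
  shows "\<sigma> \<oplus>\<^bsub>sections sh U\<^esub> \<tau> \<in> \<Gamma> sh U"
proof (rule sh_memI)
  fix x assume x: "x \<in> U"
  obtain V s where V: "openin X V" "x \<in> V" "V \<subseteq> U" "s \<in> \<Gamma> \<M> V"
      "\<And>y. y \<in> V \<Longrightarrow> \<sigma> y = germ X \<M> y V s"
    using sh_memD(3)[OF assms(2) x] by blast
  obtain W t where W: "openin X W" "x \<in> W" "W \<subseteq> U" "t \<in> \<Gamma> \<M> W"
      "\<And>y. y \<in> W \<Longrightarrow> \<tau> y = germ X \<M> y W t"
    using sh_memD(3)[OF assms(3) x] by blast
  let ?V = "V \<inter> W"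
  have VW: "openin X ?V" "?V \<subseteq> V" "?V \<subseteq> W"
    using V W by auto
  have c: "restr \<M> V ?V s \<in> \<Gamma> \<M> ?V" "restr \<M> W ?V t \<in> \<Gamma> \<M> ?V"
    using V W VW by (auto intro: restr_closed)
  have "(\<sigma> \<oplus>\<^bsub>sections sh U\<^esub> \<tau>) y = germ X \<M> y ?V (restr \<M> V ?V s \<oplus>\<^bsub>sections \<M> ?V\<^esub> restr \<M> W ?V t)"
    if y: "y \<in> ?V" for y
  proof -
    have "(\<sigma> \<oplus>\<^bsub>sections sh U\<^esub> \<tau>) y =
        germ X \<M> y ?V (restr \<M> V ?V s) \<oplus>\<^bsub>stalk_module X \<O> \<M> y\<^esub> germ X \<M> y ?V (restr \<M> W ?V t)"
      using y V W VW by (auto simp: sh_add germ_restr)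
    then show ?thesis
      using y VW c by (simp add: stalk_module_ops)
  qed
  then show "\<exists>V' t'. openin X V' \<and> x \<in> V' \<and> V' \<subseteq> U \<and> t' \<in> \<Gamma> \<M> V' \<and>
      (\<forall>y\<in>V'. (\<sigma> \<oplus>\<^bsub>sections sh U\<^esub> \<tau>) y = germ X \<M> y V' t')"
    using V(2,3) W(2) VW module_ops_closed(1)[OF VW(1) c]
    by (intro exI[of _ ?V] exI[of _ "restr \<M> V ?V s \<oplus>\<^bsub>sections \<M> ?V\<^esub> restr \<M> W ?V t"]) auto
qed (simp add: sh_add)

lemma sh_smult_closed:
  assumes U: "openin X U" and "r \<in> \<Gamma> \<O> U" "\<sigma> \<in> \<Gamma> sh U"
  shows "r \<odot>\<^bsub>sections sh U\<^esub> \<sigma> \<in> \<Gamma> sh U"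
proof (rule sh_memI)
  fix x assume x: "x \<in> U"
  obtain V s where V: "openin X V" "x \<in> V" "V \<subseteq> U" "s \<in> \<Gamma> \<M> V"
      "\<And>y. y \<in> V \<Longrightarrow> \<sigma> y = germ X \<M> y V s"
    using sh_memD(3)[OF assms(3) x] by blast
  have c: "restr \<O> U V r \<in> \<Gamma> \<O> V"
    using V assms by (auto intro: O.restr_closed)
  have "(r \<odot>\<^bsub>sections sh U\<^esub> \<sigma>) y = germ X \<M> y V (restr \<O> U V r \<odot>\<^bsub>sections \<M> V\<^esub> s)"
    if y: "y \<in> V" for y
  proof -
    have "(r \<odot>\<^bsub>sections sh U\<^esub> \<sigma>) y =
        germ X \<O> y V (restr \<O> U V r) \<odot>\<^bsub>stalk_module X \<O> \<M> y\<^esub> germ X \<M> y V s"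
      using y V assms by (auto simp: sh_smult O.germ_restr)
    then show ?thesis
      using y V c by (simp add: stalk_module_ops)
  qed
  then show "\<exists>V' t'. openin X V' \<and> x \<in> V' \<and> V' \<subseteq> U \<and> t' \<in> \<Gamma> \<M> V' \<and>
      (\<forall>y\<in>V'. (r \<odot>\<^bsub>sections sh U\<^esub> \<sigma>) y = germ X \<M> y V' t')"
    using V(1-3) module_ops_closed(2)[OF V(1) c V(4)]
    by (intro exI[of _ V] exI[of _ "restr \<O> U V r \<odot>\<^bsub>sections \<M> V\<^esub> s"]) simp
qed (simp add: sh_smult)

text \<open>Sections are functions with values in the stalks, so the module laws hold because they
  hold in each stalk.\<close>

lemma left_module_sh:
  assumes U: "openin X U"
  shows "left_module (sections \<O> U) (sections sh U)"
proof -
  interpret R: ring "sections \<O> U" by (rule O.rings[OF U])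
  let ?M = "sections sh U"
  have top: "x \<in> topspace X" if "x \<in> U" for x
    using that U openin_subset by blast
  have germ_closed: "germ X \<O> x U r \<in> carrier (stalk_ring X \<O> x)"
    if "x \<in> U" "r \<in> \<Gamma> \<O> U" for x r
    using that U by (simp add: O.carrier_stalk_ring O.germ_in_stalk)
  have mem: "\<sigma> x \<in> carrier (stalk_module X \<O> \<M> x)" if "\<sigma> \<in> carrier ?M" "x \<in> U" for \<sigma> x
    using sh_memD(2)[OF that] by (simp add: carrier_stalk_module)
  have mod: "left_module (stalk_ring X \<O> x) (stalk_module X \<O> \<M> x)" if "x \<in> U" for x
    by (rule left_module_stalk[OF top[OF that]])
  have ab: "abelian_group (stalk_module X \<O> \<M> x)" if "x \<in> U" for x
    using mod[OF that] unfolding left_module_def by blast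
  \<comment> \<open>The unit law and the distributive law precede the group structure because
    negation is built from them.\<close>
  have one: "\<one>\<^bsub>sections \<O> U\<^esub> \<odot>\<^bsub>?M\<^esub> \<sigma> = \<sigma>" if \<sigma>: "\<sigma> \<in> carrier ?M" for \<sigma>
  proof
    fix x show "(\<one>\<^bsub>sections \<O> U\<^esub> \<odot>\<^bsub>?M\<^esub> \<sigma>) x = \<sigma> x"
    proof (cases "x \<in> U")
      case True
      then show ?thesis
        using left_module.left_smult_one[OF mod[OF True] mem[OF \<sigma> True]] U
        by (simp add: sh_smult O.stalk_ring_ops(4)[of U x])
    qed (use sh_memD(1)[OF \<sigma>] in \<open>auto simp: sh_smult extensional_def\<close>)
  qed
  have l_distr: "(a \<oplus>\<^bsub>sections \<O> U\<^esub> b) \<odot>\<^bsub>?M\<^esub> \<sigma> = a \<odot>\<^bsub>?M\<^esub> \<sigma> \<oplus>\<^bsub>?M\<^esub> b \<odot>\<^bsub>?M\<^esub> \<sigma>"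
    if "a \<in> \<Gamma> \<O> U" "b \<in> \<Gamma> \<O> U" "\<sigma> \<in> carrier ?M" for a b \<sigma>
  proof
    fix x show "((a \<oplus>\<^bsub>sections \<O> U\<^esub> b) \<odot>\<^bsub>?M\<^esub> \<sigma>) x = (a \<odot>\<^bsub>?M\<^esub> \<sigma> \<oplus>\<^bsub>?M\<^esub> b \<odot>\<^bsub>?M\<^esub> \<sigma>) x"
      using that U left_module.left_smult_l_distr[OF mod[of x] germ_closed[of x a] germ_closed[of x b] mem[of \<sigma> x]]
      by (simp add: sh_smult sh_add O.stalk_ring_ops restrict_def)
  qed
  have "abelian_group ?M"
  proof (rule abelian_groupI)
    fix \<sigma> \<tau> \<rho> assume "\<sigma> \<in> carrier ?M" "\<tau> \<in> carrier ?M" "\<rho> \<in> carrier ?M"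
    then show "\<sigma> \<oplus>\<^bsub>?M\<^esub> \<tau> \<oplus>\<^bsub>?M\<^esub> \<rho> = \<sigma> \<oplus>\<^bsub>?M\<^esub> (\<tau> \<oplus>\<^bsub>?M\<^esub> \<rho>)"
      unfolding sh_add by (intro restrict_ext) (simp add: abelian_groupE(3)[OF ab] mem)
  next
    fix \<sigma> \<tau> assume "\<sigma> \<in> carrier ?M" "\<tau> \<in> carrier ?M"
    then show "\<sigma> \<oplus>\<^bsub>?M\<^esub> \<tau> = \<tau> \<oplus>\<^bsub>?M\<^esub> \<sigma>"
      unfolding sh_add by (intro restrict_ext) (simp add: abelian_groupE(4)[OF ab] mem)
  next
    show "\<zero>\<^bsub>?M\<^esub> \<in> carrier ?M"
      using to_sh_closed[OF U] to_sh_zero[OF U] module_ops_closed(3)[OF U] by metis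
  next
    fix \<sigma> assume \<sigma>: "\<sigma> \<in> carrier ?M"
    show "\<zero>\<^bsub>?M\<^esub> \<oplus>\<^bsub>?M\<^esub> \<sigma> = \<sigma>"
    proof
      fix x show "(\<zero>\<^bsub>?M\<^esub> \<oplus>\<^bsub>?M\<^esub> \<sigma>) x = \<sigma> x"
      proof (cases "x \<in> U")
        case True
        then show ?thesis
          using abelian_groupE(5)[OF ab[OF True] mem[OF \<sigma> True]] by (simp add: sh_add sh_zero)
      qed (use sh_memD(1)[OF \<sigma>] in \<open>auto simp: sh_add extensional_def\<close>)
    qed
    \<comment> \<open>The inverse of \<open>\<sigma>\<close> is its multiple by minus one, which is
      a section by closure under scalars; a pointwise inverse would still have to be shown to be
      locally given by a section of \<open>\<M>\<close>.\<close>
    let ?a = "\<ominus>\<^bsub>sections \<O> U\<^esub> \<one>\<^bsub>sections \<O> U\<^esub>"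
    have "?a \<odot>\<^bsub>?M\<^esub> \<sigma> \<oplus>\<^bsub>?M\<^esub> \<sigma> = (?a \<oplus>\<^bsub>sections \<O> U\<^esub> \<one>\<^bsub>sections \<O> U\<^esub>) \<odot>\<^bsub>?M\<^esub> \<sigma>"
      using \<sigma> by (simp add: l_distr one)
    also have "\<dots> = \<zero>\<^bsub>?M\<^esub>"
    proof
      fix x show "((?a \<oplus>\<^bsub>sections \<O> U\<^esub> \<one>\<^bsub>sections \<O> U\<^esub>) \<odot>\<^bsub>?M\<^esub> \<sigma>) x = \<zero>\<^bsub>?M\<^esub> x"
        using U left_module.smult_l_null[OF mod[of x] mem[OF \<sigma>]] O.stalk_ring_ops(3)[of U x]
        by (simp add: R.l_neg sh_smult sh_zero restrict_def)
    qed
    finally show "\<exists>\<tau>\<in>carrier ?M. \<tau> \<oplus>\<^bsub>?M\<^esub> \<sigma> = \<zero>\<^bsub>?M\<^esub>"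
      using sh_smult_closed[OF U _ \<sigma>, of ?a] by auto
  qed (rule sh_add_closed[OF U])
  moreover have "left_module_axioms (sections \<O> U) ?M"
  proof
    fix a b \<sigma> assume "a \<in> \<Gamma> \<O> U" "b \<in> \<Gamma> \<O> U" "\<sigma> \<in> carrier ?M"
    then show "(a \<otimes>\<^bsub>sections \<O> U\<^esub> b) \<odot>\<^bsub>?M\<^esub> \<sigma> = a \<odot>\<^bsub>?M\<^esub> (b \<odot>\<^bsub>?M\<^esub> \<sigma>)"
      unfolding sh_smult using U
      by (intro restrict_ext)
        (simp add: O.stalk_ring_ops(2)[symmetric] left_module.left_smult_assoc[OF mod] germ_closed mem)
  next
    fix a \<sigma> \<tau> assume "a \<in> \<Gamma> \<O> U" "\<sigma> \<in> carrier ?M" "\<tau> \<in> carrier ?M"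
    then show "a \<odot>\<^bsub>?M\<^esub> (\<sigma> \<oplus>\<^bsub>?M\<^esub> \<tau>) = a \<odot>\<^bsub>?M\<^esub> \<sigma> \<oplus>\<^bsub>?M\<^esub> a \<odot>\<^bsub>?M\<^esub> \<tau>"
      unfolding sh_smult sh_add
      by (intro restrict_ext) (simp add: left_module.left_smult_r_distr[OF mod] germ_closed mem)
  qed (use U in \<open>auto simp: sh_smult_closed l_distr one\<close>)
  ultimately show ?thesis
    unfolding left_module_def using R.ring_axioms by blast
qed

lemma restr_sh_closed:
  assumes "openin X U" "openin X V" "V \<subseteq> U" "\<sigma> \<in> \<Gamma> sh U"
  shows "restr sh U V \<sigma> \<in> \<Gamma> sh V"
proof (rule sh_memI)
  fix x assume x: "x \<in> V"
  then have "x \<in> U"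
    using assms(3) by blast
  obtain W s where W: "openin X W" "x \<in> W" "W \<subseteq> U" "s \<in> \<Gamma> \<M> W"
      "\<And>y. y \<in> W \<Longrightarrow> \<sigma> y = germ X \<M> y W s"
    using sh_memD(3)[OF assms(4) \<open>x \<in> U\<close>] by blast
  have "openin X (W \<inter> V)" "restr \<M> W (W \<inter> V) s \<in> \<Gamma> \<M> (W \<inter> V)"
    using W assms by (auto intro: restr_closed)
  moreover have "restr sh U V \<sigma> y = germ X \<M> y (W \<inter> V) (restr \<M> W (W \<inter> V) s)" if "y \<in> W \<inter> V" for y
    using that W \<open>openin X (W \<inter> V)\<close> by (simp add: restr_sh germ_restr)
  ultimately show "\<exists>V' t. openin X V' \<and> x \<in> V' \<and> V' \<subseteq> V \<and> t \<in> \<Gamma> \<M> V' \<and>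
      (\<forall>y\<in>V'. restr sh U V \<sigma> y = germ X \<M> y V' t)"
    using x W by (intro exI[of _ "W \<inter> V"] exI[of _ "restr \<M> W (W \<inter> V) s"]) auto
qed (simp add: restr_sh)

lemma is_presheaf_sh: "is_presheaf X sh"
  unfolding is_presheaf_def
proof (intro conjI allI impI ballI)
  show "restr sh U U \<sigma> = \<sigma>" if "\<sigma> \<in> \<Gamma> sh U" for U \<sigma>
    using sh_memD(1)[OF that] by (simp add: restr_sh extensional_restrict)
next
  show "restr sh V W (restr sh U V \<sigma>) = restr sh U W \<sigma>" if "W \<subseteq> V" for U V W \<sigma>
    using that by (simp add: restr_sh Int_absorb1)
qed (auto intro: restr_sh_closed)

text \<open>Gluing is gluing of functions on a union, and being locally given by the germs of a
  section is a local condition.\<close>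

lemma is_sheaf_sh: "is_sheaf X sh"
  unfolding is_sheaf_def
proof (intro conjI allI impI is_presheaf_sh)
  fix \<V> and s :: "'a set \<Rightarrow> 'a \<Rightarrow> ('a set \<times> 'm) set"
  assume s: "\<forall>V\<in>\<V>. openin X V \<and> s V \<in> \<Gamma> sh V"
    and eq: "\<forall>V\<in>\<V>. \<forall>W\<in>\<V>. restr sh V (V \<inter> W) (s V) = restr sh W (V \<inter> W) (s W)"
  \<comment> \<open>The choice of a member of the cover at each point is immaterial, as the
    \<open>s V\<close> agree on overlaps.\<close>
  define t where "t = (\<lambda>x\<in>\<Union>\<V>. s (SOME V. V \<in> \<V> \<and> x \<in> V) x)"
  have t: "t x = s V x" if "V \<in> \<V>" "x \<in> V" for V x
  proof -
    define W where "W = (SOME V. V \<in> \<V> \<and> x \<in> V)"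
    have W: "W \<in> \<V> \<and> x \<in> W"
      unfolding W_def by (rule someI[of _ V]) (use that in simp)
    then have "restrict (s V) (V \<inter> W) = restrict (s W) (V \<inter> W)"
      using eq[rule_format, OF that(1) conjunct1[OF W]] by (simp only: restr_sh)
    then have "restrict (s V) (V \<inter> W) x = restrict (s W) (V \<inter> W) x"
      by (rule fun_cong)
    then show ?thesis
      using that W by (auto simp: t_def W_def[symmetric])
  qed
  have "t \<in> \<Gamma> sh (\<Union>\<V>)"
  proof (rule sh_memI)
    fix x assume "x \<in> \<Union>\<V>"
    then obtain V where V: "V \<in> \<V>" "x \<in> V" by blast
    then have "s V \<in> \<Gamma> sh V"
      using s by blast
    obtain W u where "openin X W" "x \<in> W" "W \<subseteq> V" "u \<in> \<Gamma> \<M> W"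
      "\<And>y. y \<in> W \<Longrightarrow> s V y = germ X \<M> y W u"
      using sh_memD(3)[OF \<open>s V \<in> \<Gamma> sh V\<close> V(2)] by blast
    then show "\<exists>W u. openin X W \<and> x \<in> W \<and> W \<subseteq> \<Union>\<V> \<and> u \<in> \<Gamma> \<M> W \<and>
        (\<forall>y\<in>W. t y = germ X \<M> y W u)"
      using V by (intro exI[of _ W] exI[of _ u]) (auto simp: t subset_iff)
  qed (simp add: t_def)
  moreover have "restr sh (\<Union>\<V>) V t = s V" if "V \<in> \<V>" for V
    using that s sh_memD(1)[of "s V" V] by (intro ext) (auto simp: restr_sh t restrict_def extensional_def)
  moreover have "t' = t" if "t' \<in> \<Gamma> sh (\<Union>\<V>)"
    "\<forall>V\<in>\<V>. restr sh (\<Union>\<V>) V t' = s V" for t'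
  proof (rule extensionalityI)
    show "t' \<in> extensional (\<Union>\<V>)" "t \<in> extensional (\<Union>\<V>)"
      using that(1) sh_memD(1) by (auto simp: t_def)
    fix x assume "x \<in> \<Union>\<V>"
    then obtain V where V: "V \<in> \<V>" "x \<in> V" by blast
    then have "restrict t' V x = s V x"
      using that(2) by (simp add: restr_sh)
    then show "t' x = t x"
      using V by (simp add: t)
  qed
  ultimately show "\<exists>!t. t \<in> \<Gamma> sh (\<Union>\<V>) \<and> (\<forall>V\<in>\<V>. restr sh (\<Union>\<V>) V t = s V)"
    by blast
qed

theorem module_sheaf_sh: "module_sheaf X \<O> sh"
  unfolding module_sheaf_def
proof (intro conjI allI impI ballI is_sheaf_sh left_module_sh)
  fix U V \<sigma> \<tau> assume "openin X U" "openin X V" "V \<subseteq> U"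
  then show "restr sh U V (\<sigma> \<oplus>\<^bsub>sections sh U\<^esub> \<tau>) = restr sh U V \<sigma> \<oplus>\<^bsub>sections sh V\<^esub> restr sh U V \<tau>"
    by (intro ext) (auto simp: restr_sh sh_add)
next
  fix U V r \<sigma> assume "openin X U" "openin X V" "V \<subseteq> U" "r \<in> \<Gamma> \<O> U"
  then show "restr sh U V (r \<odot>\<^bsub>sections sh U\<^esub> \<sigma>) = restr \<O> U V r \<odot>\<^bsub>sections sh V\<^esub> restr sh U V \<sigma>"
    by (intro ext) (auto simp: restr_sh sh_smult O.germ_restr)
qed

end

lemma (in ring_presheaf_on) module_presheaf_on_sheaf:
  assumes M: "module_sheaf X \<O> \<M>"
  shows "module_presheaf_on X \<O> \<M>"
proof (intro module_presheaf_on.intro presheaf_on.intro module_presheaf_on_axioms.intro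
    ring_presheaf_on_axioms)
  show "is_presheaf X \<M>"
    using M by (simp add: module_sheaf_def is_sheaf_def)
  fix U assume U: "openin X U"
  show "left_module (sections \<O> U) (sections \<M> U)"
    using M U by (simp add: module_sheaf_def)
  fix V s assume *: "openin X V" "V \<subseteq> U" "s \<in> \<Gamma> \<M> U"
  show "restr \<M> U V (s \<oplus>\<^bsub>sections \<M> U\<^esub> t) = restr \<M> U V s \<oplus>\<^bsub>sections \<M> V\<^esub> restr \<M> U V t"
    if "t \<in> \<Gamma> \<M> U" for t
    using M U * that by (simp add: module_sheaf_def)
  show "restr \<M> U V (r \<odot>\<^bsub>sections \<M> U\<^esub> s) = restr \<O> U V r \<odot>\<^bsub>sections \<M> V\<^esub> restr \<M> U V s"
    if "r \<in> \<Gamma> \<O> U" for r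
    using M U * that by (simp add: module_sheaf_def)
qed

lemma ring_presheaf_on_ringed_space: "ringed_space X \<O> \<Longrightarrow> ring_presheaf_on X \<O>"
  by (intro ring_presheaf_on.intro presheaf_on.intro ring_presheaf_on_axioms.intro)
    (simp_all add: ringed_space_def is_sheaf_def)

section \<open>Subsheaves and restriction to open subsets\<close>

lemma module_presheaf_on_subtopology:
  assumes "module_presheaf_on X \<O> \<M>" and U: "openin X U"
  shows "module_presheaf_on (subtopology X U) \<O> \<M>"
proof -
  interpret module_presheaf_on X \<O> \<M> by fact
  show ?thesis
    by (intro module_presheaf_on.intro ring_presheaf_on.intro presheaf_on.intro
        ring_presheaf_on_axioms.intro module_presheaf_on_axioms.intro)
      (use U in \<open>auto simp: is_presheaf_def openin_open_subtopology restr_closed restr_id restr_restr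
        O.restr_closed O.restr_id O.restr_restr O.rings O.restr_ring_hom modules restr_add restr_smult\<close>)
qed

lemma module_presheaf_on_subsheaf:
  assumes "module_presheaf_on X \<O> \<M>"
    and K: "\<And>U. openin X U \<Longrightarrow> submodule (\<K> U) (sections \<O> U) (sections \<M> U)"
    and K_restr: "\<And>U V s. openin X U \<Longrightarrow> openin X V \<Longrightarrow> V \<subseteq> U \<Longrightarrow> s \<in> \<K> U \<Longrightarrow> restr \<M> U V s \<in> \<K> V"
  shows "module_presheaf_on X \<O> (subsheaf \<M> \<K>)"
proof -
  interpret module_presheaf_on X \<O> \<M> by fact
  have sub: "s \<in> \<Gamma> \<M> U" if "openin X U" "s \<in> \<K> U" for U s
    using left_module.left_submoduleD(1)[OF modules[OF that(1)] K[OF that(1)]] that(2) by blast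
  show ?thesis
  proof (intro module_presheaf_on.intro presheaf_on.intro module_presheaf_on_axioms.intro
      O.ring_presheaf_on_axioms)
    show "is_presheaf X (subsheaf \<M> \<K>)"
      by (auto simp: is_presheaf_def subsheaf_def sub K_restr restr_id restr_restr)
    show "left_module (sections \<O> U) (sections (subsheaf \<M> \<K>) U)" if "openin X U" for U
      using left_module.left_module_submodule[OF modules[OF that] K[OF that]] by (simp add: subsheaf_def)
  qed (auto simp: subsheaf_def sub restr_add restr_smult)
qed

lemma submodule_sheaf_restr:
  assumes "submodule_sheaf X \<O> \<M> \<K>" "openin X U" "openin X V" "V \<subseteq> U" "s \<in> \<K> U"
  shows "restr \<M> U V s \<in> \<K> V"
proof -
  have "is_presheaf X (subsheaf \<M> \<K>)"
    using assms(1) by (simp add: submodule_sheaf_def is_sheaf_def)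
  then have "restr (subsheaf \<M> \<K>) U V \<in> \<Gamma> (subsheaf \<M> \<K>) U \<rightarrow> \<Gamma> (subsheaf \<M> \<K>) V"
    using assms(2-4) by (simp add: is_presheaf_def)
  then show ?thesis
    using assms(5) by (auto simp: subsheaf_def)
qed

lemma submodule_sheaf_subset:
  assumes "module_presheaf_on X \<O> \<M>" "submodule_sheaf X \<O> \<M> \<K>" "openin X U"
  shows "\<K> U \<subseteq> \<Gamma> \<M> U"
  using assms left_module.left_submoduleD(1) module_presheaf_on.modules
  unfolding submodule_sheaf_def by metis

text \<open>Uniqueness of gluing, applied to the cover by all open subsets of \<open>U\<close> on
  which \<open>s\<close> and \<open>t\<close> agree.\<close>

lemma sheaf_section_eqI:
  assumes "is_sheaf X F" "openin X U"
    and s: "s \<in> \<Gamma> F U" and t: "t \<in> \<Gamma> F U"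
    and eq: "\<And>x. x \<in> U \<Longrightarrow> \<exists>V. openin X V \<and> x \<in> V \<and> V \<subseteq> U \<and> restr F U V s = restr F U V t"
  shows "s = t"
proof -
  interpret presheaf_on X F
    by unfold_locales (use assms(1) in \<open>simp add: is_sheaf_def\<close>)
  define \<V> where "\<V> = {V. openin X V \<and> V \<subseteq> U \<and> restr F U V s = restr F U V t}"
  have U: "\<Union>\<V> = U"
    using eq by (auto simp: \<V>_def)
  have 1: "\<forall>V\<in>\<V>. openin X V \<and> restr F U V s \<in> \<Gamma> F V"
    using assms(2) s t by (auto simp: \<V>_def restr_closed)
  have 2: "\<forall>V\<in>\<V>. \<forall>W\<in>\<V>. restr F V (V \<inter> W) (restr F U V s) = restr F W (V \<inter> W) (restr F U W s)"
    using assms(2) s t by (auto simp: \<V>_def restr_restr openin_Int)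
  have "\<exists>!t. t \<in> \<Gamma> F (\<Union>\<V>) \<and> (\<forall>V\<in>\<V>. restr F (\<Union>\<V>) V t = restr F U V s)"
    using conjunct2[OF assms(1)[unfolded is_sheaf_def], rule_format, of \<V> "\<lambda>V. restr F U V s"] 1 2 by blast
  moreover have "\<forall>V\<in>\<V>. restr F U V t = restr F U V s"
    by (simp add: \<V>_def)
  ultimately show ?thesis
    using s t U by auto
qed

text \<open>The restrictions of \<open>s\<close> that lie in \<open>\<K>\<close> glue to a section
  of \<open>\<K>\<close>, which is \<open>s\<close> by uniqueness in \<open>\<M>\<close>. The later
  passages from germs back to sections rest on this.\<close>

lemma submodule_sheaf_local:
  assumes M: "module_presheaf_on X \<O> \<M>" "is_sheaf X \<M>" and K: "submodule_sheaf X \<O> \<M> \<K>"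
    and U: "openin X U" and s: "s \<in> \<Gamma> \<M> U"
    and local: "\<And>x. x \<in> U \<Longrightarrow> \<exists>V. openin X V \<and> x \<in> V \<and> V \<subseteq> U \<and> restr \<M> U V s \<in> \<K> V"
  shows "s \<in> \<K> U"
proof -
  interpret module_presheaf_on X \<O> \<M> by fact
  have sheaf: "is_sheaf X (subsheaf \<M> \<K>)"
    using K by (simp add: submodule_sheaf_def)
  define \<V> where "\<V> = {V. openin X V \<and> V \<subseteq> U \<and> restr \<M> U V s \<in> \<K> V}"
  have UV: "\<Union>\<V> = U"
    using local by (auto simp: \<V>_def)
  have 1: "\<forall>V\<in>\<V>. openin X V \<and> restr \<M> U V s \<in> \<Gamma> (subsheaf \<M> \<K>) V"
    by (auto simp: \<V>_def subsheaf_def)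
  have 2: "\<forall>V\<in>\<V>. \<forall>W\<in>\<V>. restr (subsheaf \<M> \<K>) V (V \<inter> W) (restr \<M> U V s) =
      restr (subsheaf \<M> \<K>) W (V \<inter> W) (restr \<M> U W s)"
    using U s by (auto simp: \<V>_def subsheaf_def restr_restr openin_Int)
  obtain t where t: "t \<in> \<Gamma> (subsheaf \<M> \<K>) (\<Union>\<V>)"
      "\<forall>V\<in>\<V>. restr (subsheaf \<M> \<K>) (\<Union>\<V>) V t = restr \<M> U V s"
    using conjunct2[OF sheaf[unfolded is_sheaf_def], rule_format, of \<V> "\<lambda>V. restr \<M> U V s"] 1 2 by blast
  have tK: "t \<in> \<K> U"
    using t(1) UV by (simp add: subsheaf_def)
  have "s = t"
  proof (rule sheaf_section_eqI[OF M(2) U s])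
    show "t \<in> \<Gamma> \<M> U"
      using tK submodule_sheaf_subset[OF M(1) K U] by blast
    fix x assume "x \<in> U"
    then obtain V where "V \<in> \<V>" "x \<in> V"
      using UV by blast
    then show "\<exists>V. openin X V \<and> x \<in> V \<and> V \<subseteq> U \<and> restr \<M> U V s = restr \<M> U V t"
      using t(2) UV by (intro exI[of _ V]) (auto simp: \<V>_def subsheaf_def)
  qed
  with tK show ?thesis by simp
qed

text \<open>The converse of \<open>submodule_sheaf_local\<close>: gluing takes place in
  \<open>\<M>\<close>, and locality puts the glued section into \<open>\<K>\<close>.\<close>

lemma submodule_sheafI:
  assumes M: "module_presheaf_on X \<O> \<M>" "is_sheaf X \<M>"
    and K: "\<And>U. openin X U \<Longrightarrow> submodule (\<K> U) (sections \<O> U) (sections \<M> U)"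
    and K_restr: "\<And>U V s. openin X U \<Longrightarrow> openin X V \<Longrightarrow> V \<subseteq> U \<Longrightarrow> s \<in> \<K> U \<Longrightarrow> restr \<M> U V s \<in> \<K> V"
    and K_local: "\<And>U s. openin X U \<Longrightarrow> s \<in> \<Gamma> \<M> U \<Longrightarrow>
      (\<And>x. x \<in> U \<Longrightarrow> \<exists>V. openin X V \<and> x \<in> V \<and> V \<subseteq> U \<and> restr \<M> U V s \<in> \<K> V) \<Longrightarrow> s \<in> \<K> U"
  shows "submodule_sheaf X \<O> \<M> \<K>"
proof -
  interpret module_presheaf_on X \<O> \<M> by fact
  have sub: "s \<in> \<Gamma> \<M> U" if "openin X U" "s \<in> \<K> U" for U s
    using left_module.left_submoduleD(1)[OF modules[OF that(1)] K[OF that(1)]] that(2) by blast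
  have "is_sheaf X (subsheaf \<M> \<K>)"
    unfolding is_sheaf_def
  proof (intro conjI allI impI)
    show "is_presheaf X (subsheaf \<M> \<K>)"
      by (auto simp: is_presheaf_def subsheaf_def sub K_restr restr_id restr_restr)
  next
    fix \<V> s
    assume s: "\<forall>V\<in>\<V>. openin X V \<and> s V \<in> \<Gamma> (subsheaf \<M> \<K>) V"
      and eq: "\<forall>V\<in>\<V>. \<forall>W\<in>\<V>. restr (subsheaf \<M> \<K>) V (V \<inter> W) (s V) =
        restr (subsheaf \<M> \<K>) W (V \<inter> W) (s W)"
    have open_Un: "openin X (\<Union>\<V>)"
      using s by (intro openin_Union) auto
    have "\<forall>V\<in>\<V>. openin X V \<and> s V \<in> \<Gamma> \<M> V"
      using s sub by (auto simp: subsheaf_def)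
    moreover have "\<forall>V\<in>\<V>. \<forall>W\<in>\<V>. restr \<M> V (V \<inter> W) (s V) = restr \<M> W (V \<inter> W) (s W)"
      using eq by (simp add: subsheaf_def)
    ultimately have ex1: "\<exists>!t. t \<in> \<Gamma> \<M> (\<Union>\<V>) \<and> (\<forall>V\<in>\<V>. restr \<M> (\<Union>\<V>) V t = s V)"
      using conjunct2[OF M(2)[unfolded is_sheaf_def], rule_format, of \<V> s] by blast
    then obtain t where t: "t \<in> \<Gamma> \<M> (\<Union>\<V>)" "\<forall>V\<in>\<V>. restr \<M> (\<Union>\<V>) V t = s V"
      by blast
    have tK: "t \<in> \<K> (\<Union>\<V>)"
    proof (rule K_local[OF open_Un t(1)])
      fix x assume "x \<in> \<Union>\<V>"
      then obtain V where V: "V \<in> \<V>" "x \<in> V" by blast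
      then show "\<exists>V. openin X V \<and> x \<in> V \<and> V \<subseteq> \<Union>\<V> \<and> restr \<M> (\<Union>\<V>) V t \<in> \<K> V"
        using s t(2) by (intro exI[of _ V]) (auto simp: subsheaf_def)
    qed
    have unique: "t' = t" if "t' \<in> \<K> (\<Union>\<V>)" "\<forall>V\<in>\<V>. restr \<M> (\<Union>\<V>) V t' = s V" for t'
      using ex1 t that sub[OF open_Un] by blast
    show "\<exists>!t. t \<in> \<Gamma> (subsheaf \<M> \<K>) (\<Union>\<V>) \<and>
        (\<forall>V\<in>\<V>. restr (subsheaf \<M> \<K>) (\<Union>\<V>) V t = s V)"
    proof (rule ex1I[of _ t])
      show "t \<in> \<Gamma> (subsheaf \<M> \<K>) (\<Union>\<V>) \<and>
          (\<forall>V\<in>\<V>. restr (subsheaf \<M> \<K>) (\<Union>\<V>) V t = s V)"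
        using tK t(2) by (simp add: subsheaf_def)
    next
      fix t' assume "t' \<in> \<Gamma> (subsheaf \<M> \<K>) (\<Union>\<V>) \<and>
          (\<forall>V\<in>\<V>. restr (subsheaf \<M> \<K>) (\<Union>\<V>) V t' = s V)"
      then show "t' = t"
        by (intro unique) (simp_all add: subsheaf_def)
    qed
  qed
  then show ?thesis
    using K by (simp add: submodule_sheaf_def)
qed

text \<open>Makes \<open>\<M>/\<L>\<close> a subquotient of \<open>\<M>\<close>, with
  \<open>\<M>\<close> itself as the upper submodule.\<close>

lemma submodule_sheaf_carrier:
  assumes "module_presheaf_on X \<O> \<M>" "is_sheaf X \<M>"
  shows "submodule_sheaf X \<O> \<M> (\<lambda>U. \<Gamma> \<M> U)"
proof -
  interpret module_presheaf_on X \<O> \<M> by fact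
  show ?thesis
    by (rule submodule_sheafI[OF assms])
      (auto simp: left_module.carrier_submodule[OF modules] restr_closed)
qed

lemma subsheaf_carrier: "subsheaf \<M> (\<lambda>U. \<Gamma> \<M> U) = \<M>"
  by (simp add: subsheaf_def)

section \<open>Linear combinations of sections\<close>

lemma sections_free_sheaf:
  "f \<in> \<Gamma> (free_sheaf \<O> n) U \<longleftrightarrow> f \<in> (\<Pi>\<^sub>E i\<in>{..<n}. \<Gamma> \<O> U)"
  "\<zero>\<^bsub>sections (free_sheaf \<O> n) U\<^esub> = (\<lambda>i\<in>{..<n}. \<zero>\<^bsub>sections \<O> U\<^esub>)"
  "f \<oplus>\<^bsub>sections (free_sheaf \<O> n) U\<^esub> g = (\<lambda>i\<in>{..<n}. f i \<oplus>\<^bsub>sections \<O> U\<^esub> g i)"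
  "r \<odot>\<^bsub>sections (free_sheaf \<O> n) U\<^esub> f = (\<lambda>i\<in>{..<n}. r \<otimes>\<^bsub>sections \<O> U\<^esub> f i)"
  "restr (free_sheaf \<O> n) U V f = (\<lambda>i\<in>{..<n}. restr \<O> U V (f i))"
  by (simp_all add: free_sheaf_def)

context ring_presheaf_on
begin

lemma left_module_free_sheaf:
  assumes U: "openin X U"
  shows "left_module (sections \<O> U) (sections (free_sheaf \<O> n) U)"
proof -
  interpret ring "sections \<O> U" by (rule rings[OF U])
  let ?F = "sections (free_sheaf \<O> n) U"
  have mem: "f i \<in> \<Gamma> \<O> U" if "f \<in> carrier ?F" "i < n" for f i
    using that by (auto simp: sections_free_sheaf)
  have ext_eq: "(\<lambda>i\<in>{..<n}. h i) = f" if "f \<in> carrier ?F" "\<And>i. i < n \<Longrightarrow> h i = f i" for h f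
    using that by (auto simp: sections_free_sheaf fun_eq_iff restrict_def PiE_def extensional_def)
  have "abelian_group ?F"
  proof (rule abelian_groupI)
    fix f assume f: "f \<in> carrier ?F"
    show "\<zero>\<^bsub>?F\<^esub> \<oplus>\<^bsub>?F\<^esub> f = f"
      unfolding sections_free_sheaf by (rule ext_eq[OF f]) (simp add: mem[OF f])
    show "\<exists>g\<in>carrier ?F. g \<oplus>\<^bsub>?F\<^esub> f = \<zero>\<^bsub>?F\<^esub>"
    proof
      show "(\<lambda>i\<in>{..<n}. \<ominus>\<^bsub>sections \<O> U\<^esub> f i) \<in> carrier ?F"
        using mem[OF f] by (simp add: sections_free_sheaf)
      show "(\<lambda>i\<in>{..<n}. \<ominus>\<^bsub>sections \<O> U\<^esub> f i) \<oplus>\<^bsub>?F\<^esub> f = \<zero>\<^bsub>?F\<^esub>"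
        unfolding sections_free_sheaf by (intro restrict_ext) (simp add: mem[OF f] l_neg)
    qed
  qed (use mem in \<open>auto simp: sections_free_sheaf a_ac intro!: restrict_ext\<close>)
  moreover have "left_module_axioms (sections \<O> U) ?F"
  proof
    show "\<one>\<^bsub>sections \<O> U\<^esub> \<odot>\<^bsub>?F\<^esub> f = f" if f: "f \<in> carrier ?F" for f
      unfolding sections_free_sheaf by (rule ext_eq[OF f]) (simp add: mem[OF f])
  qed (use mem in \<open>auto simp: sections_free_sheaf l_distr r_distr m_assoc intro!: restrict_ext\<close>)
  ultimately show ?thesis
    unfolding left_module_def using ring_axioms by blast
qed

lemma module_presheaf_on_free_sheaf: "module_presheaf_on X \<O> (free_sheaf \<O> n)"
proof (intro module_presheaf_on.intro presheaf_on.intro module_presheaf_on_axioms.intro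
      ring_presheaf_on_axioms)
  show "is_presheaf X (free_sheaf \<O> n)"
    unfolding is_presheaf_def
  proof (intro conjI allI impI ballI)
    show "restr (free_sheaf \<O> n) U U f = f"
      if "openin X U" "f \<in> \<Gamma> (free_sheaf \<O> n) U" for U f
      using that by (auto simp: sections_free_sheaf restr_id fun_eq_iff restrict_def PiE_def extensional_def Pi_iff)
  qed (auto simp: sections_free_sheaf restr_closed restr_restr PiE_iff intro!: restrict_ext)
qed (auto simp: left_module_free_sheaf sections_free_sheaf ring_restr PiE_iff intro!: restrict_ext)

end

context module_presheaf_on
begin

lemma free_hom_0: "free_hom \<M> 0 U s V f = \<zero>\<^bsub>sections \<M> V\<^esub>" if "openin X V"
proof -
  interpret left_module "sections \<O> V" "sections \<M> V" by (rule modules[OF that])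
  show ?thesis
    by (simp add: free_hom_def)
qed

text \<open>The recursion peels off the last summand; most facts on linear combinations are
  inductions on \<open>n\<close> with it instead of manipulations of \<open>finsum\<close>.\<close>

lemma free_hom_closed_and_Suc:
  assumes U: "openin X U" "openin X V" "V \<subseteq> U"
    and s: "\<And>i. i < n \<Longrightarrow> s i \<in> \<Gamma> \<M> U"
    and f: "\<And>i. i < n \<Longrightarrow> f i \<in> \<Gamma> \<O> V"
  shows free_hom_closed: "free_hom \<M> n U s V f \<in> \<Gamma> \<M> V"
    and "n = Suc m \<Longrightarrow> free_hom \<M> n U s V f =
      f m \<odot>\<^bsub>sections \<M> V\<^esub> restr \<M> U V (s m) \<oplus>\<^bsub>sections \<M> V\<^esub> free_hom \<M> m U s V f" (is "PROP ?Suc")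
proof -
  interpret left_module "sections \<O> V" "sections \<M> V" by (rule modules[OF U(2)])
  have *: "f i \<odot>\<^bsub>sections \<M> V\<^esub> restr \<M> U V (s i) \<in> \<Gamma> \<M> V" if "i < n" for i
    using that s f U by (auto intro!: left_smult_closed restr_closed)
  then show "free_hom \<M> n U s V f \<in> \<Gamma> \<M> V"
    unfolding free_hom_def by (intro M.finsum_closed) auto
  show "PROP ?Suc"
    unfolding free_hom_def using * by (simp add: lessThan_Suc)
qed

lemmas free_hom_Suc = free_hom_closed_and_Suc(2)[where n = "Suc n" and m = n for n, OF _ _ _ _ _ refl]

lemma free_hom_cong:
  assumes "openin X U" "openin X V" "V \<subseteq> U"
    and "\<And>i. i < n \<Longrightarrow> s i \<in> \<Gamma> \<M> U"
    and "\<And>i. i < n \<Longrightarrow> f i \<in> \<Gamma> \<O> V"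
    and "\<And>i. i < n \<Longrightarrow> f i = g i" "\<And>i. i < n \<Longrightarrow> s i = t i"
  shows "free_hom \<M> n U s V f = free_hom \<M> n U t V g"
  using assms(4-)
proof (induction n)
  case (Suc n)
  then have "free_hom \<M> n U s V f = free_hom \<M> n U t V g"
    by simp
  moreover have "f n = g n" "s n = t n"
    using Suc.prems by auto
  moreover have "\<And>i. i < Suc n \<Longrightarrow> g i \<in> \<Gamma> \<O> V"
    "\<And>i. i < Suc n \<Longrightarrow> t i \<in> \<Gamma> \<M> U"
    using Suc.prems by metis+
  ultimately show ?case
    using Suc.prems assms(1-3) by (simp add: free_hom_Suc)
qed (simp add: free_hom_0 assms)

lemma free_hom_add:
  assumes U: "openin X U" "openin X V" "V \<subseteq> U"
    and "\<And>i. i < n \<Longrightarrow> s i \<in> \<Gamma> \<M> U"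
    and "\<And>i. i < n \<Longrightarrow> f i \<in> \<Gamma> \<O> V"
    and "\<And>i. i < n \<Longrightarrow> g i \<in> \<Gamma> \<O> V"
    and "\<And>i. i < n \<Longrightarrow> h i = f i \<oplus>\<^bsub>sections \<O> V\<^esub> g i"
  shows "free_hom \<M> n U s V h = free_hom \<M> n U s V f \<oplus>\<^bsub>sections \<M> V\<^esub> free_hom \<M> n U s V g"
proof -
  interpret left_module "sections \<O> V" "sections \<M> V" by (rule modules[OF U(2)])
  show ?thesis
    using assms(4-)
  proof (induction n)
    case (Suc n)
    have c: "free_hom \<M> n U s V f \<in> \<Gamma> \<M> V" "free_hom \<M> n U s V g \<in> \<Gamma> \<M> V"
      "restr \<M> U V (s n) \<in> \<Gamma> \<M> V"
      using Suc.prems U by (auto intro!: free_hom_closed restr_closed)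
    have "free_hom \<M> n U s V h = free_hom \<M> n U s V f \<oplus>\<^bsub>sections \<M> V\<^esub> free_hom \<M> n U s V g"
      using Suc by simp
    moreover have "\<And>i. i < Suc n \<Longrightarrow> h i \<in> \<Gamma> \<O> V"
      using Suc.prems by simp
    ultimately show ?case
      using Suc.prems c U
      by (simp add: free_hom_Suc left_smult_l_distr left_smult_closed M.a_ac)
  qed (simp add: free_hom_0 U)
qed

lemma free_hom_smult:
  assumes U: "openin X U" "openin X V" "V \<subseteq> U" and r: "r \<in> \<Gamma> \<O> V"
    and "\<And>i. i < n \<Longrightarrow> s i \<in> \<Gamma> \<M> U"
    and "\<And>i. i < n \<Longrightarrow> f i \<in> \<Gamma> \<O> V"
    and "\<And>i. i < n \<Longrightarrow> h i = r \<otimes>\<^bsub>sections \<O> V\<^esub> f i"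
  shows "free_hom \<M> n U s V h = r \<odot>\<^bsub>sections \<M> V\<^esub> free_hom \<M> n U s V f"
proof -
  interpret left_module "sections \<O> V" "sections \<M> V" by (rule modules[OF U(2)])
  show ?thesis
    using assms(5-)
  proof (induction n)
    case (Suc n)
    have c: "free_hom \<M> n U s V f \<in> \<Gamma> \<M> V"
      "restr \<M> U V (s n) \<in> \<Gamma> \<M> V"
      using Suc.prems U by (auto intro!: free_hom_closed restr_closed)
    have "free_hom \<M> n U s V h = r \<odot>\<^bsub>sections \<M> V\<^esub> free_hom \<M> n U s V f"
      using Suc by simp
    moreover have "\<And>i. i < Suc n \<Longrightarrow> h i \<in> \<Gamma> \<O> V"
      using Suc.prems r by simp
    ultimately show ?case
      using Suc.prems c U r
      by (simp add: free_hom_Suc left_smult_r_distr left_smult_assoc left_smult_closed)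
  qed (simp add: free_hom_0 U smult_r_null r)
qed

lemma free_hom_zero:
  assumes U: "openin X U" "openin X V" "V \<subseteq> U"
    and s: "\<And>i. i < n \<Longrightarrow> s i \<in> \<Gamma> \<M> U"
    and f: "\<And>i. i < n \<Longrightarrow> f i = \<zero>\<^bsub>sections \<O> V\<^esub>"
  shows "free_hom \<M> n U s V f = \<zero>\<^bsub>sections \<M> V\<^esub>"
proof -
  interpret left_module "sections \<O> V" "sections \<M> V" by (rule modules[OF U(2)])
  \<comment> \<open>Zero coefficients are zero times themselves, so homogeneity applies.\<close>
  have "free_hom \<M> n U s V f = \<zero>\<^bsub>sections \<O> V\<^esub> \<odot>\<^bsub>sections \<M> V\<^esub> free_hom \<M> n U s V f"
    by (rule free_hom_smult[OF U R.zero_closed s]) (simp_all add: f)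
  also have "\<dots> = \<zero>\<^bsub>sections \<M> V\<^esub>"
    by (rule smult_l_null, rule free_hom_closed[OF U s]) (simp_all add: f)
  finally show ?thesis .
qed

lemma free_hom_restr:
  assumes U: "openin X U" "openin X V" "V \<subseteq> U" and W: "openin X W" "W \<subseteq> V"
    and "\<And>i. i < n \<Longrightarrow> s i \<in> \<Gamma> \<M> U"
    and "\<And>i. i < n \<Longrightarrow> f i \<in> \<Gamma> \<O> V"
    and "\<And>i. i < n \<Longrightarrow> g i = restr \<O> V W (f i)"
  shows "restr \<M> V W (free_hom \<M> n U s V f) = free_hom \<M> n U s W g"
  using assms(6-)
proof (induction n)
  case (Suc n)
  have c: "free_hom \<M> n U s V f \<in> \<Gamma> \<M> V"
    "restr \<M> U V (s n) \<in> \<Gamma> \<M> V" "f n \<in> \<Gamma> \<O> V"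
    using Suc.prems U by (auto intro!: free_hom_closed restr_closed)
  have "restr \<M> V W (free_hom \<M> n U s V f) = free_hom \<M> n U s W g"
    using Suc by simp
  moreover have "\<And>i. i < Suc n \<Longrightarrow> g i \<in> \<Gamma> \<O> W"
    using Suc.prems U W by (auto intro: O.restr_closed)
  moreover have "W \<subseteq> U"
    using U W by blast
  ultimately show ?case
    using Suc.prems c U W
    by (simp add: free_hom_Suc restr_add restr_smult restr_restr module_ops_closed)
qed (simp add: free_hom_0 U W restr_zero)

lemma free_hom_restr_generators:
  assumes U: "openin X U" "openin X V" "V \<subseteq> U" "openin X W" "W \<subseteq> V"
    and "\<And>i. i < n \<Longrightarrow> s i \<in> \<Gamma> \<M> U"
    and "\<And>i. i < n \<Longrightarrow> f i \<in> \<Gamma> \<O> W"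
    and "\<And>i. i < n \<Longrightarrow> t i = restr \<M> U V (s i)"
  shows "free_hom \<M> n V t W f = free_hom \<M> n U s W f"
  using assms(6-)
proof (induction n)
  case (Suc n)
  have "free_hom \<M> n V t W f = free_hom \<M> n U s W f"
    using Suc by simp
  moreover have "\<And>i. i < Suc n \<Longrightarrow> t i \<in> \<Gamma> \<M> V"
    using Suc.prems U by (auto intro: restr_closed)
  moreover have "W \<subseteq> U"
    using U by blast
  ultimately show ?case
    using Suc.prems U by (simp add: free_hom_Suc restr_restr)
qed (simp add: free_hom_0 U)

lemma free_hom_append:
  assumes U: "openin X U" "openin X V" "V \<subseteq> U"
    and "\<And>i. i < n + p \<Longrightarrow> s i \<in> \<Gamma> \<M> U"
    and "\<And>i. i < n + p \<Longrightarrow> f i \<in> \<Gamma> \<O> V"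
  shows "free_hom \<M> (n + p) U s V f = free_hom \<M> n U s V f \<oplus>\<^bsub>sections \<M> V\<^esub>
    free_hom \<M> p U (\<lambda>i. s (n + i)) V (\<lambda>i. f (n + i))"
proof -
  interpret left_module "sections \<O> V" "sections \<M> V" by (rule modules[OF U(2)])
  show ?thesis
    using assms(4-)
  proof (induction p)
    case 0
    then show ?case
      using U by (simp add: free_hom_0 free_hom_closed)
  next
    case (Suc p)
    have c: "free_hom \<M> n U s V f \<in> \<Gamma> \<M> V"
      "free_hom \<M> p U (\<lambda>i. s (n + i)) V (\<lambda>i. f (n + i)) \<in> \<Gamma> \<M> V"
      "f (n + p) \<odot>\<^bsub>sections \<M> V\<^esub> restr \<M> U V (s (n + p)) \<in> \<Gamma> \<M> V"
      using Suc.prems U by (auto intro!: free_hom_closed restr_closed left_smult_closed)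
    have "free_hom \<M> (n + p) U s V f = free_hom \<M> n U s V f \<oplus>\<^bsub>sections \<M> V\<^esub>
        free_hom \<M> p U (\<lambda>i. s (n + i)) V (\<lambda>i. f (n + i))"
      using Suc by simp
    moreover have "free_hom \<M> (n + Suc p) U s V f = f (n + p) \<odot>\<^bsub>sections \<M> V\<^esub> restr \<M> U V (s (n + p))
        \<oplus>\<^bsub>sections \<M> V\<^esub> free_hom \<M> (n + p) U s V f"
      unfolding add_Suc_right by (rule free_hom_Suc[OF U]) (use Suc.prems in auto)
    moreover have "free_hom \<M> (Suc p) U (\<lambda>i. s (n + i)) V (\<lambda>i. f (n + i)) =
        f (n + p) \<odot>\<^bsub>sections \<M> V\<^esub> restr \<M> U V (s (n + p))
        \<oplus>\<^bsub>sections \<M> V\<^esub> free_hom \<M> p U (\<lambda>i. s (n + i)) V (\<lambda>i. f (n + i))"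
      by (rule free_hom_Suc[OF U]) (use Suc.prems in auto)
    ultimately show ?case
      using c by (simp add: M.a_ac)
  qed
qed

end

text \<open>\<open>\<phi>\<close> is a morphism of modules over the open subsets of
  \<open>U\<close>. It is instantiated with the projection to a quotient sheaf and with the
  truncation of relations to their first components.\<close>

lemma free_hom_morphism:
  assumes A: "module_presheaf_on X \<O> \<A>" and B: "module_presheaf_on X \<O> \<B>"
    and \<phi>_closed: "\<And>V s. openin X V \<Longrightarrow> V \<subseteq> U \<Longrightarrow> s \<in> \<Gamma> \<A> V \<Longrightarrow> \<phi> V s \<in> \<Gamma> \<B> V"
    and \<phi>_add: "\<And>V s t. openin X V \<Longrightarrow> V \<subseteq> U \<Longrightarrow> s \<in> \<Gamma> \<A> V \<Longrightarrow>
      t \<in> \<Gamma> \<A> V \<Longrightarrow> \<phi> V (s \<oplus>\<^bsub>sections \<A> V\<^esub> t) = \<phi> V s \<oplus>\<^bsub>sections \<B> V\<^esub> \<phi> V t"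
    and \<phi>_smult: "\<And>V r s. openin X V \<Longrightarrow> V \<subseteq> U \<Longrightarrow> r \<in> \<Gamma> \<O> V \<Longrightarrow>
      s \<in> \<Gamma> \<A> V \<Longrightarrow> \<phi> V (r \<odot>\<^bsub>sections \<A> V\<^esub> s) = r \<odot>\<^bsub>sections \<B> V\<^esub> \<phi> V s"
    and \<phi>_zero: "\<And>V. openin X V \<Longrightarrow> V \<subseteq> U \<Longrightarrow> \<phi> V \<zero>\<^bsub>sections \<A> V\<^esub> = \<zero>\<^bsub>sections \<B> V\<^esub>"
    and \<phi>_restr: "\<And>V s. openin X V \<Longrightarrow> V \<subseteq> U \<Longrightarrow> s \<in> \<Gamma> \<A> U \<Longrightarrow>
      restr \<B> U V (\<phi> U s) = \<phi> V (restr \<A> U V s)"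
    and U: "openin X U" "openin X V" "V \<subseteq> U"
    and "\<And>i. i < n \<Longrightarrow> s i \<in> \<Gamma> \<A> U"
    and "\<And>i. i < n \<Longrightarrow> f i \<in> \<Gamma> \<O> V"
    and "\<And>i. i < n \<Longrightarrow> t i = \<phi> U (s i)"
  shows "\<phi> V (free_hom \<A> n U s V f) = free_hom \<B> n U t V f"
proof -
  interpret A: module_presheaf_on X \<O> \<A> by fact
  interpret B: module_presheaf_on X \<O> \<B> by fact
  show ?thesis
    using assms(11-)
  proof (induction n)
    case (Suc n)
    have c: "free_hom \<A> n U s V f \<in> \<Gamma> \<A> V"
      "restr \<A> U V (s n) \<in> \<Gamma> \<A> V"
      "f n \<odot>\<^bsub>sections \<A> V\<^esub> restr \<A> U V (s n) \<in> \<Gamma> \<A> V"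
      using Suc.prems U by (auto intro!: A.free_hom_closed A.restr_closed A.module_ops_closed(2))
    have t: "t i \<in> \<Gamma> \<B> U" if "i < Suc n" for i
      using that Suc.prems U \<phi>_closed by auto
    have "\<phi> V (free_hom \<A> (Suc n) U s V f) =
        \<phi> V (f n \<odot>\<^bsub>sections \<A> V\<^esub> restr \<A> U V (s n)) \<oplus>\<^bsub>sections \<B> V\<^esub> \<phi> V (free_hom \<A> n U s V f)"
      using Suc.prems(1,2) U c by (simp add: A.free_hom_Suc \<phi>_add)
    also have "\<phi> V (f n \<odot>\<^bsub>sections \<A> V\<^esub> restr \<A> U V (s n)) = f n \<odot>\<^bsub>sections \<B> V\<^esub> restr \<B> U V (t n)"
      using Suc.prems U c by (simp add: \<phi>_smult \<phi>_restr)
    also have "\<phi> V (free_hom \<A> n U s V f) = free_hom \<B> n U t V f"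
      using Suc by simp
    also have "f n \<odot>\<^bsub>sections \<B> V\<^esub> restr \<B> U V (t n) \<oplus>\<^bsub>sections \<B> V\<^esub> free_hom \<B> n U t V f =
        free_hom \<B> (Suc n) U t V f"
      using Suc.prems(2) U t by (simp add: B.free_hom_Suc)
    finally show ?case .
  qed (simp add: A.free_hom_0 B.free_hom_0 U \<phi>_zero)
qed

context module_presheaf_on
begin

text \<open>Turns the relations between the \<open>s i\<close> into a presheaf of modules of its
  own, to which the lemmas on linear combinations apply.\<close>

lemma module_presheaf_on_free_hom_ker:
  assumes U: "openin X U" and s: "\<And>i. i < n \<Longrightarrow> s i \<in> \<Gamma> \<M> U"
  shows "module_presheaf_on (subtopology X U) \<O> (subsheaf (free_sheaf \<O> n) (free_hom_ker \<O> \<M> n U s))"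
proof (rule module_presheaf_on_subsheaf)
  show "module_presheaf_on (subtopology X U) \<O> (free_sheaf \<O> n)"
    using O.module_presheaf_on_free_sheaf U by (rule module_presheaf_on_subtopology)
next
  fix V assume "openin (subtopology X U) V"
  then have V: "openin X V" "V \<subseteq> U"
    using U by (auto simp: openin_open_subtopology)
  interpret left_module "sections \<O> V" "sections \<M> V" by (rule modules[OF V(1)])
  note F = left_module.left_submoduleI[OF O.left_module_free_sheaf[OF V(1)]]
  show "submodule (free_hom_ker \<O> \<M> n U s V) (sections \<O> V) (sections (free_sheaf \<O> n) V)"
  proof (rule F)
    show "\<zero>\<^bsub>sections (free_sheaf \<O> n) V\<^esub> \<in> free_hom_ker \<O> \<M> n U s V"
      using free_hom_zero[OF U V s] by (simp add: free_hom_ker_def sections_free_sheaf)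
    fix f g assume fg: "f \<in> free_hom_ker \<O> \<M> n U s V" "g \<in> free_hom_ker \<O> \<M> n U s V"
    have "free_hom \<M> n U s V (f \<oplus>\<^bsub>sections (free_sheaf \<O> n) V\<^esub> g) =
        free_hom \<M> n U s V f \<oplus>\<^bsub>sections \<M> V\<^esub> free_hom \<M> n U s V g"
      by (rule free_hom_add[OF U V s]) (use fg in \<open>auto simp: free_hom_ker_def sections_free_sheaf\<close>)
    then show "f \<oplus>\<^bsub>sections (free_sheaf \<O> n) V\<^esub> g \<in> free_hom_ker \<O> \<M> n U s V"
      using fg by (auto simp: free_hom_ker_def sections_free_sheaf)
  next
    fix r f assume rf: "r \<in> \<Gamma> \<O> V" "f \<in> free_hom_ker \<O> \<M> n U s V"
    have "free_hom \<M> n U s V (r \<odot>\<^bsub>sections (free_sheaf \<O> n) V\<^esub> f) =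
        r \<odot>\<^bsub>sections \<M> V\<^esub> free_hom \<M> n U s V f"
      by (rule free_hom_smult[OF U V rf(1) s]) (use rf in \<open>auto simp: free_hom_ker_def sections_free_sheaf\<close>)
    then show "r \<odot>\<^bsub>sections (free_sheaf \<O> n) V\<^esub> f \<in> free_hom_ker \<O> \<M> n U s V"
      using rf by (auto simp: free_hom_ker_def sections_free_sheaf smult_r_null)
  qed (simp add: free_hom_ker_def)
next
  fix V W f assume "openin (subtopology X U) V" "openin (subtopology X U) W" and "W \<subseteq> V"
    and f: "f \<in> free_hom_ker \<O> \<M> n U s V"
  then have V: "openin X V" "V \<subseteq> U" and W: "openin X W" "W \<subseteq> V"
    using U by (auto simp: openin_open_subtopology)
  have fV: "f i \<in> \<Gamma> \<O> V" if "i < n" for i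
    using f that by (auto simp: free_hom_ker_def sections_free_sheaf)
  have "free_hom \<M> n U s W (restr (free_sheaf \<O> n) V W f) = restr \<M> V W (free_hom \<M> n U s V f)"
    by (rule free_hom_restr[OF U V W s fV, symmetric]) (simp_all add: sections_free_sheaf)
  also have "\<dots> = \<zero>\<^bsub>sections \<M> W\<^esub>"
    using f V W by (simp add: free_hom_ker_def restr_zero)
  finally show "restr (free_sheaf \<O> n) V W f \<in> free_hom_ker \<O> \<M> n U s W"
    using fV V W by (simp add: free_hom_ker_def sections_free_sheaf O.restr_closed)
qed

end

section \<open>Quotients by submodule sheaves\<close>

lemma finite_typeE:
  assumes "finite_type X \<O> \<M>" "x \<in> topspace X"
  obtains U n s where "openin X U" "x \<in> U" "\<And>i. i < n \<Longrightarrow> s i \<in> \<Gamma> \<M> U"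
    "\<And>V t y. openin X V \<Longrightarrow> V \<subseteq> U \<Longrightarrow> t \<in> \<Gamma> \<M> V \<Longrightarrow> y \<in> V \<Longrightarrow>
      \<exists>W f. openin X W \<and> y \<in> W \<and> W \<subseteq> V \<and> f \<in> \<Gamma> (free_sheaf \<O> n) W \<and>
        restr \<M> V W t = free_hom \<M> n U s W f"
  using assms unfolding finite_type_def by metis

locale quotient_of_sheaf = module_presheaf_on X \<O> \<M>
  for X :: "'a topology" and \<O> :: "('a, 'r) ring_presheaf" and \<M> :: "('a, 'r, 'm) module_presheaf" +
  fixes \<L> :: "'a set \<Rightarrow> 'm set"
  assumes is_sheaf: "is_sheaf X \<M>" and submodule_sheaf: "submodule_sheaf X \<O> \<M> \<L>"
begin

abbreviation coset :: "'a set \<Rightarrow> 'm \<Rightarrow> 'm set" where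
  "coset U s \<equiv> \<L> U +>\<^bsub>sections \<M> U\<^esub> s"

abbreviation \<Q> :: "('a, 'r, 'm set) module_presheaf" where
  "\<Q> \<equiv> quotient_presheaf \<M> \<L>"

abbreviation \<N> :: "('a, 'r, 'a \<Rightarrow> ('a set \<times> 'm set) set) module_presheaf" where
  "\<N> \<equiv> quotient_sheaf X \<O> \<M> \<L>"

lemma submodule_L: "openin X U \<Longrightarrow> submodule (\<L> U) (sections \<O> U) (sections \<M> U)"
  using submodule_sheaf by (simp add: submodule_sheaf_def)

lemmas L_D = left_module.left_submoduleD[OF modules submodule_L]

lemma L_subset: "openin X U \<Longrightarrow> s \<in> \<L> U \<Longrightarrow> s \<in> \<Gamma> \<M> U"
  using L_D(1) by blast

lemmas L_restr = submodule_sheaf_restr[OF submodule_sheaf]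

lemma coset_in_Q: "openin X U \<Longrightarrow> s \<in> \<Gamma> \<M> U \<Longrightarrow> coset U s \<in> \<Gamma> \<Q> U"
  using quotient_module_carrier[OF modules submodule_L] by (auto simp: quotient_presheaf_def)

lemma Q_cases:
  assumes "openin X U" "A \<in> \<Gamma> \<Q> U"
  obtains s where "s \<in> \<Gamma> \<M> U" "A = coset U s"
  using assms quotient_module_carrier[OF modules submodule_L, OF assms(1,1)]
  by (auto simp: quotient_presheaf_def)

lemma restr_coset:
  assumes U: "openin X U" "openin X V" "V \<subseteq> U" and s: "s \<in> \<Gamma> \<M> U"
  shows "restr \<Q> U V (coset U s) = coset V (restr \<M> U V s)"
proof -
  interpret U: left_module "sections \<O> U" "sections \<M> U" by (rule modules[OF U(1)])
  interpret V: left_module "sections \<O> V" "sections \<M> V" by (rule modules[OF U(2)])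
  have "(\<Union>a\<in>coset U s. coset V (restr \<M> U V a)) = coset V (restr \<M> U V s)"
  proof (rule UN_coset_eq[OF modules[OF U(1)] submodule_L[OF U(1)] s])
    fix b assume b: "b \<in> \<Gamma> \<M> U" and "coset U b = coset U s"
    then have "b \<ominus>\<^bsub>sections \<M> U\<^esub> s \<in> \<L> U"
      using coset_eq_iff[OF modules[OF U(1)] submodule_L[OF U(1)] b s] by simp
    then have "restr \<M> U V (b \<ominus>\<^bsub>sections \<M> U\<^esub> s) \<in> \<L> V"
      by (rule L_restr[OF U])
    then have "restr \<M> U V b \<ominus>\<^bsub>sections \<M> V\<^esub> restr \<M> U V s \<in> \<L> V"
      using b s U by (simp add: a_minus_def restr_add restr_minus)
    then show "coset V (restr \<M> U V b) = coset V (restr \<M> U V s)"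
      using coset_eq_iff[OF modules[OF U(2)] submodule_L[OF U(2)]] b s U by (simp add: restr_closed)
  qed
  then show ?thesis
    by (simp add: quotient_presheaf_def)
qed

lemma coset_add:
  "openin X U \<Longrightarrow> s \<in> \<Gamma> \<M> U \<Longrightarrow> t \<in> \<Gamma> \<M> U \<Longrightarrow>
    coset U s \<oplus>\<^bsub>sections \<Q> U\<^esub> coset U t = coset U (s \<oplus>\<^bsub>sections \<M> U\<^esub> t)"
  using quotient_module_add[OF modules submodule_L] by (simp add: quotient_presheaf_def)

lemma coset_smult:
  "openin X U \<Longrightarrow> r \<in> \<Gamma> \<O> U \<Longrightarrow> t \<in> \<Gamma> \<M> U \<Longrightarrow>
    r \<odot>\<^bsub>sections \<Q> U\<^esub> coset U t = coset U (r \<odot>\<^bsub>sections \<M> U\<^esub> t)"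
  using quotient_module_smult[OF modules submodule_L] by (simp add: quotient_presheaf_def)

lemma coset_zero: "openin X U \<Longrightarrow> \<zero>\<^bsub>sections \<Q> U\<^esub> = coset U \<zero>\<^bsub>sections \<M> U\<^esub>"
  using quotient_module_zero[OF modules submodule_L] by (simp add: quotient_presheaf_def)

lemma coset_eq_zero_iff:
  "openin X U \<Longrightarrow> s \<in> \<Gamma> \<M> U \<Longrightarrow> coset U s = \<zero>\<^bsub>sections \<Q> U\<^esub> \<longleftrightarrow> s \<in> \<L> U"
  using coset_eq_self_iff[OF modules submodule_L] by (simp add: quotient_presheaf_def quotient_module_def)

sublocale Q: module_presheaf_on X \<O> \<Q>
proof (intro module_presheaf_on.intro presheaf_on.intro module_presheaf_on_axioms.intro
    O.ring_presheaf_on_axioms)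
  show "is_presheaf X \<Q>"
    unfolding is_presheaf_def
  proof (intro conjI allI impI ballI)
    fix U V assume U: "openin X U" "openin X V" "V \<subseteq> U"
    show "restr \<Q> U V \<in> \<Gamma> \<Q> U \<rightarrow> \<Gamma> \<Q> V"
    proof
      fix A assume "A \<in> \<Gamma> \<Q> U"
      then show "restr \<Q> U V A \<in> \<Gamma> \<Q> V"
        by (rule Q_cases[OF U(1)]) (use U in \<open>auto simp: restr_coset intro!: coset_in_Q restr_closed\<close>)
    qed
  next
    fix U A assume U: "openin X U" and "A \<in> \<Gamma> \<Q> U"
    from this(2) show "restr \<Q> U U A = A"
      by (rule Q_cases[OF U(1)]) (use U in \<open>auto simp: restr_coset restr_id\<close>)
  next
    fix U V W A assume U: "openin X U" "openin X V" "openin X W" "W \<subseteq> V" "V \<subseteq> U"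
      and "A \<in> \<Gamma> \<Q> U"
    from this(6) show "restr \<Q> V W (restr \<Q> U V A) = restr \<Q> U W A"
    proof (rule Q_cases[OF U(1)])
      fix s assume "s \<in> \<Gamma> \<M> U" "A = coset U s"
      moreover have "W \<subseteq> U"
        using U by blast
      ultimately show ?thesis
        using U by (simp add: restr_coset restr_closed restr_restr)
    qed
  qed
next
  show "left_module (sections \<O> U) (sections \<Q> U)" if "openin X U" for U
    using left_module_quotient[OF modules submodule_L] that by (simp add: quotient_presheaf_def)
next
  fix U V A B assume U: "openin X U" "openin X V" "V \<subseteq> U"
    and A: "A \<in> \<Gamma> \<Q> U" and B: "B \<in> \<Gamma> \<Q> U"
  obtain a where "a \<in> \<Gamma> \<M> U" "A = coset U a"
    using A by (rule Q_cases[OF U(1)])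
  moreover obtain b where "b \<in> \<Gamma> \<M> U" "B = coset U b"
    using B by (rule Q_cases[OF U(1)])
  ultimately show "restr \<Q> U V (A \<oplus>\<^bsub>sections \<Q> U\<^esub> B) =
      restr \<Q> U V A \<oplus>\<^bsub>sections \<Q> V\<^esub> restr \<Q> U V B"
    using U by (simp add: coset_add restr_coset restr_add restr_closed module_ops_closed)
next
  fix U V r A assume U: "openin X U" "openin X V" "V \<subseteq> U"
    and r: "r \<in> \<Gamma> \<O> U" and A: "A \<in> \<Gamma> \<Q> U"
  obtain a where "a \<in> \<Gamma> \<M> U" "A = coset U a"
    using A by (rule Q_cases[OF U(1)])
  then show "restr \<Q> U V (r \<odot>\<^bsub>sections \<Q> U\<^esub> A) =
      restr \<O> U V r \<odot>\<^bsub>sections \<Q> V\<^esub> restr \<Q> U V A"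
    using U r by (simp add: coset_smult restr_coset restr_smult restr_closed O.restr_closed module_ops_closed)
qed

lemma module_sheaf_N: "module_sheaf X \<O> \<N>"
  unfolding quotient_sheaf_def by (rule Q.module_sheaf_sh)

sublocale N: module_presheaf_on X \<O> \<N>
  by (rule O.module_presheaf_on_sheaf[OF module_sheaf_N])

text \<open>The epimorphism from \<open>\<M>\<close> to \<open>\<M>/\<L>\<close>: passage to cosets,
  followed by the canonical map to the sheafification.\<close>

definition proj :: "'a set \<Rightarrow> 'm \<Rightarrow> 'a \<Rightarrow> ('a set \<times> 'm set) set" where
  "proj U s = Q.to_sh U (coset U s)"

lemma proj_closed: "openin X U \<Longrightarrow> s \<in> \<Gamma> \<M> U \<Longrightarrow> proj U s \<in> \<Gamma> \<N> U"
  unfolding proj_def quotient_sheaf_def by (intro Q.to_sh_closed coset_in_Q)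

lemma proj_add: "openin X U \<Longrightarrow> s \<in> \<Gamma> \<M> U \<Longrightarrow> t \<in> \<Gamma> \<M> U \<Longrightarrow>
    proj U (s \<oplus>\<^bsub>sections \<M> U\<^esub> t) = proj U s \<oplus>\<^bsub>sections \<N> U\<^esub> proj U t"
  unfolding proj_def quotient_sheaf_def
  by (simp add: Q.to_sh_add[symmetric] coset_add coset_in_Q)

lemma proj_smult: "openin X U \<Longrightarrow> r \<in> \<Gamma> \<O> U \<Longrightarrow> s \<in> \<Gamma> \<M> U \<Longrightarrow>
    proj U (r \<odot>\<^bsub>sections \<M> U\<^esub> s) = r \<odot>\<^bsub>sections \<N> U\<^esub> proj U s"
  unfolding proj_def quotient_sheaf_def
  by (simp add: Q.to_sh_smult[symmetric] coset_smult coset_in_Q)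

lemma proj_zero: "openin X U \<Longrightarrow> proj U \<zero>\<^bsub>sections \<M> U\<^esub> = \<zero>\<^bsub>sections \<N> U\<^esub>"
  unfolding proj_def quotient_sheaf_def
  by (simp add: Q.to_sh_zero[symmetric] coset_zero)

lemma restr_proj: "openin X U \<Longrightarrow> openin X V \<Longrightarrow> V \<subseteq> U \<Longrightarrow> s \<in> \<Gamma> \<M> U \<Longrightarrow>
    restr \<N> U V (proj U s) = proj V (restr \<M> U V s)"
  unfolding proj_def quotient_sheaf_def
  by (simp add: Q.restr_to_sh restr_coset coset_in_Q)

text \<open>In the sheafification a class vanishes as soon as it vanishes locally. Since
  \<open>\<L>\<close> is a sheaf, membership in \<open>\<L>\<close> is local as well, so the kernel
  does not exceed \<open>\<L>\<close>.\<close>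

lemma proj_eq_zero_iff:
  assumes U: "openin X U" and s: "s \<in> \<Gamma> \<M> U"
  shows "proj U s = \<zero>\<^bsub>sections \<N> U\<^esub> \<longleftrightarrow> s \<in> \<L> U"
proof -
  have "restr \<Q> U W (coset U s) = \<zero>\<^bsub>sections \<Q> W\<^esub> \<longleftrightarrow> restr \<M> U W s \<in> \<L> W"
    if "openin X W" "W \<subseteq> U" for W
    using that U s by (simp add: restr_coset coset_eq_zero_iff restr_closed)
  then have "proj U s = \<zero>\<^bsub>sections \<N> U\<^esub> \<longleftrightarrow>
      (\<forall>x\<in>U. \<exists>W. openin X W \<and> x \<in> W \<and> W \<subseteq> U \<and> restr \<M> U W s \<in> \<L> W)"
    unfolding proj_def quotient_sheaf_def Q.to_sh_eq_zero_iff[OF U coset_in_Q[OF U s]] by metis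
  also have "\<dots> \<longleftrightarrow> s \<in> \<L> U"
  proof
    assume "\<forall>x\<in>U. \<exists>W. openin X W \<and> x \<in> W \<and> W \<subseteq> U \<and> restr \<M> U W s \<in> \<L> W"
    then show "s \<in> \<L> U"
      by (intro submodule_sheaf_local[OF module_presheaf_on_axioms is_sheaf submodule_sheaf U s]) blast
  next
    assume "s \<in> \<L> U"
    then show "\<forall>x\<in>U. \<exists>W. openin X W \<and> x \<in> W \<and> W \<subseteq> U \<and> restr \<M> U W s \<in> \<L> W"
      using U restr_id[OF U s] by (intro ballI exI[of _ U]) simp
  qed
  finally show ?thesis .
qed

text \<open>The projection is surjective up to refinement: a section of the sheafification is
  locally given by a coset, and the coset has a representative.\<close>

lemma proj_local:
  assumes U: "openin X U" and \<sigma>: "\<sigma> \<in> \<Gamma> \<N> U" and x: "x \<in> U"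
  obtains V s where "openin X V" "x \<in> V" "V \<subseteq> U" "s \<in> \<Gamma> \<M> V"
    "restr \<N> U V \<sigma> = proj V s"
proof -
  obtain V A where V: "openin X V" "x \<in> V" "V \<subseteq> U" "A \<in> \<Gamma> \<Q> V"
    and eq: "restr \<N> U V \<sigma> = Q.to_sh V A"
    using Q.sh_local[OF \<sigma>[unfolded quotient_sheaf_def] x] unfolding quotient_sheaf_def by metis
  obtain s where "s \<in> \<Gamma> \<M> V" "A = coset V s"
    using V(4) by (rule Q_cases[OF V(1)])
  with V eq that show ?thesis
    unfolding proj_def by blast
qed

text \<open>Translates supports in the quotient into membership of representatives in
  \<open>\<L>\<close>, the form in which (SH) is used.\<close>

lemma supp_proj:
  assumes U: "openin X U" and s: "s \<in> \<Gamma> \<M> U"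
  shows "supp X \<O> \<N> U (proj U s) =
    {x \<in> U. \<not> (\<exists>W. openin X W \<and> x \<in> W \<and> W \<subseteq> U \<and> restr \<M> U W s \<in> \<L> W)}"
proof -
  have "restr \<N> U W (proj U s) = \<zero>\<^bsub>sections \<N> W\<^esub> \<longleftrightarrow> restr \<M> U W s \<in> \<L> W"
    if "openin X W" "W \<subseteq> U" for W
    using that U s by (simp add: restr_proj proj_eq_zero_iff restr_closed)
  then show ?thesis
    unfolding supp_def using N.germ_eq_zero_iff[OF U _ proj_closed[OF U s]] by auto
qed

lemma free_hom_proj:
  assumes U: "openin X U" "openin X V" "V \<subseteq> U"
    and s: "\<And>i. i < n \<Longrightarrow> s i \<in> \<Gamma> \<M> U"
    and f: "\<And>i. i < n \<Longrightarrow> f i \<in> \<Gamma> \<O> V"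
    and t: "\<And>i. i < n \<Longrightarrow> t i = proj U (s i)"
  shows "proj V (free_hom \<M> n U s V f) = free_hom \<N> n U t V f"
  by (rule free_hom_morphism[where \<phi> = proj, OF module_presheaf_on_axioms N.module_presheaf_on_axioms _ _ _ _ _ U s f t])
    (use U in \<open>auto simp: proj_closed proj_add proj_smult proj_zero restr_proj\<close>)

text \<open>The images of local generators of \<open>\<M>\<close> generate, since sections of the
  quotient lift after refinement.\<close>

lemma finite_type_quotient:
  assumes "finite_type X \<O> \<M>"
  shows "finite_type X \<O> \<N>"
  unfolding finite_type_def
proof
  fix x assume x: "x \<in> topspace X"
  obtain U n s where U: "openin X U" "x \<in> U" and s: "\<And>i. i < n \<Longrightarrow> s i \<in> \<Gamma> \<M> U"
    and gen: "\<And>V t y. openin X V \<Longrightarrow> V \<subseteq> U \<Longrightarrow> t \<in> \<Gamma> \<M> V \<Longrightarrow> y \<in> V \<Longrightarrow>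
      \<exists>W f. openin X W \<and> y \<in> W \<and> W \<subseteq> V \<and> f \<in> \<Gamma> (free_sheaf \<O> n) W \<and>
        restr \<M> V W t = free_hom \<M> n U s W f"
    using assms x by (rule finite_typeE) blast
  have gen_N: "\<exists>W f. openin X W \<and> y \<in> W \<and> W \<subseteq> V \<and> f \<in> \<Gamma> (free_sheaf \<O> n) W \<and>
        restr \<N> V W \<sigma> = free_hom \<N> n U (\<lambda>i. proj U (s i)) W f"
    if V: "openin X V" "V \<subseteq> U" and \<sigma>: "\<sigma> \<in> \<Gamma> \<N> V" and y: "y \<in> V" for V \<sigma> y
  proof -
    obtain V' t where V': "openin X V'" "y \<in> V'" "V' \<subseteq> V" and t: "t \<in> \<Gamma> \<M> V'"
      and \<sigma>t: "restr \<N> V V' \<sigma> = proj V' t"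
      using proj_local[OF V(1) \<sigma> y] by metis
    have "V' \<subseteq> U"
      using V' V by blast
    then obtain W f where W: "openin X W" "y \<in> W" "W \<subseteq> V'" and f: "f \<in> \<Gamma> (free_sheaf \<O> n) W"
      and eq: "restr \<M> V' W t = free_hom \<M> n U s W f"
      using gen[OF V'(1) _ t V'(2)] by blast
    have "restr \<N> V W \<sigma> = restr \<N> V' W (restr \<N> V V' \<sigma>)"
      using V V' W \<sigma> by (simp add: N.restr_restr)
    also have "\<dots> = proj W (free_hom \<M> n U s W f)"
      using V' W t by (simp add: \<sigma>t restr_proj eq)
    also have "\<dots> = free_hom \<N> n U (\<lambda>i. proj U (s i)) W f"
      using W V V' f by (intro free_hom_proj[OF U(1) W(1) _ s]) (auto simp: sections_free_sheaf)
    finally show ?thesis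
      using W f V' by blast
  qed
  show "\<exists>U n s. openin X U \<and> x \<in> U \<and> (\<forall>i<n. s i \<in> \<Gamma> \<N> U) \<and>
      (\<forall>V t. openin X V \<longrightarrow> V \<subseteq> U \<longrightarrow> t \<in> \<Gamma> \<N> V \<longrightarrow>
        (\<forall>y\<in>V. \<exists>W f. openin X W \<and> y \<in> W \<and> W \<subseteq> V \<and> f \<in> \<Gamma> (free_sheaf \<O> n) W \<and>
          restr \<N> V W t = free_hom \<N> n U s W f))"
  proof (rule exI[of _ U], rule exI[of _ n], rule exI[of _ "\<lambda>i. proj U (s i)"],
      intro conjI allI impI ballI)
    show "openin X U" "x \<in> U" by (fact U)+
    show "proj U (s i) \<in> \<Gamma> \<N> U" if "i < n" for i
      using U(1) s[OF that] by (rule proj_closed)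
  qed (rule gen_N)
qed

text \<open>Each section lifts near \<open>x\<close>, and finitely many lift together over the
  intersection of the neighbourhoods.\<close>

lemma proj_local_finite:
  fixes n :: nat
  assumes U: "openin X U" "x \<in> U" and \<sigma>: "\<And>i. i < n \<Longrightarrow> \<sigma> i \<in> \<Gamma> \<N> U"
  shows "\<exists>V s. openin X V \<and> x \<in> V \<and> V \<subseteq> U \<and>
    (\<forall>i<n. s i \<in> \<Gamma> \<M> V \<and> restr \<N> U V (\<sigma> i) = proj V (s i))"
  using \<sigma>
proof (induction n)
  case 0
  then show ?case
    using U by auto
next
  case (Suc n)
  obtain V s where V: "openin X V" "x \<in> V" "V \<subseteq> U"
    and s: "\<And>i. i < n \<Longrightarrow> s i \<in> \<Gamma> \<M> V" "\<And>i. i < n \<Longrightarrow> restr \<N> U V (\<sigma> i) = proj V (s i)"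
    using Suc.IH[OF Suc.prems[OF less_SucI]] by blast
  obtain W t where W: "openin X W" "x \<in> W" "W \<subseteq> U" "t \<in> \<Gamma> \<M> W"
    and t: "restr \<N> U W (\<sigma> n) = proj W t"
    using proj_local[OF U(1) Suc.prems[OF lessI] U(2)] by metis
  let ?V = "V \<inter> W"
  have VW: "openin X ?V"
    using V W by (intro openin_Int)
  let ?s = "\<lambda>i. if i < n then restr \<M> V ?V (s i) else restr \<M> W ?V t"
  have "?s i \<in> \<Gamma> \<M> ?V \<and> restr \<N> U ?V (\<sigma> i) = proj ?V (?s i)" if "i < Suc n" for i
  proof (cases "i < n")
    case True
    then have "restr \<N> U ?V (\<sigma> i) = restr \<N> V ?V (restr \<N> U V (\<sigma> i))"
      using U V VW Suc.prems by (simp add: N.restr_restr)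
    then show ?thesis
      using True V VW s by (simp add: restr_proj restr_closed)
  next
    case False
    then have "i = n"
      using that by simp
    moreover have "restr \<N> U ?V (\<sigma> n) = restr \<N> W ?V (restr \<N> U W (\<sigma> n))"
      using U W VW Suc.prems by (simp add: N.restr_restr)
    ultimately show ?thesis
      using W VW t by (simp add: restr_proj restr_closed)
  qed
  then show ?case
    using V(2,3) W(2) VW by (intro exI[of _ ?V] exI[of _ ?s]) auto
qed

end

section \<open>Coherence of quotients by finitely generated submodule sheaves\<close>

text \<open>The image sheaf of the morphism \<open>\<O>\<^sup>p \<rightarrow> \<M>\<close> given by
  the \<open>t i\<close>: being a combination of them is asked only locally, as a sheaf requires.
  The generators are sections over the whole space; for generators over an open set \<open>V\<close>
  the space is \<open>subtopology X V\<close>.\<close>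

definition generated_by ::
    "'a topology \<Rightarrow> ('a, 'r) ring_presheaf \<Rightarrow> ('a, 'r, 'm) module_presheaf \<Rightarrow> nat \<Rightarrow> (nat \<Rightarrow> 'm) \<Rightarrow>
       'a set \<Rightarrow> 'm set" where
  "generated_by X \<O> \<M> p t U = {u \<in> \<Gamma> \<M> U. \<forall>y\<in>U. \<exists>W f. openin X W \<and> y \<in> W \<and> W \<subseteq> U \<and>
     f \<in> \<Gamma> (free_sheaf \<O> p) W \<and> restr \<M> U W u = free_hom \<M> p (topspace X) t W f}"

context module_presheaf_on
begin

lemma free_hom_in_generated_by:
  assumes t: "\<And>i. i < p \<Longrightarrow> t i \<in> \<Gamma> \<M> (topspace X)" and U: "openin X U"
    and f: "\<And>i. i < p \<Longrightarrow> f i \<in> \<Gamma> \<O> U"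
  shows "free_hom \<M> p (topspace X) t U f \<in> generated_by X \<O> \<M> p t U"
proof -
  have U': "U \<subseteq> topspace X"
    using U by (rule openin_subset)
  have c: "free_hom \<M> p (topspace X) t U f \<in> \<Gamma> \<M> U"
    by (rule free_hom_closed[OF openin_topspace U U' t f])
  \<comment> \<open>The coefficients have to be a section of \<open>free_sheaf\<close>, hence an
    extensional function; cutting \<open>f\<close> down to the indices below \<open>p\<close> leaves
    the combination unchanged.\<close>
  have "restr \<M> U U (free_hom \<M> p (topspace X) t U f) =
      free_hom \<M> p (topspace X) t U (\<lambda>i\<in>{..<p}. f i)"
    unfolding restr_id[OF U c] by (rule free_hom_cong[OF openin_topspace U U' t f]) simp_all
  moreover have "(\<lambda>i\<in>{..<p}. f i) \<in> \<Gamma> (free_sheaf \<O> p) U"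
    using f by (simp add: sections_free_sheaf)
  ultimately show ?thesis
    using U c unfolding generated_by_def by blast
qed

lemma generated_by_restr:
  assumes t: "\<And>i. i < p \<Longrightarrow> t i \<in> \<Gamma> \<M> (topspace X)"
    and U: "openin X U" "openin X V" "V \<subseteq> U" and u: "u \<in> generated_by X \<O> \<M> p t U"
  shows "restr \<M> U V u \<in> generated_by X \<O> \<M> p t V"
proof -
  have uc: "u \<in> \<Gamma> \<M> U"
    using u by (simp add: generated_by_def)
  have "\<exists>W f. openin X W \<and> y \<in> W \<and> W \<subseteq> V \<and> f \<in> \<Gamma> (free_sheaf \<O> p) W \<and>
      restr \<M> V W (restr \<M> U V u) = free_hom \<M> p (topspace X) t W f" if y: "y \<in> V" for y
  proof -
    obtain W f where W: "openin X W" "y \<in> W" "W \<subseteq> U" and f: "f \<in> \<Gamma> (free_sheaf \<O> p) W"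
      and eq: "restr \<M> U W u = free_hom \<M> p (topspace X) t W f"
      using u y U(3) unfolding generated_by_def by blast
    let ?W = "W \<inter> V"
    have W': "openin X ?W" "?W \<subseteq> W" "y \<in> ?W" "?W \<subseteq> V"
      using W U y by auto
    have "restr \<M> V ?W (restr \<M> U V u) = restr \<M> W ?W (restr \<M> U W u)"
      using U W W' uc by (simp add: restr_restr)
    also have "\<dots> = free_hom \<M> p (topspace X) t ?W (restr (free_sheaf \<O> p) W ?W f)"
      unfolding eq using f
      by (intro free_hom_restr[OF openin_topspace W(1) openin_subset[OF W(1)] W'(1,2) t])
        (auto simp: sections_free_sheaf)
    finally have "restr \<M> V ?W (restr \<M> U V u) = \<dots>" .
    moreover have "restr (free_sheaf \<O> p) W ?W f \<in> \<Gamma> (free_sheaf \<O> p) ?W"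
      using f W W' by (auto simp: sections_free_sheaf PiE_iff O.restr_closed)
    ultimately show ?thesis
      using W' by blast
  qed
  then show ?thesis
    using restr_closed[OF U uc] by (simp add: generated_by_def)
qed

lemma generated_by_local:
  assumes U: "openin X U" and u: "u \<in> \<Gamma> \<M> U"
    and local: "\<And>x. x \<in> U \<Longrightarrow> \<exists>V. openin X V \<and> x \<in> V \<and> V \<subseteq> U \<and> restr \<M> U V u \<in> generated_by X \<O> \<M> p t V"
  shows "u \<in> generated_by X \<O> \<M> p t U"
proof -
  have "\<exists>W f. openin X W \<and> y \<in> W \<and> W \<subseteq> U \<and> f \<in> \<Gamma> (free_sheaf \<O> p) W \<and>
      restr \<M> U W u = free_hom \<M> p (topspace X) t W f" if y: "y \<in> U" for y
  proof -
    obtain V where V: "openin X V" "y \<in> V" "V \<subseteq> U" and mem: "restr \<M> U V u \<in> generated_by X \<O> \<M> p t V"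
      using local[OF y] by blast
    obtain W f where W: "openin X W" "y \<in> W" "W \<subseteq> V" and f: "f \<in> \<Gamma> (free_sheaf \<O> p) W"
      and eq: "restr \<M> V W (restr \<M> U V u) = free_hom \<M> p (topspace X) t W f"
      using mem V(2) unfolding generated_by_def by blast
    have "restr \<M> U W u = free_hom \<M> p (topspace X) t W f"
      using U V W u eq by (simp add: restr_restr)
    then show ?thesis
      using V W f by blast
  qed
  then show ?thesis
    using u by (simp add: generated_by_def)
qed

lemma submodule_generated_by:
  assumes t: "\<And>i. i < p \<Longrightarrow> t i \<in> \<Gamma> \<M> (topspace X)" and U: "openin X U"
  shows "submodule (generated_by X \<O> \<M> p t U) (sections \<O> U) (sections \<M> U)"
proof (rule left_module.left_submoduleI[OF modules[OF U]])
  interpret left_module "sections \<O> U" "sections \<M> U" by (rule modules[OF U])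
  show "generated_by X \<O> \<M> p t U \<subseteq> \<Gamma> \<M> U"
    by (auto simp: generated_by_def)
  have "\<zero>\<^bsub>sections \<M> U\<^esub> = free_hom \<M> p (topspace X) t U (\<lambda>_. \<zero>\<^bsub>sections \<O> U\<^esub>)"
    by (rule free_hom_zero[OF openin_topspace U openin_subset[OF U] t, symmetric]) simp_all
  then show "\<zero>\<^bsub>sections \<M> U\<^esub> \<in> generated_by X \<O> \<M> p t U"
    using free_hom_in_generated_by[where f = "\<lambda>_. \<zero>\<^bsub>sections \<O> U\<^esub>", OF t U] by simp
next
  interpret left_module "sections \<O> U" "sections \<M> U" by (rule modules[OF U])
  fix u v assume uv: "u \<in> generated_by X \<O> \<M> p t U" "v \<in> generated_by X \<O> \<M> p t U"
  then have c: "u \<in> \<Gamma> \<M> U" "v \<in> \<Gamma> \<M> U"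
    by (auto simp: generated_by_def)
  show "u \<oplus>\<^bsub>sections \<M> U\<^esub> v \<in> generated_by X \<O> \<M> p t U"
  proof (rule generated_by_local[OF U])
    fix x assume x: "x \<in> U"
    obtain V f where V: "openin X V" "x \<in> V" "V \<subseteq> U" and f: "f \<in> \<Gamma> (free_sheaf \<O> p) V"
      and eqf: "restr \<M> U V u = free_hom \<M> p (topspace X) t V f"
      using uv(1) x unfolding generated_by_def by blast
    \<comment> \<open>Restricting \<open>v\<close> to \<open>V\<close> first leads to a
      neighbourhood \<open>W\<close> on which both sections are combinations.\<close>
    have "restr \<M> U V v \<in> generated_by X \<O> \<M> p t V"
      by (rule generated_by_restr[OF t U V(1,3) uv(2)])
    then obtain W g where W: "openin X W" "x \<in> W" "W \<subseteq> V" and g: "g \<in> \<Gamma> (free_sheaf \<O> p) W"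
      and eqg: "restr \<M> V W (restr \<M> U V v) = free_hom \<M> p (topspace X) t W g"
      using V(2) unfolding generated_by_def by blast
    have fW: "restr \<O> V W (f i) \<in> \<Gamma> \<O> W" if "i < p" for i
      using f V W that by (auto simp: sections_free_sheaf O.restr_closed PiE_iff)
    have gW: "g i \<in> \<Gamma> \<O> W" if "i < p" for i
      using g that by (auto simp: sections_free_sheaf)
    have eqf': "restr \<M> V W (restr \<M> U V u) = free_hom \<M> p (topspace X) t W (\<lambda>i. restr \<O> V W (f i))"
      unfolding eqf using f
      by (intro free_hom_restr[OF openin_topspace V(1) openin_subset[OF V(1)] W(1,3) t])
        (auto simp: sections_free_sheaf)
    let ?h = "\<lambda>i. restr \<O> V W (f i) \<oplus>\<^bsub>sections \<O> W\<^esub> g i"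
    have "restr \<M> U W (u \<oplus>\<^bsub>sections \<M> U\<^esub> v) =
        restr \<M> V W (restr \<M> U V u) \<oplus>\<^bsub>sections \<M> W\<^esub> restr \<M> V W (restr \<M> U V v)"
      using U V W c subset_trans[OF W(3) V(3)] by (simp add: restr_restr restr_add)
    also have "\<dots> = free_hom \<M> p (topspace X) t W ?h"
      unfolding eqf' eqg
      by (rule free_hom_add[OF openin_topspace W(1) openin_subset[OF W(1)] t fW gW, symmetric]) simp_all
    also have "\<dots> \<in> generated_by X \<O> \<M> p t W"
      using fW gW W by (intro free_hom_in_generated_by[OF t W(1)]) (simp_all add: O.ring_ops_closed)
    finally show "\<exists>V. openin X V \<and> x \<in> V \<and> V \<subseteq> U \<and>
        restr \<M> U V (u \<oplus>\<^bsub>sections \<M> U\<^esub> v) \<in> generated_by X \<O> \<M> p t V"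
      using W V by blast
  qed (use c in simp)
next
  interpret left_module "sections \<O> U" "sections \<M> U" by (rule modules[OF U])
  fix r u assume r: "r \<in> \<Gamma> \<O> U" and u: "u \<in> generated_by X \<O> \<M> p t U"
  then have c: "u \<in> \<Gamma> \<M> U"
    by (auto simp: generated_by_def)
  show "r \<odot>\<^bsub>sections \<M> U\<^esub> u \<in> generated_by X \<O> \<M> p t U"
  proof (rule generated_by_local[OF U])
    fix x assume x: "x \<in> U"
    obtain V f where V: "openin X V" "x \<in> V" "V \<subseteq> U" and f: "f \<in> \<Gamma> (free_sheaf \<O> p) V"
      and eqf: "restr \<M> U V u = free_hom \<M> p (topspace X) t V f"
      using u x unfolding generated_by_def by blast
    have fV: "f i \<in> \<Gamma> \<O> V" if "i < p" for i
      using f that by (auto simp: sections_free_sheaf)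
    have rV: "restr \<O> U V r \<in> \<Gamma> \<O> V"
      using U V r by (simp add: O.restr_closed)
    let ?h = "\<lambda>i. restr \<O> U V r \<otimes>\<^bsub>sections \<O> V\<^esub> f i"
    have "restr \<M> U V (r \<odot>\<^bsub>sections \<M> U\<^esub> u) =
        restr \<O> U V r \<odot>\<^bsub>sections \<M> V\<^esub> free_hom \<M> p (topspace X) t V f"
      using U V c r by (simp add: restr_smult eqf)
    also have "\<dots> = free_hom \<M> p (topspace X) t V ?h"
      by (rule free_hom_smult[OF openin_topspace V(1) openin_subset[OF V(1)] rV t fV, symmetric]) simp_all
    also have "\<dots> \<in> generated_by X \<O> \<M> p t V"
      using fV rV V by (intro free_hom_in_generated_by[OF t V(1)]) (simp_all add: O.ring_ops_closed)
    finally show "\<exists>V. openin X V \<and> x \<in> V \<and> V \<subseteq> U \<and>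
        restr \<M> U V (r \<odot>\<^bsub>sections \<M> U\<^esub> u) \<in> generated_by X \<O> \<M> p t V"
      using V by blast
  qed (use c r in \<open>simp add: left_smult_closed\<close>)
qed

lemma submodule_sheaf_generated_by:
  assumes "is_sheaf X \<M>" and t: "\<And>i. i < p \<Longrightarrow> t i \<in> \<Gamma> \<M> (topspace X)"
  shows "submodule_sheaf X \<O> \<M> (generated_by X \<O> \<M> p t)"
  by (rule submodule_sheafI[OF module_presheaf_on_axioms assms(1)])
    (auto intro: submodule_generated_by[OF t] generated_by_restr[OF t] generated_by_local)

end

text \<open>A relation between the classes of \<open>s 0, \<dots>, s (n - 1)\<close> modulo the submodule generated by
  \<open>t 0, \<dots>, t (p - 1)\<close> is locally the first part of a relation between all the \<open>s i\<close> and \<open>t j\<close> in \<open>\<M>\<close>.\<close>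

theorem coherent_sheaf_quotient:
  assumes O: "ring_presheaf_on X \<O>" and coh: "coherent_sheaf X \<O> \<M>"
    and t: "\<And>i. i < p \<Longrightarrow> t i \<in> \<Gamma> \<M> (topspace X)"
  shows "coherent_sheaf X \<O> (quotient_sheaf X \<O> \<M> (generated_by X \<O> \<M> p t))"
proof -
  have M: "module_sheaf X \<O> \<M>" "finite_type X \<O> \<M>"
    using coh by (simp_all add: coherent_sheaf_def)
  have sheaf: "is_sheaf X \<M>"
    using M by (simp add: module_sheaf_def)
  interpret O: ring_presheaf_on X \<O> by fact
  interpret module_presheaf_on X \<O> \<M>
    by (rule O.module_presheaf_on_sheaf[OF M(1)])
  let ?L = "generated_by X \<O> \<M> p t"
  interpret quotient_of_sheaf X \<O> \<M> ?L
    by (intro quotient_of_sheaf.intro quotient_of_sheaf_axioms.intro module_presheaf_on_axioms sheaf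
        submodule_sheaf_generated_by[OF sheaf t])
  have "finite_type (subtopology X U) \<O> (subsheaf (free_sheaf \<O> n) (free_hom_ker \<O> \<N> n U \<sigma>))"
    if U: "openin X U" and \<sigma>: "\<And>i. i < n \<Longrightarrow> \<sigma> i \<in> \<Gamma> \<N> U" for U n \<sigma>
    unfolding finite_type_def
  proof
    let ?KN = "free_hom_ker \<O> \<N> n U \<sigma>"
    let ?B = "subsheaf (free_sheaf \<O> n) ?KN"
    fix x assume "x \<in> topspace (subtopology X U)"
    then have x: "x \<in> U"
      by simp
    \<comment> \<open>The \<open>\<sigma> i\<close> lift to \<open>\<M>\<close> only after shrinking
      \<open>U\<close>. Working below \<open>U'\<close> is enough because finite type is tested near
      each point.\<close>
    obtain U' s where U': "openin X U'" "x \<in> U'" "U' \<subseteq> U"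
      and s: "\<And>i. i < n \<Longrightarrow> s i \<in> \<Gamma> \<M> U'"
      and \<sigma>s: "\<And>i. i < n \<Longrightarrow> restr \<N> U U' (\<sigma> i) = proj U' (s i)"
      using proj_local_finite[where n = n and \<sigma> = \<sigma>, OF U x \<sigma>] by blast
    \<comment> \<open>The lifts are followed by the generators of the submodule, at the indices from
      \<open>n\<close> on, so that a relation modulo the submodule can be completed to a relation in
      \<open>\<M>\<close>.\<close>
    define s' where "s' = (\<lambda>i. if i < n then s i else restr \<M> (topspace X) U' (t (i - n)))"
    have s': "s' i \<in> \<Gamma> \<M> U'" if "i < n + p" for i
      using that s t U' openin_subset[OF U'(1)] by (auto simp: s'_def intro!: restr_closed)
    let ?KM = "free_hom_ker \<O> \<M> (n + p) U' s'"
    let ?A = "subsheaf (free_sheaf \<O> (n + p)) ?KM"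
    have lift: "free_hom \<N> n U \<sigma> V h = proj V (free_hom \<M> n U' s V h)"
      if V: "openin X V" "V \<subseteq> U'" and h: "\<And>i. i < n \<Longrightarrow> h i \<in> \<Gamma> \<O> V" for V h
    proof -
      have "proj V (free_hom \<M> n U' s V h) = free_hom \<N> n U' (\<lambda>i. restr \<N> U U' (\<sigma> i)) V h"
        by (rule free_hom_proj[OF U'(1) V s h]) (simp_all add: \<sigma>s)
      also have "\<dots> = free_hom \<N> n U \<sigma> V h"
        by (rule N.free_hom_restr_generators[OF U U'(1,3) V \<sigma> h]) simp_all
      finally show ?thesis by simp
    qed
    \<comment> \<open>Relations between classes become a membership condition in
      \<open>\<M>\<close>, as the kernel of the projection is \<open>?L\<close>.\<close>
    have in_KN_iff: "h \<in> ?KN V \<longleftrightarrow>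
        h \<in> \<Gamma> (free_sheaf \<O> n) V \<and> free_hom \<M> n U' s V h \<in> ?L V"
      if V: "openin X V" "V \<subseteq> U'" for V h
    proof (cases "h \<in> \<Gamma> (free_sheaf \<O> n) V")
      case True
      then have h: "h i \<in> \<Gamma> \<O> V" if "i < n" for i
        using that by (auto simp: sections_free_sheaf)
      show ?thesis
        using True lift[OF V h] proj_eq_zero_iff[OF V(1) free_hom_closed[OF U'(1) V s h]]
        by (simp add: free_hom_ker_def)
    qed (simp add: free_hom_ker_def)
    have split: "free_hom \<M> (n + p) U' s' V f = free_hom \<M> n U' s V f \<oplus>\<^bsub>sections \<M> V\<^esub>
        free_hom \<M> p (topspace X) t V (\<lambda>i. f (n + i))"
      if V: "openin X V" "V \<subseteq> U'" and f: "\<And>i. i < n + p \<Longrightarrow> f i \<in> \<Gamma> \<O> V" for V f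
    proof -
      have "free_hom \<M> n U' s' V f = free_hom \<M> n U' s V f"
        by (rule free_hom_cong[OF U'(1) V]) (use s f in \<open>auto simp: s'_def\<close>)
      moreover have "free_hom \<M> p U' (\<lambda>i. s' (n + i)) V (\<lambda>i. f (n + i)) =
          free_hom \<M> p (topspace X) t V (\<lambda>i. f (n + i))"
        by (rule free_hom_restr_generators[OF openin_topspace U'(1) openin_subset[OF U'(1)] V t])
          (use f in \<open>auto simp: s'_def\<close>)
      ultimately show ?thesis
        using free_hom_append[OF U'(1) V s' f] by simp
    qed
    \<comment> \<open>The last \<open>p\<close> terms of a relation add up to a section of
      \<open>?L\<close>, hence so do the first \<open>n\<close>.\<close>
    have KM_KN: "restrict f {..<n} \<in> ?KN V" if V: "openin X V" "V \<subseteq> U'" and f: "f \<in> ?KM V" for V f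
    proof -
      interpret V: left_module "sections \<O> V" "sections \<M> V" by (rule modules[OF V(1)])
      have fc: "f i \<in> \<Gamma> \<O> V" if "i < n + p" for i
        using f that by (auto simp: free_hom_ker_def sections_free_sheaf)
      let ?w = "free_hom \<M> p (topspace X) t V (\<lambda>i. f (n + i))"
      have w: "?w \<in> ?L V"
        using fc by (intro free_hom_in_generated_by[OF t V(1)]) simp_all
      have "free_hom \<M> n U' s V f \<oplus>\<^bsub>sections \<M> V\<^esub> ?w = \<zero>\<^bsub>sections \<M> V\<^esub>"
        using f split[OF V fc] by (simp add: free_hom_ker_def)
      then have "free_hom \<M> n U' s V f = \<ominus>\<^bsub>sections \<M> V\<^esub> ?w"
        using L_subset[OF V(1) w] free_hom_closed[OF U'(1) V s fc] by (simp add: V.M.minus_equality)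
      moreover have "free_hom \<M> n U' s V (restrict f {..<n}) = free_hom \<M> n U' s V f"
        by (rule free_hom_cong[OF U'(1) V s]) (use fc in auto)
      ultimately have "free_hom \<M> n U' s V (restrict f {..<n}) \<in> ?L V"
        using L_D(5)[OF V(1) V(1) w] by simp
      then show ?thesis
        using fc by (simp add: in_KN_iff[OF V] sections_free_sheaf)
    qed
    \<comment> \<open>Here the coherence of \<open>\<M>\<close> enters: the relations between all
      the \<open>s' i\<close> are locally generated by finitely many \<open>g j\<close>, whose
      truncations will generate the relations between the \<open>\<sigma> i\<close>.\<close>
    have "finite_type (subtopology X U') \<O> ?A"
      using coh U'(1) s' by (simp add: coherent_sheaf_def)
    moreover have "x \<in> topspace (subtopology X U')"
      using U'(2) openin_subset[OF U'(1)] by auto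
    ultimately obtain U'' m g where UU: "openin (subtopology X U') U''" "x \<in> U''"
      and gA: "\<And>j. j < m \<Longrightarrow> g j \<in> \<Gamma> ?A U''"
      and gen: "\<And>V k y. openin (subtopology X U') V \<Longrightarrow> V \<subseteq> U'' \<Longrightarrow> k \<in> \<Gamma> ?A V \<Longrightarrow>
        y \<in> V \<Longrightarrow> \<exists>W c. openin (subtopology X U') W \<and> y \<in> W \<and> W \<subseteq> V \<and>
          c \<in> \<Gamma> (free_sheaf \<O> m) W \<and> restr ?A V W k = free_hom ?A m U'' g W c"
      by (rule finite_typeE) blast
    note sub' = openin_open_subtopology[OF U'(1)]
    have U'': "openin X U''" "x \<in> U''" "U'' \<subseteq> U'"
      using UU by (simp_all add: sub')
    have g: "g j \<in> ?KM U''" if "j < m" for j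
      using gA[OF that] by (simp add: subsheaf_def)
    let ?g = "\<lambda>j. restrict (g j) {..<n}"
    \<comment> \<open>Truncation is a morphism from \<open>?A\<close> to \<open>?B\<close>, once
      \<open>?B\<close> is considered over \<open>U'\<close> instead of \<open>U\<close>, and so
      commutes with linear combinations.\<close>
    have project: "restrict (free_hom ?A m U'' g W c) {..<n} = free_hom ?B m U'' ?g W c"
      if W: "openin X W" "W \<subseteq> U''" and c: "\<And>j. j < m \<Longrightarrow> c j \<in> \<Gamma> \<O> W" for W c
    proof -
      have A: "module_presheaf_on (subtopology X U') \<O> ?A"
        using U'(1) s' by (rule module_presheaf_on_free_hom_ker)
      have "module_presheaf_on (subtopology X U) \<O> ?B"
        using U \<sigma> by (rule N.module_presheaf_on_free_hom_ker)
      then have B: "module_presheaf_on (subtopology X U') \<O> ?B"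
        using module_presheaf_on_subtopology[of "subtopology X U" \<O> ?B U'] U' U
        by (simp add: subtopology_subtopology Int_absorb1 openin_open_subtopology)
      have "openin (subtopology X U') U''" "openin (subtopology X U') W"
        using U'' W by (auto simp: sub')
      then show ?thesis
        using W c g U''
        by (intro free_hom_morphism[where \<phi> = "\<lambda>V f. restrict f {..<n}", OF A B])
          (auto simp: sub' subsheaf_def sections_free_sheaf restrict_def KM_KN[unfolded restrict_def lessThan_iff])
    qed
    have gen_KN: "\<exists>W c. openin X W \<and> y \<in> W \<and> W \<subseteq> V \<and> c \<in> \<Gamma> (free_sheaf \<O> m) W \<and>
        restr (free_sheaf \<O> n) V W h = free_hom ?B m U'' ?g W c"
      if V: "openin X V" "V \<subseteq> U''" and h: "h \<in> ?KN V" and y: "y \<in> V" for V h y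
    proof -
      have VU': "V \<subseteq> U'"
        using V U'' by blast
      have hc: "h i \<in> \<Gamma> \<O> V" if "i < n" for i
        using h that by (auto simp: free_hom_ker_def sections_free_sheaf)
      have "free_hom \<M> n U' s V h \<in> ?L V"
        using h in_KN_iff[OF V(1) VU'] by blast
      then obtain W f where W: "openin X W" "y \<in> W" "W \<subseteq> V" and f: "f \<in> \<Gamma> (free_sheaf \<O> p) W"
        and eq: "restr \<M> V W (free_hom \<M> n U' s V h) = free_hom \<M> p (topspace X) t W f"
        using y unfolding generated_by_def by blast
      interpret W: left_module "sections \<O> W" "sections \<M> W" by (rule modules[OF W(1)])
      have WU': "W \<subseteq> U'" "W \<subseteq> U''" "W \<subseteq> topspace X"
        using W V VU' openin_subset[OF W(1)] by auto
      have fc: "f i \<in> \<Gamma> \<O> W" if "i < p" for i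
        using f that by (auto simp: sections_free_sheaf)
      have hW: "restr \<O> V W (h i) \<in> \<Gamma> \<O> W" if "i < n" for i
        using hc[OF that] V W by (simp add: O.restr_closed)
      \<comment> \<open>Over \<open>W\<close> the combination of the lifts with coefficients
        \<open>h\<close> equals that of the \<open>t i\<close> with coefficients \<open>f\<close>.
        Appending the negatives of the \<open>f i\<close> therefore completes \<open>h\<close> to a
        relation in \<open>\<M>\<close>.\<close>
      define k where "k = (\<lambda>i\<in>{..<n + p}. if i < n then restr \<O> V W (h i) else \<ominus>\<^bsub>sections \<O> W\<^esub> f (i - n))"
      have kc: "k i \<in> \<Gamma> \<O> W" if "i < n + p" for i
        using that hW fc by (auto simp: k_def)
      have "free_hom \<M> n U' s W k = free_hom \<M> p (topspace X) t W f"
        unfolding eq[symmetric]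
        by (rule free_hom_restr[OF U'(1) V(1) VU' W(1,3) s hc, symmetric]) (simp_all add: k_def)
      then have "free_hom \<M> (n + p) U' s' W k = free_hom \<M> p (topspace X) t W f \<oplus>\<^bsub>sections \<M> W\<^esub>
          free_hom \<M> p (topspace X) t W (\<lambda>i. k (n + i))"
        using split[OF W(1) WU'(1) kc] by simp
      also have "\<dots> = free_hom \<M> p (topspace X) t W (\<lambda>i. f i \<oplus>\<^bsub>sections \<O> W\<^esub> k (n + i))"
        by (rule free_hom_add[OF openin_topspace W(1) WU'(3) t fc, symmetric]) (use kc in auto)
      also have "\<dots> = \<zero>\<^bsub>sections \<M> W\<^esub>"
        by (rule free_hom_zero[OF openin_topspace W(1) WU'(3) t]) (use fc in \<open>auto simp: k_def W.R.r_neg\<close>)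
      finally have "k \<in> ?KM W"
        using kc by (simp add: free_hom_ker_def sections_free_sheaf PiE_iff k_def)
      then have "k \<in> \<Gamma> ?A W" "openin (subtopology X U') W"
        using W WU' by (simp_all add: sub' subsheaf_def)
      then obtain W' c where WW: "openin (subtopology X U') W'" "y \<in> W'" "W' \<subseteq> W"
        and c: "c \<in> \<Gamma> (free_sheaf \<O> m) W'" and eqA: "restr ?A W W' k = free_hom ?A m U'' g W' c"
        using gen[OF _ WU'(2) _ W(2)] by blast
      have W': "openin X W'" "y \<in> W'" "W' \<subseteq> W"
        using WW by (simp_all add: sub')
      have eq': "restr (free_sheaf \<O> (n + p)) W W' k = free_hom ?A m U'' g W' c"
        unfolding eqA[symmetric] by (simp add: subsheaf_def)
      have "restr (free_sheaf \<O> n) V W' h = restrict (restr (free_sheaf \<O> (n + p)) W W' k) {..<n}"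
        using V W W' hc by (auto simp: sections_free_sheaf k_def O.restr_restr intro!: restrict_ext)
      also have "\<dots> = free_hom ?B m U'' ?g W' c"
        unfolding eq' using W' WU' c by (intro project) (auto simp: sections_free_sheaf)
      finally show ?thesis
        using W' W c by blast
    qed
    note sub = openin_open_subtopology[OF U]
    have "U'' \<subseteq> U"
      using U' U'' by blast
    show "\<exists>U'' m g. openin (subtopology X U) U'' \<and> x \<in> U'' \<and> (\<forall>j<m. g j \<in> \<Gamma> ?B U'') \<and>
        (\<forall>V h. openin (subtopology X U) V \<longrightarrow> V \<subseteq> U'' \<longrightarrow> h \<in> \<Gamma> ?B V \<longrightarrow>
          (\<forall>y\<in>V. \<exists>W c. openin (subtopology X U) W \<and> y \<in> W \<and> W \<subseteq> V \<and>
            c \<in> \<Gamma> (free_sheaf \<O> m) W \<and> restr ?B V W h = free_hom ?B m U'' g W c))"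
    proof (rule exI[of _ U''], rule exI[of _ m], rule exI[of _ ?g], intro conjI allI impI ballI)
      show "openin (subtopology X U) U''" "x \<in> U''"
        using U'' \<open>U'' \<subseteq> U\<close> by (simp_all add: sub)
      show "?g j \<in> \<Gamma> ?B U''" if "j < m" for j
        using KM_KN[OF U''(1,3) g[OF that]] by (simp add: subsheaf_def)
      fix V h y assume "openin (subtopology X U) V" and V: "V \<subseteq> U''" and "h \<in> \<Gamma> ?B V"
        and y: "y \<in> V"
      then have "openin X V" "h \<in> ?KN V"
        by (simp_all add: sub subsheaf_def)
      then obtain W c where W: "openin X W" "y \<in> W" "W \<subseteq> V" "c \<in> \<Gamma> (free_sheaf \<O> m) W"
        and eq: "restr (free_sheaf \<O> n) V W h = free_hom ?B m U'' ?g W c"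
        using gen_KN[OF _ V _ y] by blast
      moreover have "restr ?B V W h = restr (free_sheaf \<O> n) V W h"
        by (simp add: subsheaf_def)
      moreover have "W \<subseteq> U"
        using W V \<open>U'' \<subseteq> U\<close> by blast
      ultimately show "\<exists>W c. openin (subtopology X U) W \<and> y \<in> W \<and> W \<subseteq> V \<and>
          c \<in> \<Gamma> (free_sheaf \<O> m) W \<and> restr ?B V W h = free_hom ?B m U'' ?g W c"
        unfolding sub by metis
    qed
  qed
  then show ?thesis
    unfolding coherent_sheaf_def using module_sheaf_N finite_type_quotient[OF M(2)] by blast
qed

section \<open>Restriction of coherent sheaves\<close>

lemma is_sheaf_subtopology:
  assumes "is_sheaf X F" and U: "openin X U"
  shows "is_sheaf (subtopology X U) F"
proof -
  have "is_presheaf (subtopology X U) F"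
    using assms(1) U by (simp add: is_sheaf_def is_presheaf_def openin_open_subtopology)
  moreover have "\<exists>!t. t \<in> \<Gamma> F (\<Union>\<V>) \<and> (\<forall>V\<in>\<V>. restr F (\<Union>\<V>) V t = s V)"
    if "\<forall>V\<in>\<V>. openin (subtopology X U) V \<and> s V \<in> \<Gamma> F V"
      "\<forall>V\<in>\<V>. \<forall>W\<in>\<V>. restr F V (V \<inter> W) (s V) = restr F W (V \<inter> W) (s W)" for \<V> s
  proof -
    have "\<forall>V\<in>\<V>. openin X V \<and> s V \<in> \<Gamma> F V"
      using that(1) U by (simp add: openin_open_subtopology)
    then show ?thesis
      using conjunct2[OF assms(1)[unfolded is_sheaf_def], rule_format, of \<V> s] that(2) by blast
  qed
  ultimately show ?thesis
    unfolding is_sheaf_def by blast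
qed

lemma finite_type_subtopology:
  assumes M: "module_presheaf_on X \<O> \<M>" and fin: "finite_type X \<O> \<M>" and U: "openin X U"
  shows "finite_type (subtopology X U) \<O> \<M>"
  unfolding finite_type_def
proof
  interpret module_presheaf_on X \<O> \<M> by (rule M)
  note sub = openin_open_subtopology[OF U]
  fix x assume "x \<in> topspace (subtopology X U)"
  then have x: "x \<in> topspace X" "x \<in> U" by auto
  obtain U' n s where U': "openin X U'" "x \<in> U'"
    and s: "\<And>i. i < n \<Longrightarrow> s i \<in> \<Gamma> \<M> U'"
    and gen: "\<And>V t y. openin X V \<Longrightarrow> V \<subseteq> U' \<Longrightarrow> t \<in> \<Gamma> \<M> V \<Longrightarrow> y \<in> V \<Longrightarrow>
      \<exists>W f. openin X W \<and> y \<in> W \<and> W \<subseteq> V \<and> f \<in> \<Gamma> (free_sheaf \<O> n) W \<and>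
        restr \<M> V W t = free_hom \<M> n U' s W f"
    using fin x(1) by (rule finite_typeE) blast
  let ?U = "U' \<inter> U" and ?s = "\<lambda>i. restr \<M> U' (U' \<inter> U) (s i)"
  have UU: "openin X ?U" "?U \<subseteq> U'"
    using U U' by auto
  show "\<exists>U'' n s. openin (subtopology X U) U'' \<and> x \<in> U'' \<and> (\<forall>i<n. s i \<in> \<Gamma> \<M> U'') \<and>
      (\<forall>V t. openin (subtopology X U) V \<longrightarrow> V \<subseteq> U'' \<longrightarrow> t \<in> \<Gamma> \<M> V \<longrightarrow>
        (\<forall>y\<in>V. \<exists>W f. openin (subtopology X U) W \<and> y \<in> W \<and> W \<subseteq> V \<and>
          f \<in> \<Gamma> (free_sheaf \<O> n) W \<and> restr \<M> V W t = free_hom \<M> n U'' s W f))"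
  proof (rule exI[of _ ?U], rule exI[of _ n], rule exI[of _ ?s], intro conjI allI impI ballI)
    show "openin (subtopology X U) ?U" "x \<in> ?U"
      using UU U' x by (simp_all add: sub)
    show "?s i \<in> \<Gamma> \<M> ?U" if "i < n" for i
      using s[OF that] U' UU by (simp add: restr_closed)
    fix V t y assume V: "openin (subtopology X U) V" "V \<subseteq> ?U" and t: "t \<in> \<Gamma> \<M> V"
      and y: "y \<in> V"
    have "openin X V" "V \<subseteq> U'"
      using V by (simp_all add: sub)
    then obtain W f where W: "openin X W" "y \<in> W" "W \<subseteq> V" and f: "f \<in> \<Gamma> (free_sheaf \<O> n) W"
      and eq: "restr \<M> V W t = free_hom \<M> n U' s W f"
      using gen[OF _ _ t y] by blast
    have WU: "W \<subseteq> ?U"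
      using W V by blast
    have "f i \<in> \<Gamma> \<O> W" if "i < n" for i
      using f that by (auto simp: sections_free_sheaf)
    then have "free_hom \<M> n ?U ?s W f = free_hom \<M> n U' s W f"
      by (intro free_hom_restr_generators[OF U'(1) UU W(1) WU s]) simp_all
    then show "\<exists>W f. openin (subtopology X U) W \<and> y \<in> W \<and> W \<subseteq> V \<and>
        f \<in> \<Gamma> (free_sheaf \<O> n) W \<and> restr \<M> V W t = free_hom \<M> n ?U ?s W f"
      using W WU f eq by (intro exI[of _ W] exI[of _ f]) (simp add: sub)
  qed
qed

text \<open>The condition on relations already ranges over all open sets, so that only subspaces of
  subspaces have to be identified; for finite type the generators are restricted.\<close>

lemma coherent_sheaf_subtopology:
  assumes O: "ring_presheaf_on X \<O>" and coh: "coherent_sheaf X \<O> \<M>" and U: "openin X U"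
  shows "coherent_sheaf (subtopology X U) \<O> \<M>"
proof -
  have M: "module_sheaf X \<O> \<M>" "finite_type X \<O> \<M>"
    and ker: "\<And>V n s. openin X V \<Longrightarrow> (\<forall>i<n. s i \<in> \<Gamma> \<M> V) \<Longrightarrow>
      finite_type (subtopology X V) \<O> (subsheaf (free_sheaf \<O> n) (free_hom_ker \<O> \<M> n V s))"
    using coh by (simp_all add: coherent_sheaf_def)
  have "is_sheaf (subtopology X U) \<M>"
    using M U by (intro is_sheaf_subtopology) (simp_all add: module_sheaf_def)
  then have "module_sheaf (subtopology X U) \<O> \<M>"
    using M(1) U by (simp add: module_sheaf_def openin_open_subtopology)
  moreover have "finite_type (subtopology X U) \<O> \<M>"
    by (rule finite_type_subtopology[OF ring_presheaf_on.module_presheaf_on_sheaf[OF O M(1)] M(2) U])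
  moreover have "finite_type (subtopology (subtopology X U) V) \<O>
      (subsheaf (free_sheaf \<O> n) (free_hom_ker \<O> \<M> n V s))"
    if "openin (subtopology X U) V" "\<forall>i<n. s i \<in> \<Gamma> \<M> V" for V n s
  proof -
    have "openin X V" "V \<subseteq> U"
      using that(1) U by (simp_all add: openin_open_subtopology)
    then show ?thesis
      using ker that(2) by (simp add: subtopology_subtopology Int_absorb1)
  qed
  ultimately show ?thesis
    unfolding coherent_sheaf_def by blast
qed

section \<open>Finite generation at a point\<close>

context module_presheaf_on
begin

lemma free_hom_mem:
  assumes U: "openin X U" "openin X V" "V \<subseteq> U"
    and P: "submodule P (sections \<O> V) (sections \<M> V)"
    and s: "\<And>i. i < n \<Longrightarrow> s i \<in> \<Gamma> \<M> U"
    and "\<And>i. i < n \<Longrightarrow> restr \<M> U V (s i) \<in> P"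
    and "\<And>i. i < n \<Longrightarrow> f i \<in> \<Gamma> \<O> V"
  shows "free_hom \<M> n U s V f \<in> P"
  using s assms(6-)
proof (induction n)
  case 0
  then show ?case
    using left_module.left_submoduleD(2)[OF modules[OF U(2)] P] U by (simp add: free_hom_0)
next
  case (Suc n)
  then have "free_hom \<M> n U s V f \<in> P"
    by simp
  moreover have "f n \<odot>\<^bsub>sections \<M> V\<^esub> restr \<M> U V (s n) \<in> P"
    using Suc.prems by (intro left_module.left_submoduleD(4)[OF modules[OF U(2)] P]) simp_all
  ultimately show ?case
    using left_module.left_submoduleD(3)[OF modules[OF U(2)] P] Suc.prems U by (simp add: free_hom_Suc)
qed

text \<open>Puts each generator into the submodule that it helps to generate.\<close>

lemma free_hom_unit:
  assumes U: "openin X U" "openin X V" "V \<subseteq> U"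
    and s: "\<And>i. i < n \<Longrightarrow> s i \<in> \<Gamma> \<M> U" and "k < n"
  shows "free_hom \<M> n U s V (\<lambda>i. if i = k then \<one>\<^bsub>sections \<O> V\<^esub> else \<zero>\<^bsub>sections \<O> V\<^esub>) = restr \<M> U V (s k)"
    (is "free_hom \<M> n U s V ?e = _")
  using s \<open>k < n\<close>
proof (induction n)
  case (Suc n)
  interpret left_module "sections \<O> V" "sections \<M> V" by (rule modules[OF U(2)])
  have c: "restr \<M> U V (s i) \<in> \<Gamma> \<M> V" if "i < Suc n" for i
    using Suc.prems(1)[OF that] U by (simp add: restr_closed)
  have Suc_eq: "free_hom \<M> (Suc n) U s V ?e =
      ?e n \<odot>\<^bsub>sections \<M> V\<^esub> restr \<M> U V (s n) \<oplus>\<^bsub>sections \<M> V\<^esub> free_hom \<M> n U s V ?e"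
    using Suc.prems(1) by (intro free_hom_Suc[OF U]) simp_all
  show ?case
  proof (cases "k = n")
    case True
    then have "free_hom \<M> n U s V ?e = \<zero>\<^bsub>sections \<M> V\<^esub>"
      using Suc.prems(1) by (intro free_hom_zero[OF U]) simp_all
    then show ?thesis
      unfolding Suc_eq using True c[of n] by (simp add: left_smult_one)
  next
    case False
    then show ?thesis
      unfolding Suc_eq using Suc c[of n] c[of k] by (simp add: smult_l_null)
  qed
qed simp

text \<open>Phrased with a submodule \<open>P\<close> of the stalk, which avoids writing out sums of
  germs.\<close>

lemma germ_free_hom_mem:
  assumes U: "openin X U" "openin X V" "V \<subseteq> U" "x \<in> V"
    and P: "submodule P (stalk_ring X \<O> x) (stalk_module X \<O> \<M> x)"
    and s: "\<And>i. i < n \<Longrightarrow> s i \<in> \<Gamma> \<M> U"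
    and "\<And>i. i < n \<Longrightarrow> germ X \<M> x U (s i) \<in> P"
    and "\<And>i. i < n \<Longrightarrow> f i \<in> \<Gamma> \<O> V"
  shows "germ X \<M> x V (free_hom \<M> n U s V f) \<in> P"
  using s assms(7-)
proof (induction n)
  have "x \<in> topspace X"
    using U openin_subset by blast
  note PD = left_module.left_submoduleD[OF left_module_stalk[OF this] P]
  case 0
  then show ?case
    using PD(2) U by (simp add: free_hom_0 stalk_module_ops(3)[of V])
next
  have "x \<in> topspace X"
    using U openin_subset by blast
  note PD = left_module.left_submoduleD[OF left_module_stalk[OF this] P]
  case (Suc n)
  have c: "restr \<M> U V (s n) \<in> \<Gamma> \<M> V" "f n \<in> \<Gamma> \<O> V"
    "free_hom \<M> n U s V f \<in> \<Gamma> \<M> V"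
    using Suc.prems U by (auto intro!: restr_closed free_hom_closed)
  have "germ X \<O> x V (f n) \<odot>\<^bsub>stalk_module X \<O> \<M> x\<^esub> germ X \<M> x V (restr \<M> U V (s n)) \<in> P"
    using Suc.prems U c
    by (intro PD(4)) (simp_all add: O.carrier_stalk_ring O.germ_in_stalk germ_restr)
  moreover have "germ X \<M> x V (free_hom \<M> n U s V f) \<in> P"
    using Suc by simp
  ultimately have "germ X \<O> x V (f n) \<odot>\<^bsub>stalk_module X \<O> \<M> x\<^esub> germ X \<M> x V (restr \<M> U V (s n))
      \<oplus>\<^bsub>stalk_module X \<O> \<M> x\<^esub> germ X \<M> x V (free_hom \<M> n U s V f) \<in> P"
    by (rule PD(3))
  then show ?case
    using Suc.prems U c by (simp add: stalk_module_ops module_ops_closed free_hom_Suc)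
qed

text \<open>Stability under restriction allows representatives to be combined on the intersection of
  their domains. It is applied to the union of the chain, which need not be a sheaf, and to the
  submodule generated by finitely many sections.\<close>

lemma submodule_germs:
  assumes V: "openin X V" "x \<in> V"
    and P: "\<And>W. openin X W \<Longrightarrow> W \<subseteq> V \<Longrightarrow> submodule (P W) (sections \<O> W) (sections \<M> W)"
    and P_restr: "\<And>W W' u. openin X W \<Longrightarrow> W \<subseteq> V \<Longrightarrow> openin X W' \<Longrightarrow> W' \<subseteq> W \<Longrightarrow> u \<in> P W \<Longrightarrow>
      restr \<M> W W' u \<in> P W'"
  shows "submodule {germ X \<M> x W u | W u. openin X W \<and> x \<in> W \<and> W \<subseteq> V \<and> u \<in> P W}
    (stalk_ring X \<O> x) (stalk_module X \<O> \<M> x)" (is "submodule ?H _ _")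
proof -
  have x: "x \<in> topspace X"
    using V openin_subset by blast
  note PD = left_module.left_submoduleD[OF modules P]
  have sub: "u \<in> \<Gamma> \<M> W" if "openin X W" "W \<subseteq> V" "u \<in> P W" for W u
    using PD(1)[OF that(1,1,2)] that(3) by blast
  have HI: "germ X \<M> x W u \<in> ?H" if "openin X W" "x \<in> W" "W \<subseteq> V" "u \<in> P W" for W u
    using that by blast
  show ?thesis
  proof (rule left_module.left_submoduleI[OF left_module_stalk[OF x]])
    show "?H \<subseteq> carrier (stalk_module X \<O> \<M> x)"
      using sub by (auto simp: carrier_stalk_module intro: germ_in_stalk)
    show "\<zero>\<^bsub>stalk_module X \<O> \<M> x\<^esub> \<in> ?H"
      unfolding stalk_module_ops(3)[OF V] using V PD(2)[OF V(1,1)] by (intro HI) simp_all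
  next
    fix A B assume "A \<in> ?H" "B \<in> ?H"
    then obtain W u W' v where W: "openin X W" "x \<in> W" "W \<subseteq> V" "u \<in> P W" and A: "A = germ X \<M> x W u"
      and W': "openin X W'" "x \<in> W'" "W' \<subseteq> V" "v \<in> P W'" and B: "B = germ X \<M> x W' v"
      by blast
    let ?W = "W \<inter> W'"
    have WW: "openin X ?W" "x \<in> ?W" "?W \<subseteq> V" "?W \<subseteq> W" "?W \<subseteq> W'"
      using W W' by auto
    have uv: "restr \<M> W ?W u \<in> P ?W" "restr \<M> W' ?W v \<in> P ?W"
      using W W' WW by (auto intro!: P_restr)
    have "A \<oplus>\<^bsub>stalk_module X \<O> \<M> x\<^esub> B = germ X \<M> x ?W (restr \<M> W ?W u)
        \<oplus>\<^bsub>stalk_module X \<O> \<M> x\<^esub> germ X \<M> x ?W (restr \<M> W' ?W v)"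
      using W W' WW sub by (simp add: A B germ_restr)
    also have "\<dots> = germ X \<M> x ?W (restr \<M> W ?W u \<oplus>\<^bsub>sections \<M> ?W\<^esub> restr \<M> W' ?W v)"
      using WW uv sub by (simp add: stalk_module_ops)
    also have "\<dots> \<in> ?H"
      using WW PD(3)[OF WW(1,1,3) uv] by (intro HI) simp_all
    finally show "A \<oplus>\<^bsub>stalk_module X \<O> \<M> x\<^esub> B \<in> ?H" .
  next
    fix R B assume R: "R \<in> carrier (stalk_ring X \<O> x)" and "B \<in> ?H"
    then obtain W' v where W': "openin X W'" "x \<in> W'" "W' \<subseteq> V" "v \<in> P W'" and B: "B = germ X \<M> x W' v"
      by blast
    obtain W r where W: "openin X W" "x \<in> W" "r \<in> \<Gamma> \<O> W" and R: "R = germ X \<O> x W r"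
      using R by (auto simp: O.carrier_stalk_ring stalk_def)
    let ?W = "W \<inter> W'"
    have WW: "openin X ?W" "x \<in> ?W" "?W \<subseteq> V" "?W \<subseteq> W" "?W \<subseteq> W'"
      using W W' by auto
    have r: "restr \<O> W ?W r \<in> \<Gamma> \<O> ?W" and v: "restr \<M> W' ?W v \<in> P ?W"
      using W W' WW by (auto intro!: P_restr O.restr_closed)
    have "R \<odot>\<^bsub>stalk_module X \<O> \<M> x\<^esub> B = germ X \<O> x ?W (restr \<O> W ?W r)
        \<odot>\<^bsub>stalk_module X \<O> \<M> x\<^esub> germ X \<M> x ?W (restr \<M> W' ?W v)"
      using W W' WW sub by (simp add: R B germ_restr O.germ_restr)
    also have "\<dots> = germ X \<M> x ?W (restr \<O> W ?W r \<odot>\<^bsub>sections \<M> ?W\<^esub> restr \<M> W' ?W v)"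
      using WW r v sub by (simp add: stalk_module_ops)
    also have "\<dots> \<in> ?H"
      using WW PD(4)[OF WW(1,1,3) r v] by (intro HI) simp_all
    finally show "R \<odot>\<^bsub>stalk_module X \<O> \<M> x\<^esub> B \<in> ?H" .
  qed
qed

text \<open>Finiteness of the set of generating germs allows one index \<open>N\<close> and one
  domain \<open>V\<close> for all of them. The last conclusion concerns a neighbourhood
  \<open>W'\<close> of \<open>x\<close> that depends on \<open>u\<close>.\<close>

lemma chain_locally_generated:
  fixes \<K> :: "nat \<Rightarrow> 'a set \<Rightarrow> 'm set"
  assumes x: "x \<in> topspace X" and noeth: "left_noetherian (stalk_ring X \<O> x)" and fin: "finite_type X \<O> \<M>"
    and K: "\<And>n U. openin X U \<Longrightarrow> submodule (\<K> n U) (sections \<O> U) (sections \<M> U)"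
    and K_restr: "\<And>n U V s. openin X U \<Longrightarrow> openin X V \<Longrightarrow> V \<subseteq> U \<Longrightarrow> s \<in> \<K> n U \<Longrightarrow> restr \<M> U V s \<in> \<K> n V"
    and K_mono: "\<And>n m U. openin X U \<Longrightarrow> n \<le> m \<Longrightarrow> \<K> n U \<subseteq> \<K> m U"
  obtains N V p t where "openin X V" "x \<in> V" "\<And>i. i < p \<Longrightarrow> t i \<in> \<K> N V"
    "\<And>n W u. openin X W \<Longrightarrow> x \<in> W \<Longrightarrow> u \<in> \<K> n W \<Longrightarrow> \<exists>W'. openin X W' \<and> x \<in> W' \<and> W' \<subseteq> W \<inter> V \<and>
      restr \<M> W W' u \<in> generated_by (subtopology X V) \<O> \<M> p t W'"
proof -
  let ?R = "stalk_ring X \<O> x" and ?M = "stalk_module X \<O> \<M> x"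
  interpret S: left_module ?R ?M by (rule left_module_stalk[OF x])
  have sub: "u \<in> \<Gamma> \<M> U" if "openin X U" "u \<in> \<K> n U" for U u n
    using left_module.left_submoduleD(1)[OF modules[OF that(1)] K[OF that(1)]] that(2) by blast
  \<comment> \<open>All germs at \<open>x\<close> of members of the chain, in the shape of
    \<open>submodule_germs\<close> with \<open>topspace X\<close> for \<open>V\<close>.\<close>
  define H where "H = {germ X \<M> x W u | W u. openin X W \<and> x \<in> W \<and> W \<subseteq> topspace X \<and> u \<in> (\<Union>n. \<K> n W)}"
  have "submodule (\<Union>n. \<K> n W) (sections \<O> W) (sections \<M> W)" if W: "openin X W" for W
  proof (rule left_module.left_submoduleI[OF modules[OF W]])
    note KD = left_module.left_submoduleD[OF modules[OF W] K[OF W]]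
    show "(\<Union>n. \<K> n W) \<subseteq> \<Gamma> \<M> W"
      using KD(1) by blast
    show "\<zero>\<^bsub>sections \<M> W\<^esub> \<in> (\<Union>n. \<K> n W)"
      using KD(2) by blast
    show "a \<odot>\<^bsub>sections \<M> W\<^esub> u \<in> (\<Union>n. \<K> n W)" if "a \<in> \<Gamma> \<O> W" "u \<in> (\<Union>n. \<K> n W)" for a u
      using KD(4) that by blast
    fix u v assume "u \<in> (\<Union>n. \<K> n W)" "v \<in> (\<Union>n. \<K> n W)"
    then obtain n m where nm: "u \<in> \<K> n W" "v \<in> \<K> m W" by blast
    then have "u \<in> \<K> (max n m) W" "v \<in> \<K> (max n m) W"
      using K_mono[OF W max.cobounded1[of n m]] K_mono[OF W max.cobounded2[of m n]] by blast+
    then show "u \<oplus>\<^bsub>sections \<M> W\<^esub> v \<in> (\<Union>n. \<K> n W)"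
      using KD(3) by blast
  qed
  then have H: "submodule H ?R ?M"
    unfolding H_def by (intro submodule_germs) (use x in \<open>auto dest: K_restr\<close>)
  obtain U n s where U: "openin X U" "x \<in> U"
    and s: "\<And>i. i < n \<Longrightarrow> s i \<in> \<Gamma> \<M> U"
    and gen: "\<And>V t y. openin X V \<Longrightarrow> V \<subseteq> U \<Longrightarrow> t \<in> \<Gamma> \<M> V \<Longrightarrow> y \<in> V \<Longrightarrow>
      \<exists>W f. openin X W \<and> y \<in> W \<and> W \<subseteq> V \<and> f \<in> \<Gamma> (free_sheaf \<O> n) W \<and>
        restr \<M> V W t = free_hom \<M> n U s W f"
    using fin x by (rule finite_typeE) blast
  let ?S = "(\<lambda>i. germ X \<M> x U (s i)) ` {..<n}"
  have S: "?S \<subseteq> carrier ?M"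
    using U s by (auto simp: carrier_stalk_module intro: germ_in_stalk)
  \<comment> \<open>Finite type of \<open>\<M>\<close> enters here: near \<open>x\<close> every
    section is a combination of the \<open>s i\<close>, so their germs span.\<close>
  have "H \<subseteq> left_span ?R ?M ?S"
  proof
    fix A assume "A \<in> H"
    then obtain W u where W: "openin X W" "x \<in> W" "u \<in> (\<Union>n. \<K> n W)" and A: "A = germ X \<M> x W u"
      unfolding H_def by blast
    then have u: "u \<in> \<Gamma> \<M> W"
      using sub by blast
    have WU: "openin X (W \<inter> U)" "x \<in> W \<inter> U"
      using W U by auto
    then have "restr \<M> W (W \<inter> U) u \<in> \<Gamma> \<M> (W \<inter> U)"
      using W u by (simp add: restr_closed)
    then obtain W' f where W': "openin X W'" "x \<in> W'" "W' \<subseteq> W \<inter> U"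
      and f: "f \<in> \<Gamma> (free_sheaf \<O> n) W'"
      and eq: "restr \<M> (W \<inter> U) W' (restr \<M> W (W \<inter> U) u) = free_hom \<M> n U s W' f"
      using gen[OF WU(1) _ _ WU(2)] by blast
    have "A = germ X \<M> x W' (restr \<M> W W' u)"
      using W W' u by (simp add: A germ_restr)
    also have "restr \<M> W W' u = free_hom \<M> n U s W' f"
      using W W' WU u eq by (simp add: restr_restr)
    also have "germ X \<M> x W' (free_hom \<M> n U s W' f) \<in> left_span ?R ?M ?S"
    proof (rule germ_free_hom_mem[OF U(1) W'(1) _ W'(2) S.submodule_left_span[OF S] s])
      show "germ X \<M> x U (s i) \<in> left_span ?R ?M ?S" if "i < n" for i
        using left_span_superset[of ?S ?R ?M] that by auto
    qed (use W' f in \<open>auto simp: sections_free_sheaf\<close>)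
    finally show "A \<in> left_span ?R ?M ?S" .
  qed
  then have "fg_submodule ?R ?M H"
    using S by (intro fg_submodule_noetherian[OF S.left_module_axioms noeth _ S H]) simp_all
  then obtain F where F: "finite F" "F \<subseteq> H" "H \<subseteq> left_span ?R ?M F"
    unfolding fg_submodule_def by blast
  \<comment> \<open>Generators are added one at a time: the domain is intersected with that of the
    new section, and the index is raised to the larger of the two, which an ascending chain
    permits.\<close>
  have "\<exists>N V p t. openin X V \<and> x \<in> V \<and> (\<forall>i<p. t i \<in> \<K> N V) \<and> F \<subseteq> (\<lambda>i. germ X \<M> x V (t i)) ` {..<p :: nat}"
    using F(1,2)
  proof (induction F rule: finite_induct)
    case empty
    show ?case
      using x by (intro exI[of _ 0] exI[of _ "topspace X"] exI[of _ "0::nat"] exI[of _ undefined]) auto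
  next
    case (insert A F)
    then obtain N V p t where V: "openin X V" "x \<in> V" and t: "\<And>i. i < p \<Longrightarrow> t i \<in> \<K> N V"
      and F: "F \<subseteq> (\<lambda>i. germ X \<M> x V (t i)) ` {..<p :: nat}"
      by auto
    obtain m W u where W: "openin X W" "x \<in> W" "u \<in> \<K> m W" and A: "A = germ X \<M> x W u"
      using insert.prems by (auto simp: H_def)
    let ?V = "V \<inter> W" and ?N = "max N m"
    let ?t = "\<lambda>i. if i < p then restr \<M> V (V \<inter> W) (t i) else restr \<M> W (V \<inter> W) u"
    have VW: "openin X ?V" "x \<in> ?V"
      using V W by auto
    have "?t i \<in> \<K> ?N ?V" for i
      using t V W VW K_restr[OF V(1) VW(1), of "t i" N] K_restr[OF W(1) VW(1), of u m]
        K_mono[OF VW(1), of N ?N] K_mono[OF VW(1), of m ?N] by auto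
    moreover have "insert A F \<subseteq> (\<lambda>i. germ X \<M> x ?V (?t i)) ` {..<Suc p}"
    proof -
      have "A = germ X \<M> x ?V (?t p)"
        using W VW sub[OF W(1,3)] by (simp add: A germ_restr)
      moreover have "germ X \<M> x V (t i) = germ X \<M> x ?V (?t i)" if "i < p" for i
        using that V VW sub[OF V(1) t[OF that]] by (simp add: germ_restr)
      ultimately show ?thesis
        using F by (force simp: lessThan_Suc)
    qed
    ultimately show ?case
      using VW by (intro exI[of _ ?N] exI[of _ ?V] exI[of _ "Suc p"] exI[of _ ?t]) simp
  qed
  then obtain N V p t where V: "openin X V" "x \<in> V" and t: "\<And>i. i < p \<Longrightarrow> t i \<in> \<K> N V"
    and Ft: "F \<subseteq> (\<lambda>i. germ X \<M> x V (t i)) ` {..<p :: nat}"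
    by blast
  have tc: "t i \<in> \<Gamma> \<M> V" if "i < p" for i
    using sub[OF V(1) t[OF that]] .
  have top: "topspace (subtopology X V) = V"
    using openin_subset[OF V(1)] by auto
  note openV = openin_open_subtopology[OF V(1)]
  interpret V: module_presheaf_on "subtopology X V" \<O> \<M>
    using module_presheaf_on_axioms V(1) by (rule module_presheaf_on_subtopology)
  have tV: "t i \<in> \<Gamma> \<M> (topspace (subtopology X V))" if "i < p" for i
    unfolding top by (rule tc[OF that])
  let ?L = "generated_by (subtopology X V) \<O> \<M> p t"
  \<comment> \<open>The germs of sections of \<open>?L\<close> form a submodule of the stalk
    containing the generators \<open>F\<close> of \<open>H\<close>, hence all of
    \<open>H\<close>.\<close>
  let ?G = "{germ X \<M> x W u | W u. openin X W \<and> x \<in> W \<and> W \<subseteq> V \<and> u \<in> ?L W}"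
  have "submodule ?G ?R ?M"
    using V by (intro submodule_germs V.submodule_generated_by V.generated_by_restr tV) (auto simp: openV)
  moreover have "F \<subseteq> ?G"
  proof
    fix A assume "A \<in> F"
    then obtain i where i: "i < p" "A = germ X \<M> x V (t i)"
      using Ft by auto
    let ?e = "\<lambda>j. if j = i then \<one>\<^bsub>sections \<O> V\<^esub> else \<zero>\<^bsub>sections \<O> V\<^esub>"
    have "free_hom \<M> p (topspace (subtopology X V)) t V ?e \<in> ?L V"
      using V(1) by (intro V.free_hom_in_generated_by tV) (simp_all add: openV O.ring_ops_closed)
    moreover have "free_hom \<M> p V t V ?e = t i"
      using free_hom_unit[where s = t, OF V(1,1) subset_refl tc i(1)] restr_id[OF V(1) tc[OF i(1)]] by simp
    ultimately have "t i \<in> ?L V"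
      unfolding top by simp
    then show "A \<in> ?G"
      using V i by blast
  qed
  ultimately have HG: "H \<subseteq> ?G"
    using F(3) left_span_least by (meson subset_trans)
  show thesis
  proof (rule that[OF V t])
    fix n W u assume W: "openin X W" "x \<in> W" and u: "u \<in> \<K> n W"
    have "germ X \<M> x W u \<in> H"
      using W u openin_subset[OF W(1)] unfolding H_def by blast
    with HG have "germ X \<M> x W u \<in> ?G"
      by (rule subsetD)
    then obtain W2 v where W2: "openin X W2" "x \<in> W2" "W2 \<subseteq> V" "v \<in> ?L W2"
      and eq: "germ X \<M> x W u = germ X \<M> x W2 v"
      by blast
    have v: "v \<in> \<Gamma> \<M> W2"
      using W2(4) by (simp add: generated_by_def)
    \<comment> \<open>Equal germs have equal restrictions to some smaller neighbourhood, on which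
      \<open>u\<close> thus becomes a section of \<open>?L\<close>.\<close>
    obtain W' where W': "openin X W'" "x \<in> W'" "W' \<subseteq> W \<inter> W2" "restr \<M> W W' u = restr \<M> W2 W' v"
      using iffD1[OF germ_eq_iff[OF W sub[OF W(1) u] W2(1,2) v] eq] by blast
    have "restr \<M> W2 W' v \<in> ?L W'"
      using W' W2 by (intro V.generated_by_restr[OF tV _ _ _ W2(4)]) (auto simp: openV)
    then show "\<exists>W'. openin X W' \<and> x \<in> W' \<and> W' \<subseteq> W \<inter> V \<and> restr \<M> W W' u \<in> ?L W'"
      using W' W2 by (intro exI[of _ W']) auto
  qed
qed

end

section \<open>Ascending chains\<close>

text \<open>A closed set violating \<open>P\<close> would contain a strictly smaller one violating
  it, and dependent choice would produce a strictly descending sequence.\<close>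

lemma noetherian_closed_induct [consumes 2, case_names less]:
  assumes noeth: "noetherian_space X" and C: "closedin X C"
    and step: "\<And>C. closedin X C \<Longrightarrow> (\<And>D. closedin X D \<Longrightarrow> D \<subset> C \<Longrightarrow> P D) \<Longrightarrow> P C"
  shows "P C"
proof (rule ccontr)
  assume "\<not> P C"
  have "\<exists>f. \<forall>n :: nat. (closedin X (f n) \<and> \<not> P (f n)) \<and> f (Suc n) \<subset> f n"
  proof (rule dependent_nat_choice)
    show "\<exists>C. closedin X C \<and> \<not> P C"
      using C \<open>\<not> P C\<close> by blast
    show "\<exists>D. (closedin X D \<and> \<not> P D) \<and> D \<subset> C" if "closedin X C \<and> \<not> P C" for C and n :: nat
      using step[of C] that by blast
  qed
  then obtain f :: "nat \<Rightarrow> 'a set" where f: "\<And>n. closedin X (f n)" "\<And>n. f (Suc n) \<subset> f n"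
    by blast
  have closed: "\<forall>n. closedin X (f n)" and decreasing: "\<forall>n. f (Suc n) \<subseteq> f n"
    using f by auto
  obtain N where "\<forall>n\<ge>N. f n = f N"
    using mp[OF mp[OF spec[OF noeth[unfolded noetherian_space_def], of f] closed] decreasing] by (rule exE)
  then have "f (Suc N) = f N"
    by (rule allE[of _ "Suc N"]) simp
  with f(2)[of N] show False
    by blast
qed

lemma generic_point_mem_open:
  "X closure_of {x} = C \<Longrightarrow> openin X W \<Longrightarrow> y \<in> W \<Longrightarrow> y \<in> C \<Longrightarrow> x \<in> W"
  by (auto simp: in_closure_of)

text \<open>For an ascending chain of submodule sheaves this says that the stalks of
  \<open>\<K> n\<close> and \<open>\<K> N\<close> agree at the points of \<open>A\<close>, with one
  \<open>N\<close> for all of \<open>A\<close>. It is expressed by sections so that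
  \<open>submodule_sheaf_local\<close> applies directly.\<close>

definition chain_stationary_on ::
    "'a topology \<Rightarrow> ('a, 'r, 'm) module_presheaf \<Rightarrow> (nat \<Rightarrow> 'a set \<Rightarrow> 'm set) \<Rightarrow> 'a set \<Rightarrow> bool" where
  "chain_stationary_on X \<M> \<K> A \<longleftrightarrow> (\<exists>N. \<forall>n\<ge>N. \<forall>y\<in>A. \<forall>W u. openin X W \<longrightarrow> y \<in> W \<longrightarrow> u \<in> \<K> n W \<longrightarrow>
     (\<exists>W'. openin X W' \<and> y \<in> W' \<and> W' \<subseteq> W \<and> restr \<M> W W' u \<in> \<K> N W'))"

locale sheaf_chain = module_presheaf_on X \<O> \<M>
  for X :: "'a topology" and \<O> :: "('a, 'r) ring_presheaf" and \<M> :: "('a, 'r, 'm) module_presheaf" +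
  fixes \<K> :: "nat \<Rightarrow> 'a set \<Rightarrow> 'm set"
  assumes is_sheaf: "is_sheaf X \<M>"
    and chain_submodule_sheaf: "\<And>n. submodule_sheaf X \<O> \<M> (\<K> n)"
    and chain_Suc: "\<And>n U. openin X U \<Longrightarrow> \<K> n U \<subseteq> \<K> (Suc n) U"
begin

lemma chain_mono: "openin X U \<Longrightarrow> n \<le> m \<Longrightarrow> \<K> n U \<subseteq> \<K> m U"
  by (rule lift_Suc_mono_le[of "\<lambda>n. \<K> n U"]) (auto dest: chain_Suc)

lemma chain_submodule: "openin X U \<Longrightarrow> submodule (\<K> n U) (sections \<O> U) (sections \<M> U)"
  using chain_submodule_sheaf by (simp add: submodule_sheaf_def)

lemmas chain_restr = submodule_sheaf_restr[OF chain_submodule_sheaf]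

lemma chain_subset: "openin X U \<Longrightarrow> u \<in> \<K> n U \<Longrightarrow> u \<in> \<Gamma> \<M> U"
  using submodule_sheaf_subset[OF module_presheaf_on_axioms chain_submodule_sheaf] by blast

lemmas chain_local = submodule_sheaf_local[OF module_presheaf_on_axioms is_sheaf chain_submodule_sheaf]

lemma chain_stationary_on_Un:
  assumes "chain_stationary_on X \<M> \<K> A" "chain_stationary_on X \<M> \<K> B"
  shows "chain_stationary_on X \<M> \<K> (A \<union> B)"
proof -
  obtain N where N: "\<And>n y W u. n \<ge> N \<Longrightarrow> y \<in> A \<Longrightarrow> openin X W \<Longrightarrow> y \<in> W \<Longrightarrow> u \<in> \<K> n W \<Longrightarrow>
      \<exists>W'. openin X W' \<and> y \<in> W' \<and> W' \<subseteq> W \<and> restr \<M> W W' u \<in> \<K> N W'"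
    using assms(1) unfolding chain_stationary_on_def by metis
  obtain N' where N': "\<And>n y W u. n \<ge> N' \<Longrightarrow> y \<in> B \<Longrightarrow> openin X W \<Longrightarrow> y \<in> W \<Longrightarrow> u \<in> \<K> n W \<Longrightarrow>
      \<exists>W'. openin X W' \<and> y \<in> W' \<and> W' \<subseteq> W \<and> restr \<M> W W' u \<in> \<K> N' W'"
    using assms(2) unfolding chain_stationary_on_def by metis
  let ?N = "max N N'"
  have "\<exists>W'. openin X W' \<and> y \<in> W' \<and> W' \<subseteq> W \<and> restr \<M> W W' u \<in> \<K> ?N W'"
    if n: "n \<ge> ?N" and y: "y \<in> A \<union> B" and W: "openin X W" "y \<in> W" "u \<in> \<K> n W" for n y W u
  proof (cases "y \<in> A")
    case True
    then obtain W' where "openin X W'" "y \<in> W'" "W' \<subseteq> W" "restr \<M> W W' u \<in> \<K> N W'"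
      using N[OF _ True W] n by auto
    then show ?thesis
      using chain_mono[of W' N ?N] by auto
  next
    case False
    then obtain W' where "openin X W'" "y \<in> W'" "W' \<subseteq> W" "restr \<M> W W' u \<in> \<K> N' W'"
      using N'[OF _ _ W] n y by auto
    then show ?thesis
      using chain_mono[of W' N' ?N] by auto
  qed
  then show ?thesis
    unfolding chain_stationary_on_def by blast
qed

text \<open>Sections of the generated submodule are combinations of the \<open>t i\<close> only
  locally; they lie in \<open>\<K> N\<close> because \<open>\<K> N\<close> is a sheaf.\<close>

lemma generated_by_subset_chain:
  assumes V: "openin X V" and t: "\<And>i. i < p \<Longrightarrow> t i \<in> \<K> N V"
    and W: "openin X W" "W \<subseteq> V"
  shows "generated_by (subtopology X V) \<O> \<M> p t W \<subseteq> \<K> N W"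
proof
  fix u assume u: "u \<in> generated_by (subtopology X V) \<O> \<M> p t W"
  have top: "topspace (subtopology X V) = V"
    using openin_subset[OF V] by auto
  show "u \<in> \<K> N W"
  proof (rule chain_local[OF W(1)])
    show "u \<in> \<Gamma> \<M> W"
      using u by (simp add: generated_by_def)
    fix x assume "x \<in> W"
    then obtain W' f where W': "openin X W'" "x \<in> W'" "W' \<subseteq> W" and f: "f \<in> \<Gamma> (free_sheaf \<O> p) W'"
      and eq: "restr \<M> W W' u = free_hom \<M> p V t W' f"
      using u V unfolding generated_by_def top by (auto simp: openin_open_subtopology)
    have WV: "W' \<subseteq> V"
      using W W' by blast
    have "free_hom \<M> p V t W' f \<in> \<K> N W'"
      using f by (intro free_hom_mem[OF V W'(1) WV chain_submodule[OF W'(1)]])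
        (auto simp: sections_free_sheaf chain_subset[OF V t] chain_restr[OF V W'(1) WV t])
    then show "\<exists>V. openin X V \<and> x \<in> V \<and> V \<subseteq> W \<and> restr \<M> W V u \<in> \<K> N V"
      using W' eq by auto
  qed
qed

text \<open>A neighbourhood of \<open>x\<close> suffices for the induction: what it leaves of
  \<open>C\<close> is a closed set without \<open>x\<close>.\<close>

lemma chain_stationary_near_generic_point:
  assumes coh: "coherent_sheaf X \<O> \<M>"
    and SH: "\<And>U \<N>. openin X U \<Longrightarrow> subquotient_sheaf (subtopology X U) \<O> \<M> \<N> \<Longrightarrow>
      coherent_sheaf (subtopology X U) \<O> \<N> \<Longrightarrow> SH (subtopology X U) \<O> \<N>"
    and x: "x \<in> topspace X" and noeth: "left_noetherian (stalk_ring X \<O> x)"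
    and C: "X closure_of {x} = C"
  shows "\<exists>V. openin X V \<and> x \<in> V \<and> chain_stationary_on X \<M> \<K> (C \<inter> V)"
proof -
  have fin: "finite_type X \<O> \<M>"
    using coh by (simp add: coherent_sheaf_def)
  obtain N V p t where V: "openin X V" "x \<in> V" and t: "\<And>i. i < p \<Longrightarrow> t i \<in> \<K> N V"
    and gen: "\<And>n W u. openin X W \<Longrightarrow> x \<in> W \<Longrightarrow> u \<in> \<K> n W \<Longrightarrow> \<exists>W'. openin X W' \<and> x \<in> W' \<and>
      W' \<subseteq> W \<inter> V \<and> restr \<M> W W' u \<in> generated_by (subtopology X V) \<O> \<M> p t W'"
  proof (rule chain_locally_generated[where \<K> = \<K>, OF x noeth fin])
    show "submodule (\<K> n U) (sections \<O> U) (sections \<M> U)" if "openin X U" for n U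
      using that by (rule chain_submodule)
    show "restr \<M> U V s \<in> \<K> n V" if "openin X U" "openin X V" "V \<subseteq> U" "s \<in> \<K> n U" for n U V s
      using that by (rule chain_restr)
    show "\<K> n U \<subseteq> \<K> m U" if "openin X U" "n \<le> m" for n m U
      using that by (rule chain_mono)
  qed (rule that)
  let ?Y = "subtopology X V"
  let ?L = "generated_by ?Y \<O> \<M> p t"
  let ?N = "quotient_sheaf ?Y \<O> \<M> ?L"
  have top: "topspace ?Y = V"
    using openin_subset[OF V(1)] by auto
  note openY = openin_open_subtopology[OF V(1)]
  interpret Y: module_presheaf_on ?Y \<O> \<M>
    using module_presheaf_on_axioms V(1) by (rule module_presheaf_on_subtopology)
  have sheafY: "is_sheaf ?Y \<M>"
    using is_sheaf V(1) by (rule is_sheaf_subtopology)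
  have tc: "t i \<in> \<Gamma> \<M> (topspace ?Y)" if "i < p" for i
    unfolding top using V(1) t[OF that] by (rule chain_subset)
  interpret q: quotient_of_sheaf ?Y \<O> \<M> ?L
    by (intro quotient_of_sheaf.intro quotient_of_sheaf_axioms.intro Y.module_presheaf_on_axioms sheafY
        Y.submodule_sheaf_generated_by[OF sheafY tc])
  have "coherent_sheaf ?Y \<O> ?N"
    by (rule coherent_sheaf_quotient[OF Y.O.ring_presheaf_on_axioms
          coherent_sheaf_subtopology[OF O.ring_presheaf_on_axioms coh V(1)] tc])
  moreover have "subquotient_sheaf ?Y \<O> \<M> ?N"
    unfolding subquotient_sheaf_def
  proof (intro exI conjI)
    show "submodule_sheaf ?Y \<O> \<M> (\<lambda>U. \<Gamma> \<M> U)"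
      using Y.module_presheaf_on_axioms sheafY by (rule submodule_sheaf_carrier)
    show "\<forall>U. openin ?Y U \<longrightarrow> ?L U \<subseteq> \<Gamma> \<M> U"
      by (auto simp: generated_by_def)
  qed (simp_all add: subsheaf_carrier q.submodule_sheaf)
  ultimately have "SH ?Y \<O> ?N"
    using SH V(1) by blast
  then obtain \<Z> where \<Z>: "finite \<Z>" "\<And>Z. Z \<in> \<Z> \<Longrightarrow> irreducible_closedin ?Y Z"
    and supp: "\<And>U s. openin ?Y U \<Longrightarrow> s \<in> \<Gamma> ?N U \<Longrightarrow>
      \<exists>\<Z>'\<subseteq>\<Z>. supp ?Y \<O> ?N U s = (\<Union>Z\<in>\<Z>'. Z \<inter> U)"
    unfolding SH_def by metis
  define V' where "V' = V - \<Union>{Z \<in> \<Z>. x \<notin> Z}"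
  \<comment> \<open>The finiteness of the family is used here, as an infinite union of closed sets
    need not be closed.\<close>
  have "closedin ?Y (\<Union>{Z \<in> \<Z>. x \<notin> Z})"
    using \<Z> by (intro closedin_Union) (auto simp: irreducible_closedin_def)
  then have "openin ?Y V'"
    unfolding V'_def by (metis openin_diff openin_topspace top)
  then have V': "openin X V'" "V' \<subseteq> V"
    by (simp_all add: openY)
  have xV': "x \<in> V'"
    using V by (simp add: V'_def)
  have in_L: "u \<in> ?L W" if W: "openin X W" "W \<subseteq> V'" "x \<in> W" and u: "u \<in> \<K> n W" for W u n
  proof -
    have WY: "openin ?Y W"
      using W V' by (auto simp: openY)
    have uc: "u \<in> \<Gamma> \<M> W"
      using W(1) u by (rule chain_subset)
    obtain \<Z>' where \<Z>': "\<Z>' \<subseteq> \<Z>" "supp ?Y \<O> ?N W (q.proj W u) = (\<Union>Z\<in>\<Z>'. Z \<inter> W)"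
      using supp[OF WY q.proj_closed[OF WY uc]] by blast
    have "x \<notin> supp ?Y \<O> ?N W (q.proj W u)"
      unfolding q.supp_proj[OF WY uc] using gen[OF W(1,3) u] by (auto simp: openY)
    \<comment> \<open>As \<open>x\<close> lies in \<open>W\<close>, a member of \<open>\<Z>'\<close>
      through \<open>x\<close> would put \<open>x\<close> into the support. All of
      \<open>\<Z>'\<close> therefore belongs to the part of the family removed from
      \<open>V'\<close>, and \<open>W\<close> is contained in \<open>V'\<close>.\<close>
    then have "x \<notin> Z" if "Z \<in> \<Z>'" for Z
      using \<Z>' W(3) that by blast
    then have "supp ?Y \<O> ?N W (q.proj W u) = {}"
      using \<Z>' W(2) unfolding V'_def by blast
    \<comment> \<open>Empty support means that \<open>u\<close> lies in \<open>?L\<close> near every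
      point of \<open>W\<close>, and membership in \<open>?L\<close> is local.\<close>
    then have "\<exists>V. openin ?Y V \<and> y \<in> V \<and> V \<subseteq> W \<and> restr \<M> W V u \<in> ?L V" if "y \<in> W" for y
      using that unfolding q.supp_proj[OF WY uc] by blast
    then show ?thesis
      by (rule Y.generated_by_local[OF WY uc])
  qed
  have "chain_stationary_on X \<M> \<K> (C \<inter> V')"
    unfolding chain_stationary_on_def
  proof (intro exI[of _ N] allI impI ballI)
    fix n y W u assume y: "y \<in> C \<inter> V'" and W: "openin X W" "y \<in> W" and u: "u \<in> \<K> n W"
    let ?W = "W \<inter> V'"
    have WV: "openin X ?W" "?W \<subseteq> V'" "?W \<subseteq> W" "?W \<subseteq> V"
      using W V' by auto
    \<comment> \<open>\<open>y\<close> lies in the closure of \<open>x\<close>, so its neighbourhood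
      \<open>?W\<close> contains \<open>x\<close>; this carries the information at \<open>x\<close>
      over to the other points of \<open>C\<close>.\<close>
    have "x \<in> ?W"
      by (rule generic_point_mem_open[OF C WV(1)]) (use W y in auto)
    moreover have "restr \<M> W ?W u \<in> \<K> n ?W"
      using W WV u by (intro chain_restr) auto
    ultimately have "restr \<M> W ?W u \<in> ?L ?W"
      by (rule in_L[OF WV(1,2)])
    moreover have "?L ?W \<subseteq> \<K> N ?W"
      using V(1) t WV(1,4) by (rule generated_by_subset_chain)
    ultimately have "restr \<M> W ?W u \<in> \<K> N ?W"
      by blast
    then show "\<exists>W'. openin X W' \<and> y \<in> W' \<and> W' \<subseteq> W \<and> restr \<M> W W' u \<in> \<K> N W'"
      using WV W y by (intro exI[of _ ?W]) simp
  qed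
  then show ?thesis
    using V' xV' by blast
qed

text \<open>Local membership at every point becomes membership over each open set because
  \<open>\<K> N\<close> is a sheaf.\<close>

lemma stationary_of_chain_stationary_on:
  assumes "chain_stationary_on X \<M> \<K> (topspace X)"
  shows "\<exists>N. \<forall>n\<ge>N. \<forall>U. openin X U \<longrightarrow> \<K> n U = \<K> N U"
proof -
  obtain N where N: "\<And>n y W u. n \<ge> N \<Longrightarrow> y \<in> topspace X \<Longrightarrow> openin X W \<Longrightarrow> y \<in> W \<Longrightarrow> u \<in> \<K> n W \<Longrightarrow>
      \<exists>W'. openin X W' \<and> y \<in> W' \<and> W' \<subseteq> W \<and> restr \<M> W W' u \<in> \<K> N W'"
    using assms unfolding chain_stationary_on_def by metis
  have "\<K> n U = \<K> N U" if n: "n \<ge> N" and U: "openin X U" for n U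
  proof
    show "\<K> n U \<subseteq> \<K> N U"
    proof
      fix u assume u: "u \<in> \<K> n U"
      show "u \<in> \<K> N U"
      proof (rule chain_local[OF U chain_subset[OF U u]])
        fix x assume "x \<in> U"
        then show "\<exists>V. openin X V \<and> x \<in> V \<and> V \<subseteq> U \<and> restr \<M> U V u \<in> \<K> N V"
          using N[OF n _ U _ u] openin_subset[OF U] by blast
      qed
    qed
    show "\<K> N U \<subseteq> \<K> n U"
      using U n by (rule chain_mono)
  qed
  then show ?thesis by blast
qed

end

theorem proposition6p3:
  fixes X :: "'a topology"
    and \<O> :: "('a, 'r) ring_presheaf"
    and \<M> :: "('a, 'r, 'm) module_presheaf"
    and \<K> :: "nat \<Rightarrow> 'a set \<Rightarrow> 'm set"
  assumes "FT X \<O>"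
    and "coherent_sheaf X \<O> \<M>"
    and "\<And>U \<N>. openin X U \<Longrightarrow> subquotient_sheaf (subtopology X U) \<O> \<M> \<N> \<Longrightarrow>
           coherent_sheaf (subtopology X U) \<O> \<N> \<Longrightarrow> SH (subtopology X U) \<O> \<N>"
    and "\<And>n. submodule_sheaf X \<O> \<M> (\<K> n)"
    and "\<And>n U. openin X U \<Longrightarrow> \<K> n U \<subseteq> \<K> (Suc n) U"
  shows "\<exists>N. \<forall>n\<ge>N. \<forall>U. openin X U \<longrightarrow> \<K> n U = \<K> N U"
proof -
  have ringed: "ringed_space X \<O>" and sober: "sober_space X" and noeth: "noetherian_space X"
    and stalks: "\<And>x. x \<in> topspace X \<Longrightarrow> left_noetherian (stalk_ring X \<O> x)"
    using assms(1) by (simp_all add: FT_def)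
  have M: "module_sheaf X \<O> \<M>"
    using assms(2) by (simp add: coherent_sheaf_def)
  interpret sheaf_chain X \<O> \<M> \<K>
  proof (intro sheaf_chain.intro sheaf_chain_axioms.intro assms(4,5))
    show "module_presheaf_on X \<O> \<M>"
      using ring_presheaf_on_ringed_space[OF ringed] M by (rule ring_presheaf_on.module_presheaf_on_sheaf)
    show "is_sheaf X \<M>"
      using M by (simp add: module_sheaf_def)
  qed
  have "chain_stationary_on X \<M> \<K> C" if "closedin X C" for C
    using noeth that
  proof (induction rule: noetherian_closed_induct)
    case (less C)
    consider "C = {}" | A B where "closedin X A" "closedin X B" "C = A \<union> B" "A \<subset> C" "B \<subset> C"
      | "irreducible_closedin X C"
      using less.hyps unfolding irreducible_closedin_def by blast
    then show ?case
    proof cases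
      case 1
      then show ?thesis
        by (simp add: chain_stationary_on_def)
    next
      case 2
      then show ?thesis
        using less.IH chain_stationary_on_Un by metis
    next
      case 3
      then obtain x where x: "x \<in> C" "X closure_of {x} = C"
        using sober unfolding sober_space_def by blast
      have "x \<in> topspace X"
        using x(1) closedin_subset[OF less.hyps] by blast
      then obtain V where V: "openin X V" "x \<in> V" "chain_stationary_on X \<M> \<K> (C \<inter> V)"
        using chain_stationary_near_generic_point[OF assms(2,3) _ stalks x(2)] by blast
      \<comment> \<open>\<open>C - V\<close> lacks the point \<open>x\<close> of \<open>C\<close>,
        so the induction hypothesis applies to it.\<close>
      have "closedin X (C - V)" "C - V \<subset> C"
        using V x less.hyps by (auto intro: closedin_diff)
      then have "chain_stationary_on X \<M> \<K> (C \<inter> V \<union> (C - V))"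
        using V(3) less.IH chain_stationary_on_Un by blast
      then show ?thesis
        by (simp add: Int_Diff_Un)
    qed
  qed
  then show ?thesis
    using stationary_of_chain_stationary_on closedin_topspace by blast
qed

end
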